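(* Let $n\ge 4$ and $0<p<1$, and consider the Bernoulli random graph $G(n,p)$ on vertex set $\{1,\dots,n\}$ with independent Bernoulli($p$) edge indicators $I_{i,j}=I_{j,i}$, $1\le i<j\le n$. Let $$T=\sum_{i<j}I_{i,j},\qquad V=\sum_{i<j<k}\bigl(I_{i,j}I_{j,k}+I_{i,j}I_{i,k}+I_{j,k}I_{i,k}\bigr),\qquad U=\sum_{i<j<k}I_{i,j}I_{j,k}I_{i,k}$$ be the numbers of edges, 2-stars and triangles, and put $$T_1=\frac{n-2}{n^2}T,\qquad V_1=\frac1{n^2}V,\qquad U_1=\frac1{n^2}U,\qquad W_1=(T_1-\mathbb{E}T_1,\;V_1-\mathbb{E}V_1,\;U_1-\mathbb{E}U_1)^t.$$ Let $$\Sigma_1=3\,\frac{(n-2)\binom n3}{n^4}\,p(1-p)\begin{pmatrix}1&2p&p^2\\ 2p&4p^2+\frac{p(1-p)}{n-2}&2p^3+\frac{p^2(1-p)}{n-2}\\ p^2&2p^3+\frac{p^2(1-p)}{n-2}&p^4+\frac{p^2(1+p-2p^2)}{3(n-2)}\end{pmatrix}$$ (which is the covariance matrix of $W_1$), and let $Z$ be a standard $3$-dimensional normal random vector. Then for every three times differentiable function $h:\mathbb{R}^3\to\mathbb{R}$, $$\bigl|\mathbb{E}h(W_1)-\mathbb{E}h(\Sigma_1^{1/2}Z)\bigr|\le\frac{|h|_2}{n}\left(\frac{35}{4}+9n^{-1}\right)+\frac{8|h|_3}{3n}\left(1+n^{-1}+n^{-2}\right).$$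
   Context: For a symmetric non-negative definite matrix $\Sigma$, $\Sigma^{1/2}$ is its unique symmetric non-negative definite square root. For a sufficiently differentiable $h:\mathbb{R}^3\to\mathbb{R}$, $|h|_2=\sup_{i,j}\sup_{x}\left|\frac{\partial^2 h}{\partial x_i\partial x_j}(x)\right|$ and $|h|_3=\sup_{i,j,k}\sup_x\left|\frac{\partial^3 h}{\partial x_i\partial x_j\partial x_k}(x)\right|$ (values in $[0,\infty]$; the bound is vacuous if the right-hand side is infinite). *)

theory Defs
  imports "HOL-Probability.Probability"
begin

definition pairs :: "nat \<Rightarrow> nat set set" where
  "pairs n = {e. e \<subseteq> {1..n} \<and> card e = 2}"

text \<open>
  The edge indicators are indexed by two-element vertex sets, so that \<open>I {i, j} = I {j, i}\<close>
  holds by construction.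
\<close>

definition bernoulli_random_graph ::
    "'a measure \<Rightarrow> nat \<Rightarrow> real \<Rightarrow> (nat set \<Rightarrow> 'a \<Rightarrow> real) \<Rightarrow> bool" where
  "bernoulli_random_graph M n p I \<longleftrightarrow>
     prob_space M \<and>
     prob_space.indep_vars M (\<lambda>_. borel) I (pairs n) \<and>
     (\<forall>e\<in>pairs n. distr M borel (I e) = distr (measure_pmf (bernoulli_pmf p)) borel of_bool)"

definition edge_count :: "nat \<Rightarrow> (nat set \<Rightarrow> 'a \<Rightarrow> real) \<Rightarrow> 'a \<Rightarrow> real" where
  "edge_count n I \<omega> = (\<Sum>i\<in>{1..n}. \<Sum>j\<in>{i<..n}. I {i, j} \<omega>)"

definition two_star_count :: "nat \<Rightarrow> (nat set \<Rightarrow> 'a \<Rightarrow> real) \<Rightarrow> 'a \<Rightarrow> real" where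
  "two_star_count n I \<omega> = (\<Sum>i\<in>{1..n}. \<Sum>j\<in>{i<..n}. \<Sum>k\<in>{j<..n}.
     I {i, j} \<omega> * I {j, k} \<omega> + I {i, j} \<omega> * I {i, k} \<omega> + I {j, k} \<omega> * I {i, k} \<omega>)"

definition triangle_count :: "nat \<Rightarrow> (nat set \<Rightarrow> 'a \<Rightarrow> real) \<Rightarrow> 'a \<Rightarrow> real" where
  "triangle_count n I \<omega> = (\<Sum>i\<in>{1..n}. \<Sum>j\<in>{i<..n}. \<Sum>k\<in>{j<..n}.
     I {i, j} \<omega> * I {j, k} \<omega> * I {i, k} \<omega>)"

definition T1 :: "nat \<Rightarrow> (nat set \<Rightarrow> 'a \<Rightarrow> real) \<Rightarrow> 'a \<Rightarrow> real" where
  "T1 n I \<omega> = (real n - 2) / real n ^ 2 * edge_count n I \<omega>"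

definition V1 :: "nat \<Rightarrow> (nat set \<Rightarrow> 'a \<Rightarrow> real) \<Rightarrow> 'a \<Rightarrow> real" where
  "V1 n I \<omega> = 1 / real n ^ 2 * two_star_count n I \<omega>"

definition U1 :: "nat \<Rightarrow> (nat set \<Rightarrow> 'a \<Rightarrow> real) \<Rightarrow> 'a \<Rightarrow> real" where
  "U1 n I \<omega> = 1 / real n ^ 2 * triangle_count n I \<omega>"

definition W1 :: "'a measure \<Rightarrow> nat \<Rightarrow> (nat set \<Rightarrow> 'a \<Rightarrow> real) \<Rightarrow> 'a \<Rightarrow> real ^ 3" where
  "W1 M n I \<omega> = vector
     [T1 n I \<omega> - integral\<^sup>L M (T1 n I),
      V1 n I \<omega> - integral\<^sup>L M (V1 n I),
      U1 n I \<omega> - integral\<^sup>L M (U1 n I)]"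

definition Sigma1 :: "nat \<Rightarrow> real \<Rightarrow> real ^ 3 ^ 3" where
  "Sigma1 n p =
     (3 * ((real n - 2) * real (n choose 3) / real n ^ 4) * p * (1 - p)) *\<^sub>R
     vector
       [vector [1, 2 * p, p ^ 2],
        vector [2 * p,
                4 * p ^ 2 + p * (1 - p) / (real n - 2),
                2 * p ^ 3 + p ^ 2 * (1 - p) / (real n - 2)],
        vector [p ^ 2,
                2 * p ^ 3 + p ^ 2 * (1 - p) / (real n - 2),
                p ^ 4 + p ^ 2 * (1 + p - 2 * p ^ 2) / (3 * (real n - 2))]]"

definition covariance_matrix :: "'a measure \<Rightarrow> ('a \<Rightarrow> real ^ 'n) \<Rightarrow> real ^ 'n ^ 'n" where
  "covariance_matrix M X = (\<chi> i j. \<integral>\<omega>.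
     (X \<omega> $ i - (\<integral>\<omega>'. X \<omega>' $ i \<partial>M)) * (X \<omega> $ j - (\<integral>\<omega>'. X \<omega>' $ j \<partial>M)) \<partial>M)"

definition sym_nonneg_definite :: "real ^ 'n ^ 'n \<Rightarrow> bool" where
  "sym_nonneg_definite A \<longleftrightarrow> transpose A = A \<and> (\<forall>x. 0 \<le> x \<bullet> (A *v x))"

definition sqrt_matrix :: "real ^ 'n ^ 'n \<Rightarrow> real ^ 'n ^ 'n" where
  "sqrt_matrix A = (THE R. sym_nonneg_definite R \<and> R ** R = A)"

definition std_normal_vector :: "'b measure \<Rightarrow> ('b \<Rightarrow> real ^ 'n) \<Rightarrow> bool" where
  "std_normal_vector N Z \<longleftrightarrow>
     prob_space N \<and>
     prob_space.indep_vars N (\<lambda>_. borel) (\<lambda>i \<omega>. Z \<omega> $ i) UNIV \<and>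
     (\<forall>i. distributed N lborel (\<lambda>\<omega>. Z \<omega> $ i) std_normal_density)"

definition partial :: "'n \<Rightarrow> (real ^ 'n \<Rightarrow> real) \<Rightarrow> real ^ 'n \<Rightarrow> real" where
  "partial i f x = deriv (\<lambda>t. f (x + t *\<^sub>R axis i 1)) 0"

text \<open>
  \<open>times_differentiable k f\<close>: \<open>f\<close> is \<open>k\<close> times (Frechet) differentiable on the whole space.
  A map into a finite-dimensional space is differentiable iff its components are, so
  differentiability of the derivative of \<open>f\<close> is that of all the partial derivatives of \<open>f\<close>.
\<close>

primrec times_differentiable :: "nat \<Rightarrow> (real ^ 'n \<Rightarrow> real) \<Rightarrow> bool" where
  "times_differentiable 0 f \<longleftrightarrow> True"
| "times_differentiable (Suc k) f \<longleftrightarrow>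
     (\<forall>x. f differentiable (at x)) \<and> (\<forall>i. times_differentiable k (partial i f))"

definition deriv_norm2 :: "(real ^ 'n \<Rightarrow> real) \<Rightarrow> ennreal" where
  "deriv_norm2 h = (SUP i. SUP j. SUP x. ennreal \<bar>partial i (partial j h) x\<bar>)"

definition deriv_norm3 :: "(real ^ 'n \<Rightarrow> real) \<Rightarrow> ennreal" where
  "deriv_norm3 h =
     (SUP i. SUP j. SUP k. SUP x. ennreal \<bar>partial i (partial j (partial k h)) x\<bar>)"

end

theory Submission
  imports Defs "HOL-Real_Asymp.Real_Asymp"
begin

text \<open>
  Write \<open>D e\<close> for the change of the centred statistics \<open>W\<close> when the edge \<open>e\<close> is switched on. Inverting
  the linear regression of the one-edge resampling step gives vectors \<open>X e\<close>, independent of the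
  indicator of \<open>e\<close>, with \<open>W = (\<Sum>e. (I e - p) X e)\<close>. Since \<open>E (I e - p) G = p (1 - p) E (G(e on) - G(e off))\<close>,
  Taylor expansion turns \<open>E W \<bullet> \<nabla>g(W)\<close> into \<open>E A : \<nabla>\<^sup>2g(W)\<close> with \<open>A = p (1 - p) (\<Sum>e. X e \<otimes> D e)\<close> and
  \<open>E A = \<Sigma>\<close>. Changing one edge moves both \<open>A\<close> and \<open>\<nabla>\<^sup>2g(W)\<close> very little, so a telescoping covariance
  inequality replaces \<open>A\<close> by \<open>\<Sigma>\<close> at the cost of third derivatives only.
  Along the rotation \<open>W sin \<theta> + Y cos \<theta>\<close> with \<open>Y = \<Sigma>\<^sup>1\<^sup>/\<^sup>2 Z\<close>, Gaussian integration by parts for \<open>Y\<close>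
  cancels the \<open>\<Sigma>\<close> terms, and the derivative in \<open>\<theta>\<close> is at most \<open>7 |h|\<^sub>3 sin\<^sup>2 \<theta> cos \<theta> / n\<close>, which
  integrates to \<open>7 |h|\<^sub>3 / (3 n)\<close>.
\<close>

section \<open>Random subsets of a finite set\<close>

text \<open>For large \<open>n\<close> the matrix \<open>Sigma1 n p\<close> is close to a multiple
  of the rank one matrix built from \<open>(1, 2 * p, p ^ 2)\<close>, so nothing may depend on its
  inverse; it enters only through its entries and its square root. The rotation shapes the weight: a
  flip moves the interpolating point by \<open>sin \<theta>\<close> times \<open>D e\<close>, so
  both errors are of order \<open>sin \<theta>\<close> squared, and the derivative in the angle
  supplies the factor \<open>cos \<theta>\<close>. The obstacle is regularity: \<open>h\<close> is
  just three times differentiable, so its third derivatives need not be continuous. Expansions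
  therefore go through Lipschitz bounds on second derivatives, and the last integration in the angle
  is a monotonicity argument. Finiteness of \<open>deriv_norm2 h\<close> yields the growth bounds
  under which the Gaussian expectations exist and can be differentiated. The constant 7 is 4 + 3 and
  comes from three facts: \<open>D e\<close> and \<open>X e\<close> have l1 norm at most
  \<open>4 * (n - 2) / n ^ 2\<close>, there are at most \<open>n ^ 2 / 2\<close> edges, and
  \<open>p * (1 - p) \<le> 1 / 4\<close>.\<close>

definition bern_ex :: "real \<Rightarrow> 'e set \<Rightarrow> ('e set \<Rightarrow> real) \<Rightarrow> real" where
  "bern_ex p E F = (\<Sum>A\<in>Pow E. p ^ card A * (1 - p) ^ card (E - A) * F A)"

lemma bern_ex_empty [simp]: "bern_ex p {} F = F {}"
  by (simp add: bern_ex_def)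

text \<open>Conditions on whether \<open>e\<close> is drawn. Since \<open>bern_ex\<close> is a
  finite weighted sum, this is pure algebra, valid for every real \<open>p\<close>; the inductions
  on \<open>E\<close> below rest on it.\<close>

lemma bern_ex_insert:
  assumes "finite E" "e \<notin> E"
  shows "bern_ex p (insert e E) F =
    p * bern_ex p E (\<lambda>A. F (insert e A)) + (1 - p) * bern_ex p E F"
proof -
  have inj: "inj_on (insert e) (Pow E)"
    using assms by (auto simp: inj_on_def)
  have disj: "Pow E \<inter> insert e ` Pow E = {}"
    using assms by auto
  have "bern_ex p (insert e E) F =
      (\<Sum>A\<in>Pow E. p ^ card A * (1 - p) ^ card (insert e E - A) * F A) +
      (\<Sum>A\<in>Pow E. p ^ card (insert e A) * (1 - p) ^ card (insert e E - insert e A) * F (insert e A))"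
    unfolding bern_ex_def Pow_insert
    by (subst sum.union_disjoint) (use assms disj inj in \<open>auto simp: sum.reindex\<close>)
  also have "(\<Sum>A\<in>Pow E. p ^ card A * (1 - p) ^ card (insert e E - A) * F A) = (1 - p) * bern_ex p E F"
    unfolding bern_ex_def sum_distrib_left
  proof (rule sum.cong[OF refl])
    fix A assume "A \<in> Pow E"
    then have "insert e E - A = insert e (E - A)" using assms by auto
    then have "card (insert e E - A) = Suc (card (E - A))" using assms by simp
    then show "p ^ card A * (1 - p) ^ card (insert e E - A) * F A =
        (1 - p) * (p ^ card A * (1 - p) ^ card (E - A) * F A)" by simp
  qed
  also have "(\<Sum>A\<in>Pow E. p ^ card (insert e A) * (1 - p) ^ card (insert e E - insert e A) * F (insert e A))
      = p * bern_ex p E (\<lambda>A. F (insert e A))"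
    unfolding bern_ex_def sum_distrib_left
  proof (rule sum.cong[OF refl])
    fix A assume A: "A \<in> Pow E"
    then have "insert e E - insert e A = E - A" using assms by auto
    moreover have "card (insert e A) = Suc (card A)"
      using A assms by (subst card_insert_disjoint) (auto intro: finite_subset)
    ultimately show "p ^ card (insert e A) * (1 - p) ^ card (insert e E - insert e A) * F (insert e A) =
        p * (p ^ card A * (1 - p) ^ card (E - A) * F (insert e A))" by simp
  qed
  finally show ?thesis by simp
qed

lemma bern_ex_cong:
  "(\<And>A. A \<subseteq> E \<Longrightarrow> F A = G A) \<Longrightarrow> bern_ex p E F = bern_ex p E G"
  unfolding bern_ex_def by (intro sum.cong) auto

lemma bern_ex_cmult: "bern_ex p E (\<lambda>A. c * F A) = c * bern_ex p E F"
  unfolding bern_ex_def sum_distrib_left by (intro sum.cong) auto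

lemma bern_ex_add: "bern_ex p E (\<lambda>A. F A + G A) = bern_ex p E F + bern_ex p E G"
  unfolding bern_ex_def by (simp add: algebra_simps sum.distrib)

lemma bern_ex_diff: "bern_ex p E (\<lambda>A. F A - G A) = bern_ex p E F - bern_ex p E G"
  unfolding bern_ex_def by (simp add: algebra_simps sum_subtractf)

lemma bern_ex_sum: "bern_ex p E (\<lambda>A. \<Sum>i\<in>S. F i A) = (\<Sum>i\<in>S. bern_ex p E (F i))"
  unfolding bern_ex_def by (subst sum.swap) (simp add: sum_distrib_left)

lemma bern_ex_const: "finite E \<Longrightarrow> bern_ex p E (\<lambda>A. c) = c"
  by (induction E rule: finite_induct) (simp_all add: bern_ex_insert algebra_simps)

lemma bern_ex_mono:
  assumes "0 \<le> p" "p \<le> 1" "\<And>A. A \<subseteq> E \<Longrightarrow> F A \<le> G A"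
  shows "bern_ex p E F \<le> bern_ex p E G"
  unfolding bern_ex_def using assms by (intro sum_mono mult_left_mono) auto

lemma bern_ex_abs_le:
  assumes "finite E" "0 \<le> p" "p \<le> 1" "\<And>A. A \<subseteq> E \<Longrightarrow> \<bar>F A\<bar> \<le> c"
  shows "\<bar>bern_ex p E F\<bar> \<le> c"
proof -
  have "bern_ex p E F \<le> bern_ex p E (\<lambda>_. c)"
    using assms(4) by (intro bern_ex_mono assms) (meson abs_le_iff)
  moreover have "bern_ex p E (\<lambda>_. - c) \<le> bern_ex p E F"
    using assms(4) by (intro bern_ex_mono assms) (smt (verit))
  ultimately show ?thesis by (simp add: bern_ex_const[OF assms(1)])
qed

text \<open>Discrete integration by parts. Given the rest of the set,
  \<open>of_bool (e \<in> A) - p\<close> is \<open>1 - p\<close> with weight \<open>p\<close> and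
  \<open>- p\<close> with weight \<open>1 - p\<close>, so both branches carry the factor
  \<open>p * (1 - p)\<close> with opposite signs.\<close>

lemma bern_ex_stein:
  assumes "finite E" "e \<in> E"
  shows "bern_ex p E (\<lambda>A. (of_bool (e \<in> A) - p) * G A) =
    p * (1 - p) * bern_ex p E (\<lambda>A. G (insert e A) - G (A - {e}))"
proof -
  define E' where "E' = E - {e}"
  have E: "E = insert e E'" "finite E'" "e \<notin> E'" using assms by (auto simp: E'_def)
  have fresh: "A - {e} = A" "e \<notin> A" if "A \<subseteq> E'" for A
    using that E(3) by auto
  have 1: "bern_ex p E' (\<lambda>A. (of_bool (e \<in> A) - p) * G A) = (- p) * bern_ex p E' G"
    unfolding bern_ex_cmult[symmetric] using fresh by (intro bern_ex_cong) simp
  have 2: "bern_ex p E' (\<lambda>A. (of_bool (e \<in> insert e A) - p) * G (insert e A)) = (1 - p) * bern_ex p E' (\<lambda>A. G (insert e A))"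
    unfolding bern_ex_cmult[symmetric] by simp
  have 3: "bern_ex p E' (\<lambda>A. G (insert e A) - G (A - {e})) = bern_ex p E' (\<lambda>A. G (insert e A)) - bern_ex p E' G"
    unfolding bern_ex_diff[symmetric] using fresh by (intro bern_ex_cong) simp
  have 4: "bern_ex p E' (\<lambda>A. G (insert e (insert e A)) - G (insert e A - {e})) = bern_ex p E' (\<lambda>A. G (insert e A)) - bern_ex p E' G"
    unfolding bern_ex_diff[symmetric] using fresh by (intro bern_ex_cong) simp
  show ?thesis
    unfolding E(1) bern_ex_insert[OF E(2,3)] 1 2 3 4 by (simp add: algebra_simps)
qed

text \<open>Polynomials in the edge indicators expand into such monomials, so all moments needed for
  the covariance matrix reduce to this one.\<close>

lemma bern_ex_monomial:
  assumes "finite E" "T \<subseteq> E"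
  shows "bern_ex p E (\<lambda>A. of_bool (T \<subseteq> A)) = p ^ card T"
  using assms
proof (induction E arbitrary: T rule: finite_induct)
  case empty then show ?case by simp
next
  case (insert e E)
  show ?case
  proof (cases "e \<in> T")
    case True
    have "bern_ex p E (\<lambda>A. of_bool (T \<subseteq> insert e A)) = bern_ex p E (\<lambda>A. of_bool (T - {e} \<subseteq> A))"
      by (intro bern_ex_cong) auto
    also have "\<dots> = p ^ card (T - {e})" using insert by (intro insert.IH) auto
    finally have 1: "bern_ex p E (\<lambda>A. of_bool (T \<subseteq> insert e A)) = p ^ card (T - {e})" .
    have 2: "bern_ex p E (\<lambda>A. of_bool (T \<subseteq> A)) = bern_ex p E (\<lambda>A. 0)"
      using insert.hyps True by (intro bern_ex_cong) auto
    have "card T = Suc (card (T - {e}))"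
      using True insert by (metis card_Suc_Diff1 finite.insertI finite_subset)
    then show ?thesis using insert.hyps 1 2 by (simp add: bern_ex_insert bern_ex_const)
  next
    case False
    then have "bern_ex p E (\<lambda>A. of_bool (T \<subseteq> insert e A)) = bern_ex p E (\<lambda>A. of_bool (T \<subseteq> A))"
      by (intro bern_ex_cong) auto
    moreover have "bern_ex p E (\<lambda>A. of_bool (T \<subseteq> A)) = p ^ card T"
      using False insert by (intro insert.IH) auto
    ultimately show ?thesis using insert.hyps by (simp add: bern_ex_insert algebra_simps)
  qed
qed

text \<open>The sum over \<open>k\<close> is bounded as a whole, so that an l1 bound on the family
  \<open>F\<close> survives taking expectations.\<close>

lemma bern_ex_sum_abs_le:
  assumes "finite E" "0 \<le> p" "p \<le> 1" "\<And>A. A \<subseteq> E \<Longrightarrow> (\<Sum>k\<in>S. \<bar>F k A\<bar>) \<le> c"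
  shows "(\<Sum>k\<in>S. \<bar>bern_ex p E (F k)\<bar>) \<le> c"
proof -
  have "(\<Sum>k\<in>S. \<bar>bern_ex p E (F k)\<bar>) \<le> (\<Sum>k\<in>S. bern_ex p E (\<lambda>A. \<bar>F k A\<bar>))"
    unfolding bern_ex_def using assms(2,3)
    by (intro sum_mono order_trans[OF sum_abs]) (simp add: abs_mult)
  also have "\<dots> \<le> bern_ex p E (\<lambda>A. c)"
    unfolding bern_ex_sum[symmetric] using assms by (intro bern_ex_mono)
  finally show ?thesis by (simp add: bern_ex_const[OF assms(1)])
qed

text \<open>Induction on \<open>E\<close> by the law of total covariance: conditioning on one
  element gives the average of the two conditional covariances plus \<open>p * (1 - p)\<close> times
  the product of the jumps of the conditional means. The \<open>F k\<close> are controlled jointly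
  in l1 and the \<open>G k\<close> separately, which matches a matrix paired with entrywise bounds
  on second derivatives and costs no factor for the number of indices.\<close>

lemma bern_ex_covariance_le:
  assumes "finite E" "0 \<le> p" "p \<le> 1"
    and "\<And>f A. f \<in> E \<Longrightarrow> A \<subseteq> E \<Longrightarrow> (\<Sum>k\<in>S. \<bar>F k (insert f A) - F k (A - {f})\<bar>) \<le> a f"
    and "\<And>k f A. k \<in> S \<Longrightarrow> f \<in> E \<Longrightarrow> A \<subseteq> E \<Longrightarrow> \<bar>G k (insert f A) - G k (A - {f})\<bar> \<le> b f"
    and "\<And>f. f \<in> E \<Longrightarrow> 0 \<le> b f"
  shows "\<bar>\<Sum>k\<in>S. bern_ex p E (\<lambda>A. F k A * G k A) - bern_ex p E (F k) * bern_ex p E (G k)\<bar>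
    \<le> p * (1 - p) * (\<Sum>f\<in>E. a f * b f)"
  using assms
proof (induction E arbitrary: F G rule: finite_induct)
  case empty then show ?case by simp
next
  case (insert e E)
  let ?F1 = "\<lambda>k A. F k (insert e A)" and ?G1 = "\<lambda>k A. G k (insert e A)"
  define S' where "S' = p * (1 - p) * (\<Sum>f\<in>E. a f * b f)"
  let ?C = "\<lambda>F G. \<Sum>k\<in>S. bern_ex p E (\<lambda>A. F k A * G k A) - bern_ex p E (F k) * bern_ex p E (G k)"
  \<comment> \<open>Flipping \<open>f\<close> commutes with fixing \<open>e\<close> as present, so
    the conditioned functions inherit the same increment bounds.\<close>
  have comm: "insert e A - {f} = insert e (A - {f})" if "f \<in> E" for f A
    using that insert.hyps by auto
  have fresh: "A - {e} = A" if "A \<subseteq> E" for A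
    using that insert.hyps by auto
  have C0: "\<bar>?C F G\<bar> \<le> S'"
    unfolding S'_def by (rule insert.IH[OF insert.prems(1,2)]; rule insert.prems) auto
  have C1: "\<bar>?C ?F1 ?G1\<bar> \<le> S'"
    unfolding S'_def
  proof (rule insert.IH[OF insert.prems(1,2)])
    fix f A assume fA: "f \<in> E" "A \<subseteq> E"
    show "(\<Sum>k\<in>S. \<bar>?F1 k (insert f A) - ?F1 k (A - {f})\<bar>) \<le> a f"
      using insert.prems(3)[of f "insert e A"] fA comm by (auto simp: insert_commute)
  next
    fix k f A assume kfA: "k \<in> S" "f \<in> E" "A \<subseteq> E"
    then show "\<bar>?G1 k (insert f A) - ?G1 k (A - {f})\<bar> \<le> b f"
      using insert.prems(4)[of k f "insert e A"] comm by (auto simp: insert_commute)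
  qed (use insert.prems(5) in auto)
  have dF: "(\<Sum>k\<in>S. \<bar>bern_ex p E (?F1 k) - bern_ex p E (F k)\<bar>) \<le> a e"
    unfolding bern_ex_diff[symmetric]
  proof (rule bern_ex_sum_abs_le[OF insert.hyps(1) insert.prems(1,2)])
    fix A assume "A \<subseteq> E"
    then show "(\<Sum>k\<in>S. \<bar>?F1 k A - F k A\<bar>) \<le> a e"
      using insert.prems(3)[of e A] fresh[of A] by auto
  qed
  have dG: "\<bar>bern_ex p E (?G1 k) - bern_ex p E (G k)\<bar> \<le> b e" if "k \<in> S" for k
    unfolding bern_ex_diff[symmetric]
  proof (rule bern_ex_abs_le[OF insert.hyps(1) insert.prems(1,2)])
    fix A assume "A \<subseteq> E"
    then show "\<bar>?G1 k A - G k A\<bar> \<le> b e"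
      using insert.prems(4)[OF that, of e A] fresh[of A] by auto
  qed
  define F0 F1 G0 G1 H0 H1 where "F0 k = bern_ex p E (F k)" and "F1 k = bern_ex p E (?F1 k)"
    and "G0 k = bern_ex p E (G k)" and "G1 k = bern_ex p E (?G1 k)"
    and "H0 k = bern_ex p E (\<lambda>A. F k A * G k A)" and "H1 k = bern_ex p E (\<lambda>A. ?F1 k A * ?G1 k A)" for k
  note defs = this
  define d c0 c1 where "d = (\<Sum>k\<in>S. (F1 k - F0 k) * (G1 k - G0 k))"
    and "c0 = (\<Sum>k\<in>S. H0 k - F0 k * G0 k)" and "c1 = (\<Sum>k\<in>S. H1 k - F1 k * G1 k)"
  \<comment> \<open>Hoelder pairing of the l1 bound on the jumps of \<open>F\<close> with the sup
    bound on those of \<open>G\<close>.\<close>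
  have "\<bar>d\<bar> \<le> (\<Sum>k\<in>S. \<bar>F1 k - F0 k\<bar> * b e)"
    unfolding d_def
  proof (rule order_trans[OF sum_abs], rule sum_mono)
    fix k assume "k \<in> S"
    then show "\<bar>(F1 k - F0 k) * (G1 k - G0 k)\<bar> \<le> \<bar>F1 k - F0 k\<bar> * b e"
      unfolding abs_mult using dG by (intro mult_left_mono) (auto simp: defs)
  qed
  also have "\<dots> \<le> a e * b e"
    unfolding sum_distrib_right[symmetric] using dF insert.prems(5)[of e]
    by (intro mult_right_mono) (auto simp: defs)
  finally have d: "\<bar>p * (1 - p) * d\<bar> \<le> p * (1 - p) * (a e * b e)"
    unfolding abs_mult[of "p * (1 - p)"] using insert.prems(1,2) by (intro mult_mono) auto
  have c1: "\<bar>p * c1\<bar> \<le> p * S'"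
    unfolding abs_mult using insert.prems(1) C1 by (intro mult_mono) (auto simp: defs c1_def)
  have c0: "\<bar>(1 - p) * c0\<bar> \<le> (1 - p) * S'"
    unfolding abs_mult using insert.prems(2) C0 by (intro mult_mono) (auto simp: defs c0_def)
  have "(\<Sum>k\<in>S. bern_ex p (insert e E) (\<lambda>A. F k A * G k A) - bern_ex p (insert e E) (F k) * bern_ex p (insert e E) (G k))
     = (\<Sum>k\<in>S. (p * H1 k + (1 - p) * H0 k) - (p * F1 k + (1 - p) * F0 k) * (p * G1 k + (1 - p) * G0 k))"
    using insert.hyps by (simp add: bern_ex_insert defs)
  \<comment> \<open>The law of total covariance for each \<open>k\<close>, as a polynomial
    identity.\<close>
  also have "\<dots> = (\<Sum>k\<in>S. p * (H1 k - F1 k * G1 k) + (1 - p) * (H0 k - F0 k * G0 k) + p * (1 - p) * ((F1 k - F0 k) * (G1 k - G0 k)))"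
    by (intro sum.cong refl) algebra
  also have "\<dots> = p * c1 + (1 - p) * c0 + p * (1 - p) * d"
    unfolding d_def c0_def c1_def sum.distrib sum_distrib_left ..
  also have "\<bar>\<dots>\<bar> \<le> p * S' + (1 - p) * S' + p * (1 - p) * (a e * b e)"
    using c0 c1 d by linarith
  also have "\<dots> = p * (1 - p) * (\<Sum>f\<in>insert e E. a f * b f)"
    using insert.hyps by (simp add: S'_def algebra_simps)
  finally show ?case .
qed

section \<open>Edges and triangles\<close>

definition triples :: "nat \<Rightarrow> nat set set" where
  "triples n = {t. t \<subseteq> {1..n} \<and> card t = 3}"

definition sides :: "nat set \<Rightarrow> nat set set" where
  "sides t = {e. e \<subseteq> t \<and> card e = 2}"

definition triples_over :: "nat \<Rightarrow> nat set \<Rightarrow> nat set set" where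
  "triples_over n e = {t \<in> triples n. e \<in> sides t}"

lemma finite_pairs [simp]: "finite (pairs n)"
  by (rule finite_subset[of _ "Pow {1..n}"]) (auto simp: pairs_def)

lemma finite_triples [simp]: "finite (triples n)"
  by (rule finite_subset[of _ "Pow {1..n}"]) (auto simp: triples_def)

lemma finite_triples_over [simp]: "finite (triples_over n e)"
  by (simp add: triples_over_def)

lemma sides_subset_pairs: "t \<in> triples n \<Longrightarrow> sides t \<subseteq> pairs n"
  by (auto simp: triples_def sides_def pairs_def)

lemma sides_triple:
  assumes "i \<noteq> j" "j \<noteq> k" "i \<noteq> k"
  shows "sides {i, j, k} = {{i, j}, {j, k}, {i, k}}"
proof -
  have "e \<in> {{i, j}, {j, k}, {i, k}}" if "e \<subseteq> {i, j, k}" "card e = 2" for e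
    using that assms by (auto simp: card_2_iff doubleton_eq_iff)
  then show ?thesis using assms by (auto simp: sides_def)
qed

text \<open>Lists any prescribed side first, so that later computations need not distinguish which
  side of the triangle is flipped.\<close>

lemma sides_cases:
  assumes "t \<in> triples n" "e \<in> sides t"
  obtains f g where "sides t = {e, f, g}" "e \<noteq> f" "e \<noteq> g" "f \<noteq> g" "sides t - {e} = {f, g}"
    "f \<in> pairs n" "g \<in> pairs n" "e \<in> pairs n"
proof -
  obtain i j k where t: "t = {i, j, k}" and d: "i \<noteq> j" "j \<noteq> k" "i \<noteq> k"
    using assms by (auto simp: triples_def card_3_iff)
  have ne: "{i, j} \<noteq> {j, k}" "{i, j} \<noteq> {i, k}" "{j, k} \<noteq> {i, k}"
    using d by (auto simp: doubleton_eq_iff)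
  have st: "sides t = {{i, j}, {j, k}, {i, k}}" using sides_triple d t by simp
  then consider "e = {i, j}" | "e = {j, k}" | "e = {i, k}" using assms by auto
  then have "\<exists>f g. sides t = {e, f, g} \<and> e \<noteq> f \<and> e \<noteq> g \<and> f \<noteq> g"
  proof cases
    case 1
    then have "sides t = {e, {j, k}, {i, k}}" using st by simp
    then show ?thesis using ne 1 by metis
  next
    case 2
    then have "sides t = {e, {i, j}, {i, k}}" using st by blast
    then show ?thesis using ne 2 by metis
  next
    case 3
    then have "sides t = {e, {i, j}, {j, k}}" using st by blast
    then show ?thesis using ne 3 by metis
  qed
  then obtain f g where fg: "sides t = {e, f, g}" "e \<noteq> f" "e \<noteq> g" "f \<noteq> g" by blast
  then show ?thesis
    using that[of f g] sides_subset_pairs[OF assms(1)] by auto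
qed

lemma card_sides_diff: "t \<in> triples n \<Longrightarrow> e \<in> sides t \<Longrightarrow> card (sides t - {e}) = 2"
  by (erule (1) sides_cases) simp

lemma card_triples_over:
  assumes "e \<in> pairs n"
  shows "card (triples_over n e) = n - 2"
proof -
  have e: "e \<subseteq> {1..n}" "card e = 2" "finite e"
    using assms by (auto simp: pairs_def intro: card_ge_0_finite)
  have "triples_over n e = (\<lambda>k. insert k e) ` ({1..n} - e)"
  proof (intro equalityI subsetI)
    fix t assume t: "t \<in> triples_over n e"
    then have "e \<subseteq> t" "card t = 3" "t \<subseteq> {1..n}" by (auto simp: triples_over_def triples_def sides_def)
    moreover have "finite t" using \<open>card t = 3\<close> by (intro card_ge_0_finite) simp
    ultimately have "card (t - e) = 1" using e by (simp add: card_Diff_subset)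
    then obtain k where "t - e = {k}" by (auto simp: card_1_singleton_iff)
    then show "t \<in> (\<lambda>k. insert k e) ` ({1..n} - e)"
      using \<open>e \<subseteq> t\<close> \<open>t \<subseteq> {1..n}\<close> by (intro image_eqI[of _ _ k]) auto
  next
    fix t assume "t \<in> (\<lambda>k. insert k e) ` ({1..n} - e)"
    then show "t \<in> triples_over n e" using e by (auto simp: triples_over_def triples_def sides_def)
  qed
  moreover have "inj_on (\<lambda>k. insert k e) ({1..n} - e)"
    by (auto simp: inj_on_def)
  ultimately show ?thesis using e by (simp add: card_image card_Diff_subset)
qed

text \<open>Double counting of incident pairs of an edge and a triangle.\<close>

lemma sum_triples_over_swap:
  "(\<Sum>e\<in>pairs n. \<Sum>t\<in>triples_over n e. F e t) = (\<Sum>t\<in>triples n. \<Sum>e\<in>sides t. F e t)"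
proof -
  have "(\<Sum>e\<in>pairs n. \<Sum>t\<in>triples_over n e. F e t) =
      (\<Sum>t\<in>triples n. \<Sum>e\<in>{e\<in>pairs n. e \<in> sides t}. F e t)"
    unfolding triples_over_def by (rule sum.swap_restrict) auto
  also have "\<dots> = (\<Sum>t\<in>triples n. \<Sum>e\<in>sides t. F e t)"
    using sides_subset_pairs by (intro sum.cong) auto
  finally show ?thesis .
qed

section \<open>From sums over increasing vertices to sums over vertex sets\<close>

lemma sum_pairs:
  "(\<Sum>e\<in>pairs n. F e) = (\<Sum>i\<in>{1..n}. \<Sum>j\<in>{i<..n}. F {i, j})"
proof -
  have "bij_betw (\<lambda>(i, j). {i, j}) (SIGMA i:{1..n}. {i<..n}) (pairs n)"
  proof (rule bij_betw_imageI)
    show "inj_on (\<lambda>(i, j). {i, j}) (SIGMA i:{1..n}. {i<..n})"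
    proof (rule inj_onI, clarify)
      fix i j i' j' :: nat
      assume "j \<in> {i<..n}" "j' \<in> {i'<..n}" "{i, j} = {i', j'}"
      then show "i = i' \<and> j = j'" unfolding doubleton_eq_iff by auto
    qed
    show "(\<lambda>(i, j). {i, j}) ` (SIGMA i:{1..n}. {i<..n}) = pairs n"
    proof (intro equalityI subsetI)
      fix e assume "e \<in> pairs n"
      then have e: "e \<subseteq> {1..n}" "card e = 2" by (auto simp: pairs_def)
      then obtain c d where cd: "e = {c, d}" "c \<noteq> d" by (auto simp: card_2_iff)
      define a b where "a = min c d" and "b = max c d"
      have "e = {a, b}" "a < b" using cd by (auto simp: a_def b_def min_def max_def)
      then show "e \<in> (\<lambda>(i, j). {i, j}) ` (SIGMA i:{1..n}. {i<..n})"
        using e by (intro image_eqI[of _ _ "(a, b)"]) auto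
    next
      fix e assume "e \<in> (\<lambda>(i, j). {i, j}) ` (SIGMA i:{1..n}. {i<..n})"
      then obtain a b where "e = {a, b}" "a \<in> {1..n}" "b \<in> {a<..n}" by auto
      then show "e \<in> pairs n" by (simp add: pairs_def)
    qed
  qed
  then have "(\<Sum>e\<in>pairs n. F e) = (\<Sum>x\<in>(SIGMA i:{1..n}. {i<..n}). F ((\<lambda>(i, j). {i, j}) x))"
    by (rule sum.reindex_bij_betw[symmetric])
  also have "\<dots> = (\<Sum>i\<in>{1..n}. \<Sum>j\<in>{i<..n}. F {i, j})"
    by (simp add: sum.Sigma split_beta)
  finally show ?thesis .
qed

lemma sum_triples:
  "(\<Sum>t\<in>triples n. F t) = (\<Sum>i\<in>{1..n}. \<Sum>j\<in>{i<..n}. \<Sum>k\<in>{j<..n}. F {i, j, k})"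
proof -
  let ?I = "SIGMA i:{1..n}. SIGMA j:{i<..n}. {j<..n}"
  have "bij_betw (\<lambda>(i, j, k). {i, j, k}) ?I (triples n)"
  proof (rule bij_betw_imageI)
    show "inj_on (\<lambda>(i, j, k). {i, j, k}) ?I"
    proof (rule inj_onI)
      fix x y assume "x \<in> ?I" "y \<in> ?I" "(\<lambda>(i, j, k). {i, j, k}) x = (\<lambda>(i, j, k). {i, j, k}) y"
      moreover obtain i j k i' j' k' where xy: "x = (i, j, k)" "y = (i', j', k')"
        by (metis prod_cases3)
      ultimately have eq: "{i, j, k} = {i', j', k'}"
        and "j \<in> {i<..n}" "k \<in> {j<..n}" "j' \<in> {i'<..n}" "k' \<in> {j'<..n}" by simp_all
      then have "i < j" "j < k" "i' < j'" "j' < k'" by simp_all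
      then have "[i, j, k] = [i', j', k']"
        by - (rule sorted_distinct_set_unique, simp_all only: list.set eq, simp_all)
      then show "x = y" using xy by simp
    qed
    show "(\<lambda>(i, j, k). {i, j, k}) ` ?I = triples n"
    proof (intro equalityI subsetI)
      fix t assume "t \<in> triples n"
      then have t: "t \<subseteq> {1..n}" "card t = 3" "finite t"
        by (auto simp: triples_def intro: card_ge_0_finite)
      define xs where "xs = sorted_list_of_set t"
      have "length xs = 3" "sorted xs" "distinct xs" "set xs = t" using t by (auto simp: xs_def)
      then obtain a b c where xs: "xs = [a, b, c]"
        by (auto simp: numeral_3_eq_3 length_Suc_conv)
      then have "a < b" "b < c" "t = {a, b, c}" using \<open>sorted xs\<close> \<open>distinct xs\<close> \<open>set xs = t\<close> by auto
      then show "t \<in> (\<lambda>(i, j, k). {i, j, k}) ` ?I"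
        using t by (intro image_eqI[of _ _ "(a, b, c)"]) auto
    next
      fix t assume "t \<in> (\<lambda>(i, j, k). {i, j, k}) ` ?I"
      then obtain a b c where "t = {a, b, c}" "a \<in> {1..n}" "b \<in> {a<..n}" "c \<in> {b<..n}" by auto
      then show "t \<in> triples n" by (simp add: triples_def)
    qed
  qed
  then have "(\<Sum>t\<in>triples n. F t) = (\<Sum>x\<in>?I. F ((\<lambda>(i, j, k). {i, j, k}) x))"
    by (rule sum.reindex_bij_betw[symmetric])
  also have "\<dots> = (\<Sum>i\<in>{1..n}. \<Sum>j\<in>{i<..n}. \<Sum>k\<in>{j<..n}. F {i, j, k})"
    by (simp add: sum.Sigma split_beta)
  finally show ?thesis .
qed

text \<open>Takes the place of \<open>I\<close> when the sample point is the set of present edges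
  itself; \<open>T1 n edge_ind A\<close> is then the statistic of the graph with edge set
  \<open>A\<close>.\<close>

definition edge_ind :: "nat set \<Rightarrow> nat set set \<Rightarrow> real" where
  "edge_ind e A = of_bool (e \<in> A)"

text \<open>Inside the triangle \<open>t\<close>, switching the side \<open>e\<close> on changes the
  number of 2-stars by \<open>other_sum e t A\<close> and the number of triangles by
  \<open>other_prod e t A\<close>.\<close>

definition other_sum :: "nat set \<Rightarrow> nat set \<Rightarrow> nat set set \<Rightarrow> real" where
  "other_sum e t A = (\<Sum>f\<in>sides t - {e}. edge_ind f A)"

definition other_prod :: "nat set \<Rightarrow> nat set \<Rightarrow> nat set set \<Rightarrow> real" where
  "other_prod e t A = (\<Prod>f\<in>sides t - {e}. edge_ind f A)"

definition graph_stats :: "nat \<Rightarrow> nat set set \<Rightarrow> real ^ 3" where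
  "graph_stats n A = vector [T1 n edge_ind A, V1 n edge_ind A, U1 n edge_ind A]"

text \<open>This is \<open>D e\<close> of the overview. The entry 1 arises because the factor
  \<open>n - 2\<close> in \<open>T1\<close> spreads each edge over the \<open>n - 2\<close>
  triangles containing it.\<close>

definition flip_diff :: "nat \<Rightarrow> nat set \<Rightarrow> nat set set \<Rightarrow> real ^ 3" where
  "flip_diff n e A = (1 / real n ^ 2) *\<^sub>R
     (\<Sum>t\<in>triples_over n e. vector [1, other_sum e t A, other_prod e t A])"

text \<open>
  The inverse, up to the number of edges, of the regression matrix with rows \<open>(1, 0, 0)\<close>,
  \<open>(- 2 * p, 2, 0)\<close> and \<open>(0, - p, 3)\<close>, applied to \<open>flip_diff\<close>.
\<close>

definition stein_coeff :: "nat \<Rightarrow> real \<Rightarrow> nat set \<Rightarrow> nat set set \<Rightarrow> real ^ 3" where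
  "stein_coeff n p e A = (1 / real n ^ 2) *\<^sub>R
     (\<Sum>t\<in>triples_over n e. vector [1, p + other_sum e t A / 2,
        p ^ 2 / 3 + p * other_sum e t A / 6 + other_prod e t A / 3])"

definition triangle_stats :: "nat set \<Rightarrow> nat set set \<Rightarrow> real ^ 3" where
  "triangle_stats t A = vector [\<Sum>e\<in>sides t. edge_ind e A,
     (\<Sum>e\<in>sides t. \<Prod>f\<in>sides t - {e}. edge_ind f A), \<Prod>e\<in>sides t. edge_ind e A]"

text \<open>Each edge lies in \<open>n - 2\<close> triangles, so the normalisation of
  \<open>T1\<close> turns the edge count into a sum over triangles as well. All three statistics
  thereby become local and can be treated triangle by triangle.\<close>

lemma graph_stats_eq:
  assumes "n \<ge> 2"
  shows "graph_stats n A = (1 / real n ^ 2) *\<^sub>R (\<Sum>t\<in>triples n. triangle_stats t A)"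
proof -
  have T: "(real n - 2) * edge_count n edge_ind A = (\<Sum>t\<in>triples n. \<Sum>e\<in>sides t. edge_ind e A)"
  proof -
    have "(\<Sum>t\<in>triples n. \<Sum>e\<in>sides t. edge_ind e A) = (\<Sum>e\<in>pairs n. \<Sum>t\<in>triples_over n e. edge_ind e A)"
      by (rule sum_triples_over_swap[symmetric])
    also have "\<dots> = (\<Sum>e\<in>pairs n. (real n - 2) * edge_ind e A)"
      using assms by (intro sum.cong) (auto simp: card_triples_over of_nat_diff)
    also have "\<dots> = (real n - 2) * edge_count n edge_ind A"
      by (simp add: edge_count_def sum_pairs sum_distrib_left)
    finally show ?thesis by simp
  qed
  have ne: "{i, j} \<noteq> {j, k}" "{i, j} \<noteq> {i, k}" "{j, k} \<noteq> {i, k}" if "i < j" "j < k" for i j k :: nat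
    using that by (auto simp: doubleton_eq_iff)
  have s: "sides {i, j, k} = {{i, j}, {j, k}, {i, k}}" if "i < j" "j < k" for i j k :: nat
    using that by (intro sides_triple) auto
  have V: "two_star_count n edge_ind A = (\<Sum>t\<in>triples n. \<Sum>e\<in>sides t. \<Prod>f\<in>sides t - {e}. edge_ind f A)"
    unfolding two_star_count_def sum_triples
  proof (intro sum.cong refl)
    fix i j k assume "i \<in> {1..n}" "j \<in> {i<..n}" "k \<in> {j<..n}"
    then have "i < j" "j < k" by auto
    moreover have "{{i, j}, {j, k}, {i, k}} - {{i, j}} = {{j, k}, {i, k}}"
      "{{i, j}, {j, k}, {i, k}} - {{j, k}} = {{i, j}, {i, k}}"
      "{{i, j}, {j, k}, {i, k}} - {{i, k}} = {{i, j}, {j, k}}"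
      using ne[OF calculation] by auto
    ultimately show "edge_ind {i, j} A * edge_ind {j, k} A + edge_ind {i, j} A * edge_ind {i, k} A +
         edge_ind {j, k} A * edge_ind {i, k} A =
         (\<Sum>e\<in>sides {i, j, k}. \<Prod>f\<in>sides {i, j, k} - {e}. edge_ind f A)"
      using ne s by simp
  qed
  have U: "triangle_count n edge_ind A = (\<Sum>t\<in>triples n. \<Prod>e\<in>sides t. edge_ind e A)"
    unfolding triangle_count_def sum_triples
    by (intro sum.cong refl) (auto simp: s ne)
  show ?thesis
    unfolding vec_eq_iff forall_3 graph_stats_def T1_def V1_def U1_def
    by (simp add: triangle_stats_def T[symmetric] V U)
qed

lemma other_sum_cases:
  assumes "t \<in> triples n" "e \<in> sides t"
  obtains f g where "sides t = {e, f, g}" "e \<noteq> f" "e \<noteq> g" "f \<noteq> g"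
    "other_sum e t = (\<lambda>A. edge_ind f A + edge_ind g A)"
    "other_prod e t = (\<lambda>A. edge_ind f A * edge_ind g A)"
    "f \<in> pairs n" "g \<in> pairs n" "e \<in> pairs n"
proof -
  obtain f g where *: "sides t = {e, f, g}" "e \<noteq> f" "e \<noteq> g" "f \<noteq> g" "sides t - {e} = {f, g}"
    "f \<in> pairs n" "g \<in> pairs n" "e \<in> pairs n"
    using sides_cases[OF assms] .
  show ?thesis
    by (rule that[OF *(1-4) _ _ *(6-8)]) (simp_all add: fun_eq_iff other_sum_def other_prod_def *)
qed

text \<open>Holds separately in each triangle. Replacing indicators by \<open>p\<close> one at a
  time telescopes, as in \<open>a * b * c - p ^ 3 = (a - p) * b * c + p * (b - p) * c + p ^ 2 * (c -
  p)\<close>; averaging over the orders of replacement gives exactly the entries of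
  \<open>stein_coeff\<close>. The weight of a side involves only the other two sides.\<close>

lemma stein_decomposition:
  assumes "n \<ge> 2"
  shows "(\<Sum>e\<in>pairs n. (edge_ind e A - p) *\<^sub>R stein_coeff n p e A) =
     graph_stats n A - (1 / real n ^ 2) *\<^sub>R (\<Sum>t\<in>triples n. vector [3 * p, 3 * p ^ 2, p ^ 3])"
proof -
  have "(\<Sum>e\<in>sides t. (edge_ind e A - p) *\<^sub>R
         (vector [1, p + other_sum e t A / 2, p ^ 2 / 3 + p * other_sum e t A / 6 + other_prod e t A / 3] :: real ^ 3))
      = triangle_stats t A - vector [3 * p, 3 * p ^ 2, p ^ 3]" if t: "t \<in> triples n" for t
  proof -
    obtain i j k where ijk: "t = {i, j, k}" "i \<noteq> j" "j \<noteq> k" "i \<noteq> k"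
      using t by (auto simp: triples_def card_3_iff)
    then have "{i, j} \<in> sides t" by (auto simp: sides_def)
    from sides_cases[OF t this] obtain a b c
      where s: "sides t = {a, b, c}" and ne: "a \<noteq> b" "a \<noteq> c" "b \<noteq> c" by metis
    have d: "{a, b, c} - {a} = {b, c}" "{a, b, c} - {b} = {a, c}" "{a, b, c} - {c} = {a, b}"
      using ne by auto
    show ?thesis
      unfolding vec_eq_iff forall_3 triangle_stats_def other_sum_def other_prod_def s
      using ne by (simp add: d; simp add: field_simps power2_eq_square power3_eq_cube)
  qed
  then have "(\<Sum>t\<in>triples n. \<Sum>e\<in>sides t. (edge_ind e A - p) *\<^sub>R
         (vector [1, p + other_sum e t A / 2, p ^ 2 / 3 + p * other_sum e t A / 6 + other_prod e t A / 3] :: real ^ 3))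
      = (\<Sum>t\<in>triples n. triangle_stats t A - vector [3 * p, 3 * p ^ 2, p ^ 3])"
    by (intro sum.cong) auto
  then show ?thesis
    unfolding stein_coeff_def graph_stats_eq[OF assms] sum_triples_over_swap[symmetric]
    by (simp add: sum_subtractf scaleR_right_diff_distrib[symmetric] scaleR_left_commute[of _ "1 / _"]
       scaleR_sum_right[symmetric] flip: scaleR_scaleR)
qed

text \<open>Triangles without the side \<open>e\<close> cancel, and in the others the change is read
  off from the three sides.\<close>

lemma graph_stats_flip:
  assumes "n \<ge> 2" "e \<in> pairs n"
  shows "graph_stats n (insert e A) - graph_stats n (A - {e}) = flip_diff n e A"
proof -
  have 1: "triangle_stats t (insert e A) - triangle_stats t (A - {e}) = vector [1, other_sum e t A, other_prod e t A]"
    if te: "t \<in> triples n" "e \<in> sides t" for t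
  proof -
    obtain f g where s: "sides t = {e, f, g}" and ne: "e \<noteq> f" "e \<noteq> g" "f \<noteq> g"
      using sides_cases[OF te] by metis
    have d: "{e, f, g} - {e} = {f, g}" "{e, f, g} - {f} = {e, g}" "{e, f, g} - {g} = {e, f}"
      using ne by auto
    show ?thesis
      unfolding vec_eq_iff forall_3 triangle_stats_def other_sum_def other_prod_def s
      using ne by (simp add: d edge_ind_def)
  qed
  have 2: "triangle_stats t (insert e A) - triangle_stats t (A - {e}) = 0" if "e \<notin> sides t" for t
  proof -
    have "edge_ind f (insert e A) = edge_ind f A \<and> edge_ind f (A - {e}) = edge_ind f A" if "f \<in> sides t" for f
      using that \<open>e \<notin> sides t\<close> by (auto simp: edge_ind_def)
    moreover from this have "(\<Prod>f\<in>sides t - {g}. edge_ind f (insert e A)) = (\<Prod>f\<in>sides t - {g}. edge_ind f (A - {e}))" for g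
      by (intro prod.cong) auto
    ultimately show ?thesis by (simp add: triangle_stats_def cong: sum.cong prod.cong)
  qed
  have "(\<Sum>t\<in>triples n. triangle_stats t (insert e A) - triangle_stats t (A - {e}))
      = (\<Sum>t\<in>triples_over n e. vector [1, other_sum e t A, other_prod e t A])"
    by (rule sum.mono_neutral_cong_right) (auto simp: triples_over_def 1 2)
  then show ?thesis
    unfolding graph_stats_eq[OF assms(1)] flip_diff_def
    by (simp add: sum_subtractf scaleR_right_diff_distrib[symmetric])
qed

section \<open>Dependence of the increments on the edges: invariance, size and change\<close>

lemma other_flip [simp]:
  "other_sum e t (insert e A) = other_sum e t A" "other_sum e t (A - {e}) = other_sum e t A"
  "other_prod e t (insert e A) = other_prod e t A" "other_prod e t (A - {e}) = other_prod e t A"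
  by (auto simp: other_sum_def other_prod_def edge_ind_def intro!: sum.cong prod.cong)

text \<open>Expresses that \<open>D e\<close> and \<open>X e\<close> are independent of the
  indicator of \<open>e\<close>; this is what lets \<open>X e\<close> leave the difference in
  \<open>bern_ex_stein\<close>.\<close>

lemma flip_invariant [simp]:
  "flip_diff n e (insert e A) = flip_diff n e A" "flip_diff n e (A - {e}) = flip_diff n e A"
  "stein_coeff n p e (insert e A) = stein_coeff n p e A" "stein_coeff n p e (A - {e}) = stein_coeff n p e A"
  by (simp_all add: flip_diff_def stein_coeff_def)

text \<open>The norm dual to entrywise suprema, which is how \<open>deriv_norm2\<close> and
  \<open>deriv_norm3\<close> measure derivatives.\<close>

definition l1 :: "real ^ 'n \<Rightarrow> real" where
  "l1 v = (\<Sum>i\<in>UNIV. \<bar>v $ i\<bar>)"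

lemma l1_nonneg [simp]: "0 \<le> l1 v"
  by (simp add: l1_def sum_nonneg)

lemma component_le_l1: "\<bar>v $ i\<bar> \<le> l1 v"
  unfolding l1_def by (rule member_le_sum) auto

lemma l1_scaleR [simp]: "l1 (c *\<^sub>R v) = \<bar>c\<bar> * l1 v"
  by (simp add: l1_def abs_mult sum_distrib_left)

lemma l1_zero [simp]: "l1 0 = 0"
  by (simp add: l1_def)

lemma l1_add: "l1 (v + w) \<le> l1 v + l1 w"
  unfolding l1_def sum.distrib[symmetric] by (intro sum_mono) auto

lemma l1_sum: "l1 (\<Sum>i\<in>S. f i) \<le> (\<Sum>i\<in>S. l1 (f i))"
proof (induction S rule: infinite_finite_induct)
  case (insert x F)
  then show ?case using l1_add[of "f x" "sum f F"] by simp
qed auto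

lemma l1_3: "l1 (v :: real ^ 3) = \<bar>v $ 1\<bar> + \<bar>v $ 2\<bar> + \<bar>v $ 3\<bar>"
  by (simp add: l1_def sum_3)

lemma other_bounds:
  assumes "t \<in> triples n" "e \<in> sides t"
  shows "0 \<le> other_sum e t A" "other_sum e t A \<le> 2" "0 \<le> other_prod e t A" "other_prod e t A \<le> 1"
proof -
  obtain g h where gh: "sides t = {e, g, h}" "e \<noteq> g" "e \<noteq> h" "g \<noteq> h"
    "other_sum e t = (\<lambda>A. edge_ind g A + edge_ind h A)"
    "other_prod e t = (\<lambda>A. edge_ind g A * edge_ind h A)"
    "g \<in> pairs n" "h \<in> pairs n" "e \<in> pairs n"
    using other_sum_cases[OF assms] .
  show "0 \<le> other_sum e t A" "other_sum e t A \<le> 2" "0 \<le> other_prod e t A" "other_prod e t A \<le> 1"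
    by (simp_all add: gh(5,6) edge_ind_def)
qed

lemma other_change:
  assumes "t \<in> triples n" "e \<in> sides t"
  shows "\<bar>other_sum e t (insert f A) - other_sum e t (A - {f})\<bar> \<le> of_bool (f \<in> sides t - {e})"
    "\<bar>other_prod e t (insert f A) - other_prod e t (A - {f})\<bar> \<le> of_bool (f \<in> sides t - {e})"
proof -
  obtain g h where gh: "sides t = {e, g, h}" "e \<noteq> g" "e \<noteq> h" "g \<noteq> h"
    "other_sum e t = (\<lambda>A. edge_ind g A + edge_ind h A)"
    "other_prod e t = (\<lambda>A. edge_ind g A * edge_ind h A)"
    "g \<in> pairs n" "h \<in> pairs n" "e \<in> pairs n"
    using other_sum_cases[OF assms] .
  show "\<bar>other_sum e t (insert f A) - other_sum e t (A - {f})\<bar> \<le> of_bool (f \<in> sides t - {e})"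
    "\<bar>other_prod e t (insert f A) - other_prod e t (A - {f})\<bar> \<le> of_bool (f \<in> sides t - {e})"
    unfolding gh(1,5,6) edge_ind_def using gh(2-4)
    by (cases "f = g"; cases "f = h"; cases "g \<in> A"; cases "h \<in> A"; simp)+
qed

text \<open>Each of the \<open>n - 2\<close> triangles over \<open>e\<close> contributes at most 4 =
  1 + 2 + 1.\<close>

lemma l1_flip_diff_le:
  assumes "n \<ge> 2" "e \<in> pairs n"
  shows "l1 (flip_diff n e A) \<le> 4 * (real n - 2) / real n ^ 2"
proof -
  have "l1 (\<Sum>t\<in>triples_over n e. vector [1, other_sum e t A, other_prod e t A] :: real ^ 3)
      \<le> (\<Sum>t\<in>triples_over n e. 4)"
  proof (rule order_trans[OF l1_sum], rule sum_mono)
    fix t assume "t \<in> triples_over n e"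
    then have "t \<in> triples n" "e \<in> sides t" by (auto simp: triples_over_def)
    from other_bounds[OF this, of A]
    show "l1 (vector [1, other_sum e t A, other_prod e t A] :: real ^ 3) \<le> 4"
      by (simp add: l1_3)
  qed
  also have "\<dots> = 4 * (real n - 2)"
    using assms by (simp add: card_triples_over of_nat_diff)
  finally show ?thesis
    unfolding flip_diff_def l1_scaleR by (simp add: divide_right_mono)
qed

text \<open>The same 4 = 1 + 2 + 1 per triangle: the second entry is at most \<open>p + 1\<close>
  and the third at most 1/3 + 1/3 + 1/3.\<close>

lemma l1_stein_coeff_le:
  assumes "n \<ge> 2" "e \<in> pairs n" "0 \<le> p" "p \<le> 1"
  shows "l1 (stein_coeff n p e A) \<le> 4 * (real n - 2) / real n ^ 2"
proof -
  have "l1 (\<Sum>t\<in>triples_over n e. vector [1, p + other_sum e t A / 2,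
        p ^ 2 / 3 + p * other_sum e t A / 6 + other_prod e t A / 3] :: real ^ 3)
      \<le> (\<Sum>t\<in>triples_over n e. 4)"
  proof (rule order_trans[OF l1_sum], rule sum_mono)
    fix t assume "t \<in> triples_over n e"
    then have "t \<in> triples n" "e \<in> sides t" by (auto simp: triples_over_def)
    note b = other_bounds[OF this, of A]
    have "p * other_sum e t A \<le> 1 * 2"
      using b assms by (intro mult_mono) auto
    moreover have "0 \<le> p * other_sum e t A" "p ^ 2 \<le> 1" "0 \<le> p ^ 2"
      using b assms by (simp_all add: power_le_one)
    ultimately show "l1 (vector [1, p + other_sum e t A / 2,
        p ^ 2 / 3 + p * other_sum e t A / 6 + other_prod e t A / 3] :: real ^ 3) \<le> 4"
      using b assms unfolding l1_3 vector_3 by linarith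
  qed
  also have "\<dots> = 4 * (real n - 2)"
    using assms by (simp add: card_triples_over of_nat_diff)
  finally show ?thesis
    unfolding stein_coeff_def l1_scaleR by (simp add: divide_right_mono)
qed

text \<open>For edges of the complete graph this is 1 if they are distinct and share a vertex, and 0
  otherwise. It is written as a sum over triangles to match \<open>flip_diff\<close> and
  \<open>stein_coeff\<close>.\<close>

definition common_triples :: "nat \<Rightarrow> nat set \<Rightarrow> nat set \<Rightarrow> real" where
  "common_triples n e f = (\<Sum>t\<in>triples_over n e. of_bool (f \<in> sides t - {e}))"

text \<open>Each of the \<open>n - 2\<close> triangles over \<open>f\<close> has two further
  sides.\<close>

lemma sum_common_triples:
  assumes "n \<ge> 2" "f \<in> pairs n"
  shows "(\<Sum>e\<in>pairs n. common_triples n e f) = 2 * (real n - 2)"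
proof -
  have fin: "finite (sides t)" if "t \<in> triples n" for t
    by (rule finite_subset[OF sides_subset_pairs[OF that]]) simp
  have "(\<Sum>e\<in>pairs n. common_triples n e f) = (\<Sum>t\<in>triples n. \<Sum>e\<in>sides t. of_bool (f \<in> sides t - {e}))"
    unfolding common_triples_def by (rule sum_triples_over_swap)
  also have "\<dots> = (\<Sum>t\<in>triples_over n f. \<Sum>e\<in>sides t. of_bool (f \<in> sides t - {e}))"
    unfolding triples_over_def by (rule sum.mono_neutral_right) auto
  also have "\<dots> = (\<Sum>t\<in>triples_over n f. 2)"
  proof (intro sum.cong refl)
    fix t assume "t \<in> triples_over n f"
    then have t: "t \<in> triples n" "f \<in> sides t" by (auto simp: triples_over_def)
    have "(\<Sum>e\<in>sides t. of_bool (f \<in> sides t - {e}) :: real) = (\<Sum>e\<in>sides t - {f}. 1)"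
      using t fin by (intro sum.mono_neutral_cong_right) auto
    then show "(\<Sum>e\<in>sides t. of_bool (f \<in> sides t - {e}) :: real) = 2"
      using card_sides_diff[OF t] by simp
  qed
  also have "\<dots> = 2 * (real n - 2)"
    using assms by (simp add: card_triples_over of_nat_diff)
  finally show ?thesis .
qed

text \<open>In each triangle shared with \<open>f\<close> the last two entries move by at most 1
  each, while the first is constant; hence the factor 2.\<close>

lemma l1_flip_diff_change:
  "l1 (flip_diff n e (insert f A) - flip_diff n e (A - {f})) \<le> 2 * common_triples n e f / real n ^ 2"
proof -
  have "l1 (\<Sum>t\<in>triples_over n e. (vector [1, other_sum e t (insert f A), other_prod e t (insert f A)] -
          vector [1, other_sum e t (A - {f}), other_prod e t (A - {f})]) :: real ^ 3)
      \<le> (\<Sum>t\<in>triples_over n e. 2 * of_bool (f \<in> sides t - {e}))"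
  proof (rule order_trans[OF l1_sum], rule sum_mono)
    fix t assume "t \<in> triples_over n e"
    then have "t \<in> triples n" "e \<in> sides t" by (auto simp: triples_over_def)
    from other_change[OF this, of f A]
    show "l1 (vector [1, other_sum e t (insert f A), other_prod e t (insert f A)] -
          vector [1, other_sum e t (A - {f}), other_prod e t (A - {f})] :: real ^ 3)
        \<le> 2 * of_bool (f \<in> sides t - {e})"
      unfolding l1_3 vector_minus_component vector_3 by linarith
  qed
  then have "l1 ((1 / real n ^ 2) *\<^sub>R (\<Sum>t\<in>triples_over n e. (vector [1, other_sum e t (insert f A), other_prod e t (insert f A)] -
          vector [1, other_sum e t (A - {f}), other_prod e t (A - {f})]) :: real ^ 3)) \<le> 2 * common_triples n e f / real n ^ 2"
    unfolding l1_scaleR common_triples_def by (simp add: divide_right_mono sum_distrib_left)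
  then show ?thesis
    unfolding flip_diff_def sum_subtractf scaleR_right_diff_distrib .
qed

text \<open>A shared triangle contributes at most 1/2 in the second entry and 1/6 + 1/3 in the
  third, together 1.\<close>

lemma l1_stein_coeff_change:
  assumes "0 \<le> p" "p \<le> 1"
  shows "l1 (stein_coeff n p e (insert f A) - stein_coeff n p e (A - {f})) \<le> common_triples n e f / real n ^ 2"
proof -
  let ?v = "\<lambda>t A. vector [1, p + other_sum e t A / 2,
        p ^ 2 / 3 + p * other_sum e t A / 6 + other_prod e t A / 3] :: real ^ 3"
  have "l1 (\<Sum>t\<in>triples_over n e. ?v t (insert f A) - ?v t (A - {f}))
      \<le> (\<Sum>t\<in>triples_over n e. of_bool (f \<in> sides t - {e}))"
  proof (rule order_trans[OF l1_sum], rule sum_mono)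
    fix t assume "t \<in> triples_over n e"
    then have "t \<in> triples n" "e \<in> sides t" by (auto simp: triples_over_def)
    note c = other_change[OF this, of f A]
    let ?d = "other_sum e t (insert f A) - other_sum e t (A - {f})"
    have "\<bar>p * ?d\<bar> \<le> 1 * of_bool (f \<in> sides t - {e})"
      unfolding abs_mult using c assms by (intro mult_mono) auto
    then have "\<bar>p * other_sum e t (insert f A) - p * other_sum e t (A - {f})\<bar> \<le> of_bool (f \<in> sides t - {e})"
      by (simp add: right_diff_distrib)
    with c show "l1 (?v t (insert f A) - ?v t (A - {f})) \<le> of_bool (f \<in> sides t - {e})"
      unfolding l1_3 vector_minus_component vector_3 by linarith
  qed
  then have "l1 ((1 / real n ^ 2) *\<^sub>R (\<Sum>t\<in>triples_over n e. ?v t (insert f A) - ?v t (A - {f})))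
      \<le> common_triples n e f / real n ^ 2"
    unfolding l1_scaleR common_triples_def by (simp add: divide_right_mono)
  then show ?thesis
    unfolding stein_coeff_def sum_subtractf scaleR_right_diff_distrib .
qed

text \<open>The random matrix \<open>A\<close> of the overview. For a fixed edge set it need not be
  symmetric, since \<open>X e\<close> and \<open>D e\<close> differ; its expectation is.\<close>

definition stein_matrix :: "nat \<Rightarrow> real \<Rightarrow> nat set set \<Rightarrow> 3 \<Rightarrow> 3 \<Rightarrow> real" where
  "stein_matrix n p A i j = p * (1 - p) * (\<Sum>e\<in>pairs n. stein_coeff n p e A $ i * flip_diff n e A $ j)"

text \<open>Only the edges sharing a triangle with \<open>f\<close> contribute, so flipping
  \<open>f\<close> alters about \<open>2 * n\<close> of the roughly \<open>n ^ 2 / 2\<close>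
  summands. The 24 is \<open>(1 + 2) * 4 * 2\<close>: the changes of \<open>X\<close> and
  \<open>D\<close>, the bound on the unchanged factor, and the count of adjacent edges.\<close>

lemma stein_matrix_change:
  assumes "n \<ge> 2" "f \<in> pairs n" "0 \<le> p" "p \<le> 1"
  shows "(\<Sum>i\<in>UNIV. \<Sum>j\<in>UNIV. \<bar>stein_matrix n p (insert f A) i j - stein_matrix n p (A - {f}) i j\<bar>)
     \<le> p * (1 - p) * (24 * (real n - 2) ^ 2 / real n ^ 4)"
proof -
  let ?X = "stein_coeff n p" and ?D = "flip_diff n" and ?A1 = "insert f A" and ?A0 = "A - {f}"
  let ?b = "4 * (real n - 2) / real n ^ 2"
  have "(\<Sum>i\<in>UNIV. \<Sum>j\<in>UNIV. \<bar>stein_matrix n p ?A1 i j - stein_matrix n p ?A0 i j\<bar>)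
     = (\<Sum>i\<in>UNIV. \<Sum>j\<in>UNIV. p * (1 - p) * \<bar>\<Sum>e\<in>pairs n. ?X e ?A1 $ i * ?D e ?A1 $ j - ?X e ?A0 $ i * ?D e ?A0 $ j\<bar>)"
    unfolding stein_matrix_def right_diff_distrib[symmetric] sum_subtractf[symmetric]
    using assms by (simp add: abs_mult)
  also have "\<dots> \<le> (\<Sum>i\<in>UNIV. \<Sum>j\<in>UNIV. p * (1 - p) * (\<Sum>e\<in>pairs n.
       \<bar>(?X e ?A1 - ?X e ?A0) $ i\<bar> * \<bar>?D e ?A1 $ j\<bar> + \<bar>?X e ?A0 $ i\<bar> * \<bar>(?D e ?A1 - ?D e ?A0) $ j\<bar>))"
  proof (intro sum_mono mult_left_mono order_trans[OF sum_abs])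
    fix i j :: 3 and e
    \<comment> \<open>Product rule for differences, with the new value of \<open>D\<close> and the
      old value of \<open>X\<close>.\<close>
    have "?X e ?A1 $ i * ?D e ?A1 $ j - ?X e ?A0 $ i * ?D e ?A0 $ j =
       (?X e ?A1 - ?X e ?A0) $ i * ?D e ?A1 $ j + ?X e ?A0 $ i * (?D e ?A1 - ?D e ?A0) $ j"
      by (simp add: algebra_simps)
    then show "\<bar>?X e ?A1 $ i * ?D e ?A1 $ j - ?X e ?A0 $ i * ?D e ?A0 $ j\<bar> \<le>
      \<bar>(?X e ?A1 - ?X e ?A0) $ i\<bar> * \<bar>?D e ?A1 $ j\<bar> + \<bar>?X e ?A0 $ i\<bar> * \<bar>(?D e ?A1 - ?D e ?A0) $ j\<bar>"
      unfolding abs_mult[symmetric] using abs_triangle_ineq by simp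
  qed (use assms in auto)
  \<comment> \<open>The entrywise l1 norm of an outer product factors into the l1 norms of the two
    vectors.\<close>
  also have "\<dots> = p * (1 - p) * (\<Sum>e\<in>pairs n.
       l1 (?X e ?A1 - ?X e ?A0) * l1 (?D e ?A1) + l1 (?X e ?A0) * l1 (?D e ?A1 - ?D e ?A0))"
  proof -
    have "(\<Sum>i\<in>UNIV. \<Sum>j\<in>UNIV. p * (1 - p) * (\<Sum>e\<in>pairs n.
       \<bar>(?X e ?A1 - ?X e ?A0) $ i\<bar> * \<bar>?D e ?A1 $ j\<bar> + \<bar>?X e ?A0 $ i\<bar> * \<bar>(?D e ?A1 - ?D e ?A0) $ j\<bar>))
      = p * (1 - p) * (\<Sum>i\<in>UNIV. \<Sum>e\<in>pairs n. \<Sum>j\<in>UNIV.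
       \<bar>(?X e ?A1 - ?X e ?A0) $ i\<bar> * \<bar>?D e ?A1 $ j\<bar> + \<bar>?X e ?A0 $ i\<bar> * \<bar>(?D e ?A1 - ?D e ?A0) $ j\<bar>)"
      unfolding sum_distrib_left[symmetric] by (subst (3) sum.swap) (rule refl)
    also have "\<dots> = p * (1 - p) * (\<Sum>e\<in>pairs n. \<Sum>i\<in>UNIV. \<Sum>j\<in>UNIV.
       \<bar>(?X e ?A1 - ?X e ?A0) $ i\<bar> * \<bar>?D e ?A1 $ j\<bar> + \<bar>?X e ?A0 $ i\<bar> * \<bar>(?D e ?A1 - ?D e ?A0) $ j\<bar>)"
      by (subst sum.swap) (rule refl)
    finally show ?thesis
      unfolding l1_def sum_product sum.distrib .
  qed
  also have "\<dots> \<le> p * (1 - p) * (\<Sum>e\<in>pairs n.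
       common_triples n e f / real n ^ 2 * ?b + ?b * (2 * common_triples n e f / real n ^ 2))"
  proof (intro mult_left_mono sum_mono add_mono mult_mono)
    fix e assume "e \<in> pairs n"
    then show "l1 (?D e ?A1) \<le> ?b" "l1 (?X e ?A0) \<le> ?b"
      using assms by (intro l1_flip_diff_le l1_stein_coeff_le; simp)+
  qed (use assms l1_flip_diff_change l1_stein_coeff_change in \<open>auto simp: common_triples_def sum_nonneg\<close>)
  also have "\<dots> = p * (1 - p) * ((3 * ?b / real n ^ 2) * (\<Sum>e\<in>pairs n. common_triples n e f))"
    unfolding sum_distrib_left by (intro arg_cong2[where f="(*)"] refl sum.cong) (simp add: divide_inverse algebra_simps)
  also have "\<dots> = p * (1 - p) * (24 * (real n - 2) ^ 2 / real n ^ 4)"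
    unfolding sum_common_triples[OF assms(1,2)] by (simp add: field_simps power2_eq_square power4_eq_xxxx)
  finally show ?thesis .
qed

section \<open>Stein's identity for the graph statistics\<close>

text \<open>Centred by an explicit vector; that this is the mean follows from the decomposition and
  is shown in \<open>bern_ex_centred_stats\<close>.\<close>

definition centred_stats :: "nat \<Rightarrow> real \<Rightarrow> nat set set \<Rightarrow> real ^ 3" where
  "centred_stats n p A = graph_stats n A - (1 / real n ^ 2) *\<^sub>R (\<Sum>t\<in>triples n. vector [3 * p, 3 * p ^ 2, p ^ 3])"

lemma centred_stats_flip:
  assumes "n \<ge> 2" "e \<in> pairs n"
  shows "centred_stats n p (insert e A) - centred_stats n p (A - {e}) = flip_diff n e A"
  using graph_stats_flip[OF assms] by (simp add: centred_stats_def)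

text \<open>The Stein identity before any expansion: \<open>stein_decomposition\<close> followed by
  \<open>bern_ex_stein\<close> edge by edge.\<close>

lemma bern_ex_centred_stats_mult:
  assumes "n \<ge> 2"
  shows "bern_ex p (pairs n) (\<lambda>A. centred_stats n p A $ i * G A) =
    p * (1 - p) * (\<Sum>e\<in>pairs n. bern_ex p (pairs n)
      (\<lambda>A. stein_coeff n p e A $ i * (G (insert e A) - G (A - {e}))))"
proof -
  have "bern_ex p (pairs n) (\<lambda>A. centred_stats n p A $ i * G A) =
      (\<Sum>e\<in>pairs n. bern_ex p (pairs n) (\<lambda>A. (of_bool (e \<in> A) - p) * (stein_coeff n p e A $ i * G A)))"
    unfolding bern_ex_sum[symmetric] centred_stats_def stein_decomposition[OF assms, symmetric]
    by (simp add: sum_distrib_right edge_ind_def mult.assoc)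
  also have "\<dots> = (\<Sum>e\<in>pairs n. p * (1 - p) * bern_ex p (pairs n)
      (\<lambda>A. stein_coeff n p e A $ i * (G (insert e A) - G (A - {e}))))"
    by (intro sum.cong refl) (subst bern_ex_stein, auto simp: right_diff_distrib)
  finally show ?thesis by (simp add: sum_distrib_left)
qed

text \<open>The Stein identity with a constant test function, whose differences vanish.\<close>

lemma bern_ex_centred_stats:
  assumes "n \<ge> 2"
  shows "bern_ex p (pairs n) (\<lambda>A. centred_stats n p A $ i) = 0"
  using bern_ex_centred_stats_mult[OF assms, of p i "\<lambda>_. 1"] by (simp add: bern_ex_const)

text \<open>The Stein identity tested on the \<open>j\<close>-th coordinate of the statistics, whose
  difference is exactly \<open>flip_diff n e A $ j\<close>.\<close>

lemma bern_ex_stein_matrix: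
  assumes "n \<ge> 2"
  shows "bern_ex p (pairs n) (\<lambda>A. stein_matrix n p A i j) =
    bern_ex p (pairs n) (\<lambda>A. centred_stats n p A $ i * centred_stats n p A $ j)"
proof -
  have "bern_ex p (pairs n) (\<lambda>A. centred_stats n p A $ i * centred_stats n p A $ j) =
    p * (1 - p) * (\<Sum>e\<in>pairs n. bern_ex p (pairs n) (\<lambda>A. stein_coeff n p e A $ i * flip_diff n e A $ j))"
    unfolding bern_ex_centred_stats_mult[OF assms] vector_minus_component[symmetric]
    using centred_stats_flip[OF assms] by (simp cong: sum.cong)
  then show ?thesis
    by (simp add: stein_matrix_def bern_ex_cmult bern_ex_sum)
qed

text \<open>
  Two errors are collected: the Taylor remainder of the Stein identity, at most \<open>4 * K * s\<^sup>2 / n\<close>, and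
  the covariances of \<open>stein_matrix\<close> with the second derivatives \<open>H\<close>, at most \<open>3 * K * s\<^sup>2 / n\<close>.
\<close>

lemma graph_stein_bound:
  fixes G :: "3 \<Rightarrow> nat set set \<Rightarrow> real" and H :: "3 \<Rightarrow> 3 \<Rightarrow> nat set set \<Rightarrow> real"
  assumes n: "n \<ge> 2" and p: "0 \<le> p" "p \<le> 1" and K: "0 \<le> K" and s: "0 \<le> s"
    and G: "\<And>i e A. e \<in> pairs n \<Longrightarrow> A \<subseteq> pairs n \<Longrightarrow>
      \<bar>G i (insert e A) - G i (A - {e}) - s * (\<Sum>j\<in>UNIV. flip_diff n e A $ j * H i j A)\<bar>
        \<le> K / 2 * (s * l1 (flip_diff n e A)) ^ 2"
    and H: "\<And>i j e A. e \<in> pairs n \<Longrightarrow> A \<subseteq> pairs n \<Longrightarrow>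
      \<bar>H i j (insert e A) - H i j (A - {e})\<bar> \<le> K * (s * l1 (flip_diff n e A))"
  shows "\<bar>bern_ex p (pairs n) (\<lambda>A. \<Sum>i\<in>UNIV. centred_stats n p A $ i * G i A) -
     s * (\<Sum>i\<in>UNIV. \<Sum>j\<in>UNIV. bern_ex p (pairs n) (\<lambda>A. stein_matrix n p A i j) * bern_ex p (pairs n) (H i j))\<bar>
    \<le> 7 * K * s ^ 2 / n"
proof -
  let ?E = "bern_ex p (pairs n)" and ?X = "stein_coeff n p" and ?D = "flip_diff n"
  define b where "b = 4 * (real n - 2) / real n ^ 2"
  define pq where "pq = p * (1 - p)"
  have "1 / 4 - pq = (p - 1 / 2) * (p - 1 / 2)"
    by (simp add: pq_def algebra_simps)
  then have pq: "0 \<le> pq" "pq \<le> 1 / 4"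
    using p zero_le_square[of "p - 1 / 2"] by (simp add: pq_def, linarith)
  have b: "0 \<le> b" using n by (simp add: b_def)
  define N where "N = real (card (pairs n))"
  have N: "N = real n * (real n - 1) / 2"
  proof -
    have "card (pairs n) = n choose 2"
      unfolding pairs_def using n_subsets[of "{1..n}" 2] by simp
    then show ?thesis using n by (simp add: N_def choose_two real_of_nat_div of_nat_diff)
  qed
  have D: "l1 (?D e A) \<le> b" and X: "l1 (?X e A) \<le> b" if "e \<in> pairs n" for e A
    using l1_flip_diff_le[OF n that] l1_stein_coeff_le[OF n that p] by (auto simp: b_def)
  \<comment> \<open>The error of the first order expansion. It is taken about \<open>A\<close>
    itself, which is one of the two endpoints, so that \<open>H\<close> and
    \<open>stein_matrix\<close> appear at the same \<open>A\<close> and form a covariance.\<close>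
  define R where "R i e A = G i (insert e A) - G i (A - {e}) - s * (\<Sum>j\<in>UNIV. ?D e A $ j * H i j A)" for i e A
  have R: "\<bar>R i e A\<bar> \<le> K / 2 * (s * b) ^ 2" if "e \<in> pairs n" "A \<subseteq> pairs n" for i e A
    unfolding R_def
    using that K s D[OF that(1)]
    by (intro order_trans[OF G[OF that]] mult_left_mono power_mono) auto
  have "?E (\<lambda>A. \<Sum>i\<in>UNIV. centred_stats n p A $ i * G i A) =
      (\<Sum>i\<in>UNIV. pq * (\<Sum>e\<in>pairs n. ?E (\<lambda>A. ?X e A $ i * (G i (insert e A) - G i (A - {e})))))"
    unfolding pq_def by (simp add: bern_ex_sum bern_ex_centred_stats_mult[OF n])
  also have "\<dots> = (\<Sum>i\<in>UNIV. pq * (\<Sum>e\<in>pairs n. ?E (\<lambda>A. ?X e A $ i * R i e A) +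
      s * (\<Sum>j\<in>UNIV. ?E (\<lambda>A. ?X e A $ i * ?D e A $ j * H i j A))))"
    unfolding R_def bern_ex_sum[symmetric] bern_ex_cmult[symmetric] bern_ex_add[symmetric]
    by (simp add: algebra_simps sum_distrib_left)
  also have "\<dots> = pq * (\<Sum>e\<in>pairs n. ?E (\<lambda>A. \<Sum>i\<in>UNIV. ?X e A $ i * R i e A)) +
      s * (\<Sum>i\<in>UNIV. \<Sum>j\<in>UNIV. ?E (\<lambda>A. stein_matrix n p A i j * H i j A))"
  proof -
    have "(\<Sum>i\<in>UNIV. \<Sum>j\<in>UNIV. ?E (\<lambda>A. stein_matrix n p A i j * H i j A)) =
      pq * (\<Sum>i\<in>UNIV. \<Sum>j\<in>UNIV. \<Sum>e\<in>pairs n. ?E (\<lambda>A. ?X e A $ i * ?D e A $ j * H i j A))"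
      by (simp add: stein_matrix_def pq_def sum_distrib_right mult.assoc bern_ex_cmult bern_ex_sum sum_distrib_left)
    also have "\<dots> = pq * (\<Sum>i\<in>UNIV. \<Sum>e\<in>pairs n. \<Sum>j\<in>UNIV. ?E (\<lambda>A. ?X e A $ i * ?D e A $ j * H i j A))"
      by (intro arg_cong2[where f="(*)"] refl sum.cong sum.swap)
    finally have 1: "s * (\<Sum>i\<in>UNIV. \<Sum>j\<in>UNIV. ?E (\<lambda>A. stein_matrix n p A i j * H i j A)) =
      (\<Sum>i\<in>UNIV. pq * (\<Sum>e\<in>pairs n. s * (\<Sum>j\<in>UNIV. ?E (\<lambda>A. ?X e A $ i * ?D e A $ j * H i j A))))"
      by (simp add: sum_distrib_left mult.left_commute)
    have 2: "pq * (\<Sum>e\<in>pairs n. ?E (\<lambda>A. \<Sum>i\<in>UNIV. ?X e A $ i * R i e A)) =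
      (\<Sum>i\<in>UNIV. pq * (\<Sum>e\<in>pairs n. ?E (\<lambda>A. ?X e A $ i * R i e A)))"
      unfolding bern_ex_sum sum_distrib_left[symmetric] by (subst sum.swap) (rule refl)
    show ?thesis
      unfolding 1 2 sum.distrib[symmetric] distrib_left[symmetric] ..
  qed
  finally have split: "?E (\<lambda>A. \<Sum>i\<in>UNIV. centred_stats n p A $ i * G i A) -
     s * (\<Sum>i\<in>UNIV. \<Sum>j\<in>UNIV. ?E (\<lambda>A. stein_matrix n p A i j) * ?E (H i j)) =
     pq * (\<Sum>e\<in>pairs n. ?E (\<lambda>A. \<Sum>i\<in>UNIV. ?X e A $ i * R i e A)) +
     s * (\<Sum>i\<in>UNIV. \<Sum>j\<in>UNIV. ?E (\<lambda>A. stein_matrix n p A i j * H i j A) - ?E (\<lambda>A. stein_matrix n p A i j) * ?E (H i j))"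
    by (simp add: sum_subtractf right_diff_distrib)
  have rem: "\<bar>pq * (\<Sum>e\<in>pairs n. ?E (\<lambda>A. \<Sum>i\<in>UNIV. ?X e A $ i * R i e A))\<bar> \<le> pq * (N * (b * (K / 2 * (s * b) ^ 2)))"
  proof -
    have "\<bar>?E (\<lambda>A. \<Sum>i\<in>UNIV. ?X e A $ i * R i e A)\<bar> \<le> b * (K / 2 * (s * b) ^ 2)" if e: "e \<in> pairs n" for e
    proof (rule bern_ex_abs_le)
      fix A assume A: "A \<subseteq> pairs n"
      have "\<bar>\<Sum>i\<in>UNIV. ?X e A $ i * R i e A\<bar> \<le> (\<Sum>i\<in>UNIV. \<bar>?X e A $ i\<bar> * (K / 2 * (s * b) ^ 2))"
      proof (rule order_trans[OF sum_abs], rule sum_mono)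
        fix i
        show "\<bar>?X e A $ i * R i e A\<bar> \<le> \<bar>?X e A $ i\<bar> * (K / 2 * (s * b) ^ 2)"
          unfolding abs_mult using R[OF e A] by (intro mult_left_mono) auto
      qed
      also have "\<dots> = l1 (?X e A) * (K / 2 * (s * b) ^ 2)"
        by (simp add: l1_def sum_distrib_right)
      also have "\<dots> \<le> b * (K / 2 * (s * b) ^ 2)"
        using X[OF e] K by (intro mult_right_mono) auto
      finally show "\<bar>\<Sum>i\<in>UNIV. ?X e A $ i * R i e A\<bar> \<le> b * (K / 2 * (s * b) ^ 2)" .
    qed (use p in auto)
    then have "\<bar>\<Sum>e\<in>pairs n. ?E (\<lambda>A. \<Sum>i\<in>UNIV. ?X e A $ i * R i e A)\<bar> \<le> (\<Sum>e\<in>pairs n. b * (K / 2 * (s * b) ^ 2))"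
      by (intro order_trans[OF sum_abs] sum_mono)
    then show ?thesis
      unfolding abs_mult using pq by (intro mult_mono) (auto simp: N_def)
  qed
  have cov: "\<bar>\<Sum>i\<in>UNIV. \<Sum>j\<in>UNIV. ?E (\<lambda>A. stein_matrix n p A i j * H i j A) - ?E (\<lambda>A. stein_matrix n p A i j) * ?E (H i j)\<bar>
    \<le> pq * (N * (pq * (24 * (real n - 2) ^ 2 / real n ^ 4) * (K * (s * b))))"
  proof -
    \<comment> \<open>The two matrix indices are packed into one, so that the joint l1 bound of
      \<open>stein_matrix_change\<close> is the hypothesis on \<open>F\<close>.\<close>
    let ?F = "\<lambda>k A. stein_matrix n p A (fst k) (snd k)" and ?G = "\<lambda>k. H (fst k) (snd k)"
    have "\<bar>\<Sum>k\<in>UNIV. ?E (\<lambda>A. ?F k A * ?G k A) - ?E (?F k) * ?E (?G k)\<bar>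
      \<le> p * (1 - p) * (\<Sum>f\<in>pairs n. (pq * (24 * (real n - 2) ^ 2 / real n ^ 4)) * (K * (s * b)))"
    proof (rule bern_ex_covariance_le)
      fix f A assume f: "f \<in> pairs n"
      have "(\<Sum>k\<in>UNIV. \<bar>?F k (insert f A) - ?F k (A - {f})\<bar>) =
        (\<Sum>i\<in>UNIV. \<Sum>j\<in>UNIV. \<bar>stein_matrix n p (insert f A) i j - stein_matrix n p (A - {f}) i j\<bar>)"
        by (simp add: sum.cartesian_product split_beta)
      then show "(\<Sum>k\<in>UNIV. \<bar>?F k (insert f A) - ?F k (A - {f})\<bar>) \<le> pq * (24 * (real n - 2) ^ 2 / real n ^ 4)"
        using stein_matrix_change[OF n f p] by (simp add: pq_def)
    next
      fix k :: "3 \<times> 3" and f A assume f: "f \<in> pairs n" "A \<subseteq> pairs n"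
      show "\<bar>?G k (insert f A) - ?G k (A - {f})\<bar> \<le> K * (s * b)"
        using D[OF f(1)] K s by (intro order_trans[OF H[OF f]] mult_left_mono) auto
    qed (use p K s b in auto)
    moreover have "(\<Sum>k\<in>UNIV. ?E (\<lambda>A. ?F k A * ?G k A) - ?E (?F k) * ?E (?G k)) =
      (\<Sum>i\<in>UNIV. \<Sum>j\<in>UNIV. ?E (\<lambda>A. stein_matrix n p A i j * H i j A) - ?E (\<lambda>A. stein_matrix n p A i j) * ?E (H i j))"
      by (simp add: sum.cartesian_product split_beta)
    ultimately show ?thesis by (simp add: N_def pq_def mult.left_commute)
  qed
  define m where "m = real n - 2"
  have m: "0 \<le> m" "m \<le> n" "real n > 0" using n by (auto simp: m_def)
  have "N * m ^ 3 \<le> (real n ^ 2 / 2) * real n ^ 3"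
    using m n by (intro mult_mono power_mono) (auto simp: N power2_eq_square)
  then have Nm: "N * m ^ 3 / real n ^ 6 \<le> 1 / (2 * real n)"
    using m by (simp add: field_simps eval_nat_numeral)
  have b3: "b ^ 3 = 64 * (m ^ 3 / real n ^ 6)"
    by (simp add: b_def m_def[symmetric] power_divide power_mult_distrib flip: power_mult)
  have b1: "(24 * (real n - 2) ^ 2 / real n ^ 4) * b = 96 * (m ^ 3 / real n ^ 6)"
    by (simp add: b_def m_def[symmetric] power2_eq_square eval_nat_numeral)
  have t1: "pq * (N * (b * (K / 2 * (s * b) ^ 2))) = pq * (32 * (K * s ^ 2) * (N * m ^ 3 / real n ^ 6))"
  proof -
    have "pq * (N * (b * (K / 2 * (s * b) ^ 2))) = pq * (K / 2 * s ^ 2 * N * b ^ 3)"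
      by (simp add: power2_eq_square power3_eq_cube mult_ac)
    then show ?thesis unfolding b3 by (simp add: mult_ac)
  qed
  have t2: "s * (pq * (N * (pq * (24 * (real n - 2) ^ 2 / real n ^ 4) * (K * (s * b))))) =
    pq * pq * (96 * (K * s ^ 2) * (N * m ^ 3 / real n ^ 6))"
  proof -
    have "s * (pq * (N * (pq * y * (K * (s * b))))) = pq * pq * K * s ^ 2 * N * (y * b)" for y
      by (simp add: power2_eq_square mult_ac)
    note gen = this[of "24 * (real n - 2) ^ 2 / real n ^ 4"]
    show ?thesis unfolding gen b1 by (simp add: mult_ac)
  qed
  have x: "0 \<le> (K * s ^ 2) * (N * m ^ 3 / real n ^ 6)"
    using K m by (simp add: N_def)
  have pq2: "pq * pq \<le> 1 / 4 * (1 / 4)"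
    using pq by (intro mult_mono) auto
  have "\<bar>pq * (\<Sum>e\<in>pairs n. ?E (\<lambda>A. \<Sum>i\<in>UNIV. ?X e A $ i * R i e A)) +
     s * (\<Sum>i\<in>UNIV. \<Sum>j\<in>UNIV. ?E (\<lambda>A. stein_matrix n p A i j * H i j A) - ?E (\<lambda>A. stein_matrix n p A i j) * ?E (H i j))\<bar>
    \<le> pq * (32 * (K * s ^ 2) * (N * m ^ 3 / real n ^ 6)) + pq * pq * (96 * (K * s ^ 2) * (N * m ^ 3 / real n ^ 6))"
    unfolding t1[symmetric] t2[symmetric]
    using rem mult_left_mono[OF cov s] s by (intro order_trans[OF abs_triangle_ineq] add_mono) (auto simp: abs_mult)
  also have "\<dots> \<le> 1 / 4 * (32 * (K * s ^ 2) * (N * m ^ 3 / real n ^ 6)) + 1 / 4 * (1 / 4) * (96 * (K * s ^ 2) * (N * m ^ 3 / real n ^ 6))"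
    using x pq pq2 by (intro add_mono mult_right_mono) auto
  \<comment> \<open>Here 14 = 32 / 4 + 96 / 16. Bounding \<open>n - 1\<close> and
    \<open>n - 2\<close> by \<open>n\<close> leaves \<open>1 / (2 * n)\<close>, which halves the two
    parts to 4 and 3.\<close>
  also have "\<dots> = 14 * ((K * s ^ 2) * (N * m ^ 3 / real n ^ 6))"
    by simp
  also have "\<dots> \<le> 14 * ((K * s ^ 2) * (1 / (2 * real n)))"
    using Nm K by (intro mult_left_mono) auto
  also have "\<dots> = 7 * K * s ^ 2 / n" by simp
  finally show ?thesis unfolding split .
qed

section \<open>The covariance matrix\<close>

text \<open>Indicators are idempotent, so a product of monomials is the monomial of the union and
  repeated sides count once.\<close>

lemma edge_ind_monomial:
  "edge_ind f A = of_bool ({f} \<subseteq> A)"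
  "of_bool (S \<subseteq> A) * of_bool (T \<subseteq> A) = (of_bool (S \<union> T \<subseteq> A) :: real)"
  by (auto simp: edge_ind_def)

lemma bern_ex_monomial_pairs:
  "\<forall>f\<in>T. f \<in> pairs n \<Longrightarrow> bern_ex p (pairs n) (\<lambda>A. of_bool (T \<subseteq> A)) = p ^ card T"
  by (rule bern_ex_monomial) auto

lemma bern_ex_other:
  assumes "t \<in> triples n" "e \<in> sides t"
  shows "bern_ex p (pairs n) (other_sum e t) = 2 * p" "bern_ex p (pairs n) (other_prod e t) = p ^ 2"
proof -
  obtain f g where fg: "sides t = {e, f, g}" "e \<noteq> f" "e \<noteq> g" "f \<noteq> g"
    "other_sum e t = (\<lambda>A. edge_ind f A + edge_ind g A)"
    "other_prod e t = (\<lambda>A. edge_ind f A * edge_ind g A)"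
    "f \<in> pairs n" "g \<in> pairs n" "e \<in> pairs n"
    using other_sum_cases[OF assms] .
  show "bern_ex p (pairs n) (other_sum e t) = 2 * p" "bern_ex p (pairs n) (other_prod e t) = p ^ 2"
    unfolding fg(5,6) edge_ind_monomial bern_ex_add
    using fg by (simp_all add: bern_ex_monomial_pairs edge_ind_monomial(2) power2_eq_square del: insert_subset)
qed

text \<open>Distinct triangles over \<open>e\<close> share no further side, so their factors are
  independent and the moments multiply. On the diagonal squares of indicators collapse
  instead.\<close>

lemma bern_ex_other_mult:
  assumes t: "t \<in> triples_over n e" "t' \<in> triples_over n e"
  shows "bern_ex p (pairs n) (\<lambda>A. other_sum e t A * other_sum e t' A) =
      (if t = t' then 2 * p + 2 * p ^ 2 else 4 * p ^ 2)" (is ?ss)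
    "bern_ex p (pairs n) (\<lambda>A. other_sum e t A * other_prod e t' A) =
      (if t = t' then 2 * p ^ 2 else 2 * p ^ 3)" (is ?sp)
    "bern_ex p (pairs n) (\<lambda>A. other_prod e t A * other_prod e t' A) =
      (if t = t' then p ^ 2 else p ^ 4)" (is ?pp)
proof -
  have te: "t \<in> triples n" "e \<in> sides t" "t' \<in> triples n" "e \<in> sides t'"
    using t by (auto simp: triples_over_def)
  obtain f g where fg: "sides t = {e, f, g}" "e \<noteq> f" "e \<noteq> g" "f \<noteq> g"
    "other_sum e t = (\<lambda>A. edge_ind f A + edge_ind g A)"
    "other_prod e t = (\<lambda>A. edge_ind f A * edge_ind g A)"
    "f \<in> pairs n" "g \<in> pairs n" "e \<in> pairs n"
    using other_sum_cases[OF te(1,2)] .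
  obtain f' g' where fg': "sides t' = {e, f', g'}" "e \<noteq> f'" "e \<noteq> g'" "f' \<noteq> g'"
    "other_sum e t' = (\<lambda>A. edge_ind f' A + edge_ind g' A)"
    "other_prod e t' = (\<lambda>A. edge_ind f' A * edge_ind g' A)"
    "f' \<in> pairs n" "g' \<in> pairs n" "e \<in> pairs n"
    using other_sum_cases[OF te(3,4)] .
  have "?ss \<and> ?sp \<and> ?pp"
  proof (cases "t = t'")
    case True
    then show ?thesis
      unfolding fg(5,6) True[symmetric] edge_ind_monomial ring_distribs bern_ex_add
      using fg by (simp add: edge_ind_monomial(2) bern_ex_monomial_pairs bern_ex_add insert_commute eval_nat_numeral del: insert_subset)
  next
    case False
    \<comment> \<open>Two different sides of a triangle already span its three vertices, so a second
      common side forces the triangles to coincide.\<close>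
    have disj: False if "h \<in> sides t" "h \<in> sides t'" "h \<noteq> e" for h
    proof -
      have fin: "finite t" "finite t'" and c: "card t = 3" "card t' = 3"
        using te by (auto simp: triples_def intro: card_ge_0_finite)
      have h: "h \<subseteq> t" "h \<subseteq> t'" "e \<subseteq> t" "e \<subseteq> t'" "card h = 2" "card e = 2"
        using that te by (auto simp: sides_def)
      have "\<not> h \<subseteq> e"
        using h that(3) by (metis card_ge_0_finite card_subset_eq zero_less_numeral)
      then have "e \<subset> h \<union> e" by auto
      moreover have "h \<union> e \<subseteq> t" "h \<union> e \<subseteq> t'" using h by auto
      moreover have "finite (h \<union> e)" using \<open>h \<union> e \<subseteq> t\<close> fin finite_subset by blast
      ultimately have "card (h \<union> e) \<ge> 3" using psubset_card_mono[of "h \<union> e" e] h by simp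
      then have "h \<union> e = t" "h \<union> e = t'"
        using card_seteq[OF fin(1) \<open>h \<union> e \<subseteq> t\<close>] card_seteq[OF fin(2) \<open>h \<union> e \<subseteq> t'\<close>] c by simp_all
      then show False using False by simp
    qed
    have ne: "f \<noteq> f'" "f \<noteq> g'" "g \<noteq> f'" "g \<noteq> g'"
      using disj[of f] disj[of g] fg(1-4) fg'(1-4) by auto
    show ?thesis
      unfolding fg(5,6) fg'(5,6) edge_ind_monomial ring_distribs bern_ex_add
      using fg(2-4,7-9) fg'(2-4,7-9) ne False
      by (simp add: edge_ind_monomial(2) bern_ex_monomial_pairs bern_ex_add eval_nat_numeral del: insert_subset)
  qed
  then show ?ss ?sp ?pp by auto
qed

lemma sum_diagonal_or_off:
  assumes "finite S"
  shows "(\<Sum>s\<in>S. \<Sum>t\<in>S. if s = t then a else b) = real (card S) * a + real (card S) * (real (card S) - 1) * (b :: real)"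
proof -
  have "(\<Sum>t\<in>S. if s = t then a else b) = a + (real (card S) - 1) * b" if "s \<in> S" for s
  proof -
    have "(\<Sum>t\<in>S. if s = t then a else b) = a + (\<Sum>t\<in>S - {s}. if s = t then a else b)"
      using that assms by (subst sum.remove[of S s]) auto
    also have "(\<Sum>t\<in>S - {s}. if s = t then a else b) = (\<Sum>t\<in>S - {s}. b)"
      by (intro sum.cong) auto
    also have "\<dots> = (real (card S) - 1) * b"
    proof -
      have "card S > 0" using that assms by (auto simp: card_gt_0_iff)
      then show ?thesis using that assms by (simp add: card_Diff_singleton of_nat_diff Suc_leI)
    qed
    finally show ?thesis .
  qed
  then have "(\<Sum>s\<in>S. \<Sum>t\<in>S. if s = t then a else b) = (\<Sum>s\<in>S. a + (real (card S) - 1) * b)"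
    by (intro sum.cong) auto
  then show ?thesis by (simp add: algebra_simps)
qed

text \<open>With \<open>S e\<close> and \<open>Q e\<close> summed over the triangles through
  \<open>e\<close>, every entry is a second moment of \<open>1\<close>, \<open>S e\<close> and
  \<open>Q e\<close>, the same for all edges. The diagonal terms of these double sums produce the
  corrections of order \<open>1 / (n - 2)\<close> in \<open>Sigma1\<close>.\<close>

lemma bern_ex_stein_matrix_Sigma1:
  assumes n: "n \<ge> 3"
  shows "bern_ex p (pairs n) (\<lambda>A. stein_matrix n p A i j) = Sigma1 n p $ i $ j"
proof -
  let ?E = "bern_ex p (pairs n)"
  define m where "m = real n - 2"
  have m: "m > 0" using n by (simp add: m_def)
  define S Q where "S e A = (\<Sum>t\<in>triples_over n e. other_sum e t A)"
    and "Q e A = (\<Sum>t\<in>triples_over n e. other_prod e t A)" for e A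
  have card: "real (card (triples_over n e)) = m" if "e \<in> pairs n" for e
    using n by (simp add: m_def card_triples_over[OF that] of_nat_diff)
  have D: "flip_diff n e A = (1 / real n ^ 2) *\<^sub>R vector [m, S e A, Q e A]" if "e \<in> pairs n" for e A
    unfolding flip_diff_def vec_eq_iff forall_3 S_def Q_def by (simp add: card[OF that])
  have X: "stein_coeff n p e A = (1 / real n ^ 2) *\<^sub>R
      vector [m, p * m + S e A / 2, p ^ 2 / 3 * m + p / 6 * S e A + Q e A / 3]" if "e \<in> pairs n" for e A
    unfolding stein_coeff_def vec_eq_iff forall_3 S_def Q_def
    by (simp add: card[OF that] sum.distrib sum_divide_distrib[symmetric] sum_distrib_left[symmetric])
  have ES: "?E (S e) = 2 * p * m" and EQ: "?E (Q e) = p ^ 2 * m" if "e \<in> pairs n" for e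
    unfolding S_def Q_def bern_ex_sum
    by (simp_all add: triples_over_def bern_ex_other card[OF that, unfolded triples_over_def])
  have ESS: "?E (\<lambda>A. S e A * S e A) = m * (2 * p + 2 * p ^ 2) + m * (m - 1) * (4 * p ^ 2)"
    and ESQ: "?E (\<lambda>A. S e A * Q e A) = m * (2 * p ^ 2) + m * (m - 1) * (2 * p ^ 3)"
    and EQQ: "?E (\<lambda>A. Q e A * Q e A) = m * p ^ 2 + m * (m - 1) * p ^ 4" if "e \<in> pairs n" for e
    unfolding S_def Q_def sum_product bern_ex_sum card[OF that, symmetric]
    by (subst sum_diagonal_or_off[symmetric]; simp add: bern_ex_other_mult cong: sum.cong)+
  define N where "N = real (card (pairs n))"
  \<comment> \<open>Counts incidences of edges and triangles in two ways; it converts the binomial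
    factor of \<open>Sigma1\<close> into the number of edges.\<close>
  have N: "3 * real (n choose 3) = m * N"
  proof -
    have "(\<Sum>e\<in>pairs n. \<Sum>t\<in>triples_over n e. 1) = (\<Sum>t\<in>triples n. \<Sum>e\<in>sides t. 1 :: real)"
      by (rule sum_triples_over_swap)
    moreover have "card (sides t) = 3" if t: "t \<in> triples n" for t
    proof -
      have "card t = 3" "finite t" using t by (auto simp: triples_def intro: card_ge_0_finite)
      then show ?thesis using n_subsets[of t 2] by (simp add: sides_def choose_two)
    qed
    moreover have "card (triples n) = n choose 3"
      unfolding triples_def using n_subsets[of "{1..n}" 3] by simp
    ultimately show ?thesis by (simp add: card N_def mult.commute)
  qed
  have entry: "?E (\<lambda>A. stein_matrix n p A i j) = p * (1 - p) * N * c / real n ^ 4"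
    if "\<And>e. e \<in> pairs n \<Longrightarrow> real n ^ 4 * ?E (\<lambda>A. stein_coeff n p e A $ i * flip_diff n e A $ j) = c" for i j c
  proof -
    have "?E (\<lambda>A. stein_coeff n p e A $ i * flip_diff n e A $ j) = c / real n ^ 4" if "e \<in> pairs n" for e
      using \<open>\<And>e. e \<in> pairs n \<Longrightarrow> _ = c\<close>[OF that] n by (simp add: field_simps)
    then show ?thesis
      unfolding stein_matrix_def bern_ex_cmult bern_ex_sum by (simp add: N_def)
  qed
  have Sig: "Sigma1 n p $ i $ j = p * (1 - p) * N / real n ^ 4 * (m ^ 2 * (vector
       [vector [1, 2 * p, p ^ 2],
        vector [2 * p, 4 * p ^ 2 + p * (1 - p) / m, 2 * p ^ 3 + p ^ 2 * (1 - p) / m],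
        vector [p ^ 2, 2 * p ^ 3 + p ^ 2 * (1 - p) / m,
                p ^ 4 + p ^ 2 * (1 + p - 2 * p ^ 2) / (3 * m)]] :: real ^ 3 ^ 3) $ i $ j)" for i j
    unfolding Sigma1_def m_def[symmetric] using N by (simp add: power2_eq_square field_simps)
  have u11: "?E (\<lambda>A. stein_matrix n p A 1 1) = Sigma1 n p $ 1 $ 1"
  proof (subst entry)
    fix e assume e: "e \<in> pairs n"
    have "real n ^ 4 * ?E (\<lambda>A. stein_coeff n p e A $ 1 * flip_diff n e A $ 1) = ?E (\<lambda>A. m * m)"
      unfolding bern_ex_cmult[symmetric] using n
      by (intro bern_ex_cong) (simp add: X[OF e] D[OF e] power2_eq_square power4_eq_xxxx; simp add: algebra_simps)
    also have "\<dots> = m ^ 2"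
      unfolding bern_ex_add bern_ex_cmult ES[OF e] EQ[OF e] ESS[OF e] ESQ[OF e] EQQ[OF e] bern_ex_const[OF finite_pairs]
      by (simp add: power2_eq_square power3_eq_cube power4_eq_xxxx algebra_simps add_divide_distrib diff_divide_distrib)
    finally show "real n ^ 4 * ?E (\<lambda>A. stein_coeff n p e A $ 1 * flip_diff n e A $ 1) = m ^ 2" .
  next
    show "p * (1 - p) * N * (m ^ 2) / real n ^ 4 = Sigma1 n p $ 1 $ 1"
      unfolding Sig using m by (simp add: power2_eq_square power3_eq_cube power4_eq_xxxx; simp add: field_simps)
  qed
  have u12: "?E (\<lambda>A. stein_matrix n p A 1 2) = Sigma1 n p $ 1 $ 2"
  proof (subst entry)
    fix e assume e: "e \<in> pairs n"
    have "real n ^ 4 * ?E (\<lambda>A. stein_coeff n p e A $ 1 * flip_diff n e A $ 2) = ?E (\<lambda>A. m * S e A)"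
      unfolding bern_ex_cmult[symmetric] using n
      by (intro bern_ex_cong) (simp add: X[OF e] D[OF e] power2_eq_square power4_eq_xxxx; simp add: algebra_simps)
    also have "\<dots> = 2 * p * m ^ 2"
      unfolding bern_ex_add bern_ex_cmult ES[OF e] EQ[OF e] ESS[OF e] ESQ[OF e] EQQ[OF e] bern_ex_const[OF finite_pairs]
      by (simp add: power2_eq_square power3_eq_cube power4_eq_xxxx algebra_simps add_divide_distrib diff_divide_distrib)
    finally show "real n ^ 4 * ?E (\<lambda>A. stein_coeff n p e A $ 1 * flip_diff n e A $ 2) = 2 * p * m ^ 2" .
  next
    show "p * (1 - p) * N * (2 * p * m ^ 2) / real n ^ 4 = Sigma1 n p $ 1 $ 2"
      unfolding Sig using m by (simp add: power2_eq_square power3_eq_cube power4_eq_xxxx; simp add: field_simps)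
  qed
  have u13: "?E (\<lambda>A. stein_matrix n p A 1 3) = Sigma1 n p $ 1 $ 3"
  proof (subst entry)
    fix e assume e: "e \<in> pairs n"
    have "real n ^ 4 * ?E (\<lambda>A. stein_coeff n p e A $ 1 * flip_diff n e A $ 3) = ?E (\<lambda>A. m * Q e A)"
      unfolding bern_ex_cmult[symmetric] using n
      by (intro bern_ex_cong) (simp add: X[OF e] D[OF e] power2_eq_square power4_eq_xxxx; simp add: algebra_simps)
    also have "\<dots> = p ^ 2 * m ^ 2"
      unfolding bern_ex_add bern_ex_cmult ES[OF e] EQ[OF e] ESS[OF e] ESQ[OF e] EQQ[OF e] bern_ex_const[OF finite_pairs]
      by (simp add: power2_eq_square power3_eq_cube power4_eq_xxxx algebra_simps add_divide_distrib diff_divide_distrib)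
    finally show "real n ^ 4 * ?E (\<lambda>A. stein_coeff n p e A $ 1 * flip_diff n e A $ 3) = p ^ 2 * m ^ 2" .
  next
    show "p * (1 - p) * N * (p ^ 2 * m ^ 2) / real n ^ 4 = Sigma1 n p $ 1 $ 3"
      unfolding Sig using m by (simp add: power2_eq_square power3_eq_cube power4_eq_xxxx; simp add: field_simps)
  qed
  have u22: "?E (\<lambda>A. stein_matrix n p A 2 2) = Sigma1 n p $ 2 $ 2"
  proof (subst entry)
    fix e assume e: "e \<in> pairs n"
    have "real n ^ 4 * ?E (\<lambda>A. stein_coeff n p e A $ 2 * flip_diff n e A $ 2) = ?E (\<lambda>A. p * m * S e A + 1 / 2 * (S e A * S e A))"
      unfolding bern_ex_cmult[symmetric] using n
      by (intro bern_ex_cong) (simp add: X[OF e] D[OF e] power2_eq_square power4_eq_xxxx; simp add: algebra_simps)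
    also have "\<dots> = 4 * p ^ 2 * m ^ 2 + p * (1 - p) * m"
      unfolding bern_ex_add bern_ex_cmult ES[OF e] EQ[OF e] ESS[OF e] ESQ[OF e] EQQ[OF e] bern_ex_const[OF finite_pairs]
      by (simp add: power2_eq_square power3_eq_cube power4_eq_xxxx algebra_simps add_divide_distrib diff_divide_distrib)
    finally show "real n ^ 4 * ?E (\<lambda>A. stein_coeff n p e A $ 2 * flip_diff n e A $ 2) = 4 * p ^ 2 * m ^ 2 + p * (1 - p) * m" .
  next
    show "p * (1 - p) * N * (4 * p ^ 2 * m ^ 2 + p * (1 - p) * m) / real n ^ 4 = Sigma1 n p $ 2 $ 2"
      unfolding Sig using m by (simp add: power2_eq_square power3_eq_cube power4_eq_xxxx; simp add: field_simps)
  qed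
  have u23: "?E (\<lambda>A. stein_matrix n p A 2 3) = Sigma1 n p $ 2 $ 3"
  proof (subst entry)
    fix e assume e: "e \<in> pairs n"
    have "real n ^ 4 * ?E (\<lambda>A. stein_coeff n p e A $ 2 * flip_diff n e A $ 3) = ?E (\<lambda>A. p * m * Q e A + 1 / 2 * (S e A * Q e A))"
      unfolding bern_ex_cmult[symmetric] using n
      by (intro bern_ex_cong) (simp add: X[OF e] D[OF e] power2_eq_square power4_eq_xxxx; simp add: algebra_simps)
    also have "\<dots> = 2 * p ^ 3 * m ^ 2 + p ^ 2 * (1 - p) * m"
      unfolding bern_ex_add bern_ex_cmult ES[OF e] EQ[OF e] ESS[OF e] ESQ[OF e] EQQ[OF e] bern_ex_const[OF finite_pairs]
      by (simp add: power2_eq_square power3_eq_cube power4_eq_xxxx algebra_simps add_divide_distrib diff_divide_distrib)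
    finally show "real n ^ 4 * ?E (\<lambda>A. stein_coeff n p e A $ 2 * flip_diff n e A $ 3) = 2 * p ^ 3 * m ^ 2 + p ^ 2 * (1 - p) * m" .
  next
    show "p * (1 - p) * N * (2 * p ^ 3 * m ^ 2 + p ^ 2 * (1 - p) * m) / real n ^ 4 = Sigma1 n p $ 2 $ 3"
      unfolding Sig using m by (simp add: power2_eq_square power3_eq_cube power4_eq_xxxx; simp add: field_simps)
  qed
  have u33: "?E (\<lambda>A. stein_matrix n p A 3 3) = Sigma1 n p $ 3 $ 3"
  proof (subst entry)
    fix e assume e: "e \<in> pairs n"
    have "real n ^ 4 * ?E (\<lambda>A. stein_coeff n p e A $ 3 * flip_diff n e A $ 3) = ?E (\<lambda>A. p ^ 2 / 3 * m * Q e A + p / 6 * (S e A * Q e A) + 1 / 3 * (Q e A * Q e A))"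
      unfolding bern_ex_cmult[symmetric] using n
      by (intro bern_ex_cong) (simp add: X[OF e] D[OF e] power2_eq_square power4_eq_xxxx; simp add: algebra_simps)
    also have "\<dots> = p ^ 4 * m ^ 2 + p ^ 2 * (1 + p - 2 * p ^ 2) / 3 * m"
      unfolding bern_ex_add bern_ex_cmult ES[OF e] EQ[OF e] ESS[OF e] ESQ[OF e] EQQ[OF e] bern_ex_const[OF finite_pairs]
      by (simp add: power2_eq_square power3_eq_cube power4_eq_xxxx algebra_simps add_divide_distrib diff_divide_distrib)
    finally show "real n ^ 4 * ?E (\<lambda>A. stein_coeff n p e A $ 3 * flip_diff n e A $ 3) = p ^ 4 * m ^ 2 + p ^ 2 * (1 + p - 2 * p ^ 2) / 3 * m" .
  next
    show "p * (1 - p) * N * (p ^ 4 * m ^ 2 + p ^ 2 * (1 + p - 2 * p ^ 2) / 3 * m) / real n ^ 4 = Sigma1 n p $ 3 $ 3"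
      unfolding Sig using m by (simp add: power2_eq_square power3_eq_cube power4_eq_xxxx; simp add: field_simps)
  qed
  \<comment> \<open>The roles of \<open>X\<close> and \<open>D\<close> differ, so symmetry comes
    from the identification with a covariance; it supplies the entries below the diagonal.\<close>
  have E_sym: "?E (\<lambda>A. stein_matrix n p A i j) = ?E (\<lambda>A. stein_matrix n p A j i)" for i j
  proof -
    have "n \<ge> 2" using n by simp
    then show ?thesis by (simp add: bern_ex_stein_matrix mult.commute)
  qed
  have "Sigma1 n p $ 2 $ 1 = Sigma1 n p $ 1 $ 2" "Sigma1 n p $ 3 $ 1 = Sigma1 n p $ 1 $ 3"
    "Sigma1 n p $ 3 $ 2 = Sigma1 n p $ 2 $ 3"
    by (simp_all add: Sig)
  then have "?E (\<lambda>A. stein_matrix n p A 2 1) = Sigma1 n p $ 2 $ 1"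
    "?E (\<lambda>A. stein_matrix n p A 3 1) = Sigma1 n p $ 3 $ 1"
    "?E (\<lambda>A. stein_matrix n p A 3 2) = Sigma1 n p $ 3 $ 2"
    using E_sym[of 2 1] E_sym[of 3 1] E_sym[of 3 2] u12 u13 u23 by (simp_all only:)
  with u11 u12 u13 u22 u23 u33 show ?thesis
    using exhaust_3[of i] exhaust_3[of j] by (elim disjE; simp only:)
qed

section \<open>From the random graph to random subsets\<close>

definition present_edges :: "nat \<Rightarrow> (nat set \<Rightarrow> 'a \<Rightarrow> real) \<Rightarrow> 'a \<Rightarrow> nat set set" where
  "present_edges n I \<omega> = {e \<in> pairs n. I e \<omega> = 1}"

lemma borel_measurable_vec:
  fixes f :: "'a \<Rightarrow> real ^ 'n"
  assumes "\<And>i. (\<lambda>x. f x $ i) \<in> borel_measurable M"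
  shows "f \<in> borel_measurable M"
proof (rule borel_measurable_euclidean_space[THEN iffD2], rule ballI)
  fix b :: "real ^ 'n" assume "b \<in> Basis"
  then obtain i where "b = axis i 1" by (auto simp: Basis_vec_def)
  then show "(\<lambda>x. f x \<bullet> b) \<in> borel_measurable M"
    using assms[of i] by (simp add: inner_axis)
qed

lemma pairs_nonempty: "n \<ge> 2 \<Longrightarrow> pairs n \<noteq> {}"
  unfolding pairs_def by (auto intro!: exI[of _ "{1, 2}"])

context
  fixes M :: "'a measure" and n :: nat and p :: real and I :: "nat set \<Rightarrow> 'a \<Rightarrow> real"
  assumes graph: "bernoulli_random_graph M n p I" and n: "n \<ge> 2" and p: "0 \<le> p" "p \<le> 1"
begin

interpretation prob_space M
  using graph by (simp add: bernoulli_random_graph_def)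

lemma edge_measurable: "e \<in> pairs n \<Longrightarrow> I e \<in> borel_measurable M"
  using graph by (auto simp: bernoulli_random_graph_def indep_vars_def)

lemma prob_edge:
  assumes e: "e \<in> pairs n" and B: "B \<in> sets borel"
  shows "prob (I e -` B \<inter> space M) = measure (bernoulli_pmf p) {x. of_bool x \<in> B}"
proof -
  note [measurable] = edge_measurable[OF e]
  have "prob (I e -` B \<inter> space M) = measure (distr M borel (I e)) B"
    using e B by (subst measure_distr) auto
  also have "distr M borel (I e) = distr (measure_pmf (bernoulli_pmf p)) borel of_bool"
    using graph e by (simp add: bernoulli_random_graph_def)
  also have "measure \<dots> B = measure (bernoulli_pmf p) {x. of_bool x \<in> B}"
    using B by (subst measure_distr) (auto simp: vimage_def)
  finally show ?thesis .
qed

text \<open>Only the laws of the indicators are prescribed, so they take the values 0 and 1 merely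
  almost surely.\<close>

lemma edge_zero_one: "AE \<omega> in M. \<forall>e\<in>pairs n. I e \<omega> = edge_ind e (present_edges n I \<omega>)"
proof (rule AE_finite_allI)
  show "finite (pairs n)" by simp
next
  fix e assume e: "e \<in> pairs n"
  note [measurable] = edge_measurable[OF e]
  have "{x. (of_bool x :: real) \<in> {0, 1}} = UNIV" by auto
  then have "prob (I e -` {0, 1} \<inter> space M) = 1"
    using prob_edge[OF e, of "{0, 1}"] by simp
  then have "AE \<omega> in M. \<omega> \<in> I e -` {0, 1} \<inter> space M"
    using e by (intro AE_prob_1) simp
  then show "AE \<omega> in M. I e \<omega> = edge_ind e (present_edges n I \<omega>)"
    by eventually_elim (use e in \<open>auto simp: edge_ind_def present_edges_def\<close>)
qed

lemma present_edges_measurable: "present_edges n I \<in> measurable M (count_space (Pow (pairs n)))"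
proof -
  have fin: "finite (Pow (pairs n))" by simp
  have "present_edges n I -` {B} \<inter> space M \<in> sets M" if B: "B \<in> Pow (pairs n)" for B
  proof -
    have "present_edges n I -` {B} \<inter> space M = {\<omega>\<in>space M. \<forall>e\<in>pairs n. (I e \<omega> = 1) = (e \<in> B)}"
      using B unfolding present_edges_def by blast
    also have "\<dots> \<in> sets M"
      using edge_measurable by (intro sets.sets_Collect_finite_All' finite_pairs pairs_nonempty n) measurable
    finally show ?thesis .
  qed
  moreover have "present_edges n I \<in> space M \<rightarrow> Pow (pairs n)"
    by (auto simp: present_edges_def)
  ultimately show ?thesis
    unfolding measurable_count_space_eq2[OF fin] by simp
qed

lemma prob_present_edges:
  assumes B: "B \<subseteq> pairs n"
  shows "prob (present_edges n I -` {B} \<inter> space M) = p ^ card B * (1 - p) ^ card (pairs n - B)"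
proof -
  \<comment> \<open>An absent edge is recorded as "not 1" rather than "0", in line with
    \<open>present_edges\<close>. The event identity is then exact, not just almost sure.\<close>
  let ?T = "\<lambda>e. if e \<in> B then {1} else - {1 :: real}"
  have "present_edges n I -` {B} \<inter> space M = (\<Inter>e\<in>pairs n. I e -` ?T e \<inter> space M)"
  proof -
    have 1: "present_edges n I -` {B} \<inter> space M = {\<omega> \<in> space M. \<forall>e\<in>pairs n. (I e \<omega> = 1) = (e \<in> B)}"
      using B unfolding present_edges_def by blast
    have 2: "((I e \<omega> = 1) = (e \<in> B)) = (I e \<omega> \<in> ?T e)" for e \<omega>
      by simp
    show ?thesis
      unfolding 1 2 using pairs_nonempty[OF n] by blast
  qed
  then have "prob (present_edges n I -` {B} \<inter> space M) = prob (\<Inter>e\<in>pairs n. I e -` ?T e \<inter> space M)"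
    by (rule arg_cong)
  also have "\<dots> = (\<Prod>e\<in>pairs n. prob (I e -` ?T e \<inter> space M))"
    using graph pairs_nonempty[OF n] by (intro indep_varsD) (auto simp: bernoulli_random_graph_def)
  also have "\<dots> = (\<Prod>e\<in>pairs n. if e \<in> B then p else 1 - p)"
  proof (intro prod.cong refl)
    fix e assume e: "e \<in> pairs n"
    have "{x. (of_bool x :: real) = 1} = {True}" "{x. (of_bool x :: real) \<noteq> 1} = {False}" by auto
    then show "prob (I e -` ?T e \<inter> space M) = (if e \<in> B then p else 1 - p)"
      using prob_edge[OF e, of "?T e"] p by (auto simp: measure_pmf_single)
  qed
  also have "\<dots> = p ^ card B * (1 - p) ^ card (pairs n - B)"
    using B by (simp add: prod.If_cases Int_absorb1 Diff_eq[symmetric])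
  finally show ?thesis .
qed

text \<open>The random edge set has finitely many values, so any function of it is a finite
  combination of indicators and no integrability condition on \<open>H\<close> arises.\<close>

lemma integral_present_edges:
  "(\<integral>\<omega>. H (present_edges n I \<omega>) \<partial>M) = bern_ex p (pairs n) H"
proof -
  note [measurable] = present_edges_measurable
  have "(\<integral>\<omega>. H (present_edges n I \<omega>) \<partial>M) =
    (\<integral>\<omega>. (\<Sum>B\<in>Pow (pairs n). H B * indicator (present_edges n I -` {B} \<inter> space M) \<omega>) \<partial>M)"
  proof (intro Bochner_Integration.integral_cong refl)
    fix \<omega> assume "\<omega> \<in> space M"
    then have "(\<Sum>B\<in>Pow (pairs n). H B * indicator (present_edges n I -` {B} \<inter> space M) \<omega>) =
      (\<Sum>B\<in>Pow (pairs n). if B = present_edges n I \<omega> then H B else 0)"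
      by (intro sum.cong) (auto simp: indicator_def)
    then show "H (present_edges n I \<omega>) = (\<Sum>B\<in>Pow (pairs n). H B * indicator (present_edges n I -` {B} \<inter> space M) \<omega>)"
      by (simp add: present_edges_def)
  qed
  also have "\<dots> = (\<Sum>B\<in>Pow (pairs n). H B * prob (present_edges n I -` {B} \<inter> space M))"
    by (subst Bochner_Integration.integral_sum) (auto simp: emeasure_eq_measure)
  also have "\<dots> = bern_ex p (pairs n) H"
    unfolding bern_ex_def by (intro sum.cong refl) (simp add: prob_present_edges)
  finally show ?thesis .
qed

section \<open>Transfer of the three counts and of \<open>W1\<close> to the random edge set\<close>

lemma counts_measurable:
  "T1 n I \<in> borel_measurable M" "V1 n I \<in> borel_measurable M" "U1 n I \<in> borel_measurable M"
proof -
  have *: "{i, j} \<in> pairs n" if "i \<in> {1..n}" "j \<in> {i<..n}" for i j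
    using that by (simp add: pairs_def)
  have **: "{j, k} \<in> pairs n" "{i, k} \<in> pairs n" "{i, j} \<in> pairs n"
    if "i \<in> {1..n}" "j \<in> {i<..n}" "k \<in> {j<..n}" for i j k
    using that by (simp_all add: pairs_def)
  show "T1 n I \<in> borel_measurable M"
    unfolding T1_def edge_count_def
    by (intro borel_measurable_times borel_measurable_sum borel_measurable_const edge_measurable *)
  show "V1 n I \<in> borel_measurable M" "U1 n I \<in> borel_measurable M"
    unfolding V1_def two_star_count_def U1_def triangle_count_def
    by (intro borel_measurable_times borel_measurable_sum borel_measurable_const borel_measurable_add
        edge_measurable **; assumption)+
qed

lemma counts_present_edges:
  "AE \<omega> in M. T1 n I \<omega> = T1 n edge_ind (present_edges n I \<omega>) \<and>
     V1 n I \<omega> = V1 n edge_ind (present_edges n I \<omega>) \<and>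
     U1 n I \<omega> = U1 n edge_ind (present_edges n I \<omega>)"
  using edge_zero_one
proof eventually_elim
  case (elim \<omega>)
  have 1: "I {i, j} \<omega> = edge_ind {i, j} (present_edges n I \<omega>)" if "i \<in> {1..n}" "j \<in> {i<..n}" for i j
    using that elim by (simp add: pairs_def)
  have 2: "I {i, k} \<omega> = edge_ind {i, k} (present_edges n I \<omega>)" "I {j, k} \<omega> = edge_ind {j, k} (present_edges n I \<omega>)"
    if "i \<in> {1..n}" "j \<in> {i<..n}" "k \<in> {j<..n}" for i j k
    using that elim by (simp_all add: pairs_def)
  show ?case
    unfolding T1_def V1_def U1_def edge_count_def two_star_count_def triangle_count_def
    by (intro conjI arg_cong2[where f="(*)"] refl sum.cong) (simp_all only: 1 2)
qed

lemma integral_counts: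
  "integral\<^sup>L M (T1 n I) = bern_ex p (pairs n) (\<lambda>A. graph_stats n A $ 1)"
  "integral\<^sup>L M (V1 n I) = bern_ex p (pairs n) (\<lambda>A. graph_stats n A $ 2)"
  "integral\<^sup>L M (U1 n I) = bern_ex p (pairs n) (\<lambda>A. graph_stats n A $ 3)"
proof -
  note [measurable] = counts_measurable
  have "integral\<^sup>L M F = bern_ex p (pairs n) G"
    if "F \<in> borel_measurable M" "AE \<omega> in M. F \<omega> = G (present_edges n I \<omega>)" for F :: "'a \<Rightarrow> real" and G
    unfolding integral_present_edges[symmetric]
    using that by (intro integral_cong_AE) (auto intro: measurable_compose[OF present_edges_measurable])
  then show "integral\<^sup>L M (T1 n I) = bern_ex p (pairs n) (\<lambda>A. graph_stats n A $ 1)"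
    "integral\<^sup>L M (V1 n I) = bern_ex p (pairs n) (\<lambda>A. graph_stats n A $ 2)"
    "integral\<^sup>L M (U1 n I) = bern_ex p (pairs n) (\<lambda>A. graph_stats n A $ 3)"
    using counts_present_edges by (simp_all add: graph_stats_def)
qed

lemma bern_ex_graph_stats:
  "bern_ex p (pairs n) (\<lambda>A. graph_stats n A $ i) =
    ((1 / real n ^ 2) *\<^sub>R (\<Sum>t\<in>triples n. vector [3 * p, 3 * p ^ 2, p ^ 3] :: real ^ 3)) $ i"
  using bern_ex_centred_stats[OF n, of p i]
  unfolding centred_stats_def vector_minus_component bern_ex_diff bern_ex_const[OF finite_pairs] by simp

lemma W1_present_edges: "AE \<omega> in M. W1 M n I \<omega> = centred_stats n p (present_edges n I \<omega>)"
  using counts_present_edges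
proof eventually_elim
  case (elim \<omega>)
  then show ?case
    unfolding W1_def integral_counts bern_ex_graph_stats centred_stats_def vec_eq_iff forall_3
    by (simp add: graph_stats_def)
qed

lemma W1_measurable: "W1 M n I \<in> borel_measurable M"
proof (rule borel_measurable_vec)
  fix i
  show "(\<lambda>\<omega>. W1 M n I \<omega> $ i) \<in> borel_measurable M"
    using exhaust_3[of i] counts_measurable by (elim disjE) (simp_all add: W1_def)
qed

text \<open>Almost surely \<open>W1\<close> takes finitely many values, so the expectation reduces
  to a finite sum without growth conditions on \<open>F\<close>.\<close>

lemma integral_W1:
  assumes "F \<in> borel_measurable borel"
  shows "(\<integral>\<omega>. F (W1 M n I \<omega>) \<partial>M) = bern_ex p (pairs n) (\<lambda>A. F (centred_stats n p A) :: real)"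
proof -
  have "(\<integral>\<omega>. F (W1 M n I \<omega>) \<partial>M) = (\<integral>\<omega>. F (centred_stats n p (present_edges n I \<omega>)) \<partial>M)"
    using W1_present_edges assms
    by (intro integral_cong_AE) (auto intro: measurable_compose[OF present_edges_measurable] measurable_compose[OF W1_measurable])
  then show ?thesis by (simp add: integral_present_edges[of "\<lambda>A. F (centred_stats n p A)"])
qed

end

lemma covariance_matrix_W1:
  assumes "bernoulli_random_graph M n p I" "n \<ge> 3" "0 \<le> p" "p \<le> 1"
  shows "covariance_matrix M (W1 M n I) = Sigma1 n p"
proof -
  have n2: "n \<ge> 2" using assms by simp
  note int = integral_W1[OF assms(1) n2 assms(3,4)]
  have 0: "(\<integral>\<omega>. W1 M n I \<omega> $ i \<partial>M) = 0" for i
    using int[of "\<lambda>x. x $ i"] bern_ex_centred_stats[OF n2] by simp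
  show ?thesis
    unfolding covariance_matrix_def vec_eq_iff
    using int[of "\<lambda>x. x $ i * x $ j" for i j]
    by (simp add: 0 bern_ex_stein_matrix[OF n2, symmetric] bern_ex_stein_matrix_Sigma1[OF assms(2)])
qed

section \<open>Bounds from partial derivatives\<close>

text \<open>Ties \<open>partial\<close>, which is defined through \<open>deriv\<close> along an
  axis, to the Frechet derivative, by evaluating the latter on the axis vectors.\<close>

lemma has_derivative_partial:
  assumes "f differentiable (at x)"
  shows "(f has_derivative (\<lambda>v. \<Sum>j\<in>UNIV. v $ j * partial j f x)) (at x)"
proof -
  obtain f' where f': "(f has_derivative f') (at x)"
    using assms by (auto simp: differentiable_def)
  interpret f': linear f' using f' by (rule has_derivative_linear)
  have partial: "partial j f x = f' (axis j 1)" for j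
  proof -
    have "((\<lambda>t. x + t *\<^sub>R axis j 1) has_derivative (\<lambda>t. t *\<^sub>R axis j 1)) (at 0)"
      by (auto intro!: derivative_eq_intros)
    then have "((\<lambda>t. f (x + t *\<^sub>R axis j 1)) has_derivative (\<lambda>t. f' (t *\<^sub>R axis j 1))) (at 0)"
      using f' by (intro has_derivative_compose[of "\<lambda>t. x + t *\<^sub>R axis j 1", where g = f]) auto
    then have "((\<lambda>t. f (x + t *\<^sub>R axis j 1)) has_real_derivative f' (axis j 1)) (at 0)"
      unfolding has_field_derivative_def by (rule has_derivative_eq_rhs) (auto simp: f'.scaleR mult.commute)
    then show ?thesis unfolding partial_def by (rule DERIV_imp_deriv)
  qed
  have "f' v = (\<Sum>j\<in>UNIV. v $ j * partial j f x)" for v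
  proof -
    have "f' v = f' (\<Sum>j\<in>UNIV. v $ j *\<^sub>R axis j 1)"
      using basis_expansion[of v] by (simp add: scalar_mult_eq_scaleR)
    then show ?thesis by (simp add: f'.sum f'.scaleR partial)
  qed
  then have "f' = (\<lambda>v. \<Sum>j\<in>UNIV. v $ j * partial j f x)" by (rule ext)
  with f' show ?thesis by (simp only:)
qed

lemma has_real_derivative_along_curve:
  assumes "\<And>x. f differentiable (at x)" "(c has_vector_derivative c') (at t)"
  shows "((\<lambda>t. f (c t)) has_real_derivative (\<Sum>j\<in>UNIV. c' $ j * partial j f (c t))) (at t)"
proof -
  have "((\<lambda>t. f (c t)) has_derivative (\<lambda>h. \<Sum>j\<in>UNIV. (h *\<^sub>R c') $ j * partial j f (c t))) (at t)"
    using has_derivative_compose[OF assms(2)[unfolded has_vector_derivative_def] has_derivative_partial[OF assms(1)[of "c t"]]] .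
  then show ?thesis
    unfolding has_field_derivative_def
    by (rule has_derivative_eq_rhs) (auto simp: sum_distrib_left sum_distrib_right mult_ac)
qed

lemma has_real_derivative_along_line:
  assumes "\<And>x. f differentiable (at x)"
  shows "((\<lambda>t. f (x + t *\<^sub>R v)) has_real_derivative (\<Sum>j\<in>UNIV. v $ j * partial j f (x + t *\<^sub>R v))) (at t)"
  by (rule has_real_derivative_along_curve[OF assms]) (auto intro!: derivative_eq_intros)

lemma abs_sum_mult_le_l1:
  assumes "\<And>j. \<bar>g j\<bar> \<le> c"
  shows "\<bar>\<Sum>j\<in>UNIV. v $ j * g j\<bar> \<le> l1 v * c"
proof -
  have "\<bar>\<Sum>j\<in>UNIV. v $ j * g j\<bar> \<le> (\<Sum>j\<in>UNIV. \<bar>v $ j\<bar> * c)"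
    by (intro order_trans[OF sum_abs] sum_mono) (simp add: abs_mult mult_left_mono assms)
  then show ?thesis by (simp add: l1_def sum_distrib_right)
qed

lemma lipschitz_of_partial_bound:
  assumes f: "\<And>x. f differentiable (at x)" and K: "\<And>j x. \<bar>partial j f x\<bar> \<le> K"
  shows "\<bar>f (x + v) - f x\<bar> \<le> K * l1 v"
proof -
  have "\<exists>z>0. z < 1 \<and> f (x + 1 *\<^sub>R v) - f (x + 0 *\<^sub>R v) =
      (1 - 0) * (\<Sum>j\<in>UNIV. v $ j * partial j f (x + z *\<^sub>R v))"
    by (rule MVT2) (simp_all only: zero_less_one has_real_derivative_along_line[OF f])
  then obtain z where "f (x + v) - f x = (\<Sum>j\<in>UNIV. v $ j * partial j f (x + z *\<^sub>R v))"
    by auto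
  then show ?thesis
    using abs_sum_mult_le_l1[of "\<lambda>j. partial j f (x + z *\<^sub>R v)" K v] K by (simp add: mult.commute)
qed

text \<open>Assumes Lipschitz partial derivatives instead of a bounded continuous second derivative;
  it is later applied to \<open>partial i h\<close>, whose second derivatives may be
  discontinuous.\<close>

lemma taylor_of_partial_lipschitz:
  assumes f: "\<And>x. f differentiable (at x)" and K: "\<And>j x v. \<bar>partial j f (x + v) - partial j f x\<bar> \<le> K * l1 v"
  shows "\<bar>f (x + v) - f x - (\<Sum>j\<in>UNIV. v $ j * partial j f x)\<bar> \<le> K / 2 * (l1 v) ^ 2"
proof -
  \<comment> \<open>Subtracting the claimed quadratic bound makes the signed error nonincreasing
    along the segment; the two signs \<open>s\<close> give the two sides of the absolute
    value.\<close>
  define \<phi> where "\<phi> s t = s * (f (x + t *\<^sub>R v) - f x - t * (\<Sum>j\<in>UNIV. v $ j * partial j f x)) - K / 2 * (l1 v) ^ 2 * t ^ 2" for s t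
  have "\<phi> s 1 \<le> \<phi> s 0" if s: "\<bar>s\<bar> = 1" for s
  proof (rule DERIV_nonpos_imp_nonincreasing[of 0 1])
    fix t :: real assume t: "0 \<le> t" "t \<le> 1"
    let ?d = "\<Sum>j\<in>UNIV. v $ j * (partial j f (x + t *\<^sub>R v) - partial j f x)"
    have "(\<phi> s has_real_derivative s * ?d - K * (l1 v) ^ 2 * t) (at t)"
      unfolding \<phi>_def
      by (rule derivative_eq_intros has_real_derivative_along_line[OF f] refl | simp)+
         (simp add: sum_subtractf right_diff_distrib)
    moreover have "\<bar>?d\<bar> \<le> l1 v * (K * l1 (t *\<^sub>R v))"
      by (rule abs_sum_mult_le_l1) (rule K)
    moreover have "s * ?d \<le> \<bar>?d\<bar>"
      using s abs_ge_self[of "s * ?d"] by (simp only: abs_mult)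
    ultimately show "\<exists>y. (\<phi> s has_real_derivative y) (at t) \<and> y \<le> 0"
      using t by (intro exI[of _ "s * ?d - K * (l1 v) ^ 2 * t"]) (auto simp: power2_eq_square mult_ac)
  qed simp
  from this[of 1] this[of "-1"]
  have "f (x + v) - f x - (\<Sum>j\<in>UNIV. v $ j * partial j f x) \<le> K / 2 * (l1 v) ^ 2"
    "- (f (x + v) - f x - (\<Sum>j\<in>UNIV. v $ j * partial j f x)) \<le> K / 2 * (l1 v) ^ 2"
    by (simp_all add: \<phi>_def)
  then show ?thesis unfolding abs_le_iff by blast
qed

lemma partial_bound3:
  assumes "deriv_norm3 h < \<top>"
  shows "\<bar>partial i (partial j (partial k h)) x\<bar> \<le> enn2real (deriv_norm3 h)"
proof -
  have "ennreal \<bar>partial i (partial j (partial k h)) x\<bar> \<le> deriv_norm3 h"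
    unfolding deriv_norm3_def
    by (rule order_trans[OF _ SUP_upper[of i]], rule order_trans[OF _ SUP_upper[of j]],
        rule order_trans[OF _ SUP_upper[of k]], rule order_trans[OF _ SUP_upper[of x]]) auto
  then show ?thesis
    using enn2real_mono[OF _ assms] by fastforce
qed

lemma partial_bound2:
  assumes "deriv_norm2 h < \<top>"
  shows "\<bar>partial i (partial j h) x\<bar> \<le> enn2real (deriv_norm2 h)"
proof -
  have "ennreal \<bar>partial i (partial j h) x\<bar> \<le> deriv_norm2 h"
    unfolding deriv_norm2_def
    by (rule order_trans[OF _ SUP_upper[of i]], rule order_trans[OF _ SUP_upper[of j]],
        rule order_trans[OF _ SUP_upper[of x]]) auto
  then show ?thesis
    using enn2real_mono[OF _ assms] by fastforce
qed

lemma continuous_on_differentiable: "(\<And>x. f differentiable (at x)) \<Longrightarrow> continuous_on UNIV f"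
  by (simp add: differentiable_imp_continuous_within continuous_at_imp_continuous_on)

section \<open>Square roots of symmetric matrices\<close>

lemma symmetric_inner:
  fixes A :: "real ^ 'n ^ 'n"
  assumes "transpose A = A"
  shows "(A *v x) \<bullet> y = x \<bullet> (A *v y)"
  by (metis assms dot_lmul_matrix transpose_matrix_vector inner_commute)

text \<open>Maximises the Rayleigh quotient over the unit sphere of \<open>S\<close>. The residual
  \<open>w = A *v v - c *\<^sub>R v\<close> stays in \<open>S\<close>, and if it were nonzero,
  moving \<open>v\<close> towards \<open>w\<close> would increase the quotient to first
  order.\<close>

lemma symmetric_eigenvector_in_subspace:
  fixes A :: "real ^ 'n ^ 'n"
  assumes A: "transpose A = A" and S: "subspace S" "S \<noteq> {0}" and inv: "\<And>x. x \<in> S \<Longrightarrow> A *v x \<in> S"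
  obtains v c where "v \<in> S" "norm v = 1" "A *v v = c *\<^sub>R v"
    "\<And>x. x \<in> S \<Longrightarrow> x \<bullet> (A *v x) \<le> c * (x \<bullet> x)"
proof -
  let ?K = "sphere 0 1 \<inter> S"
  have "compact ?K" using S by (intro compact_Int_closed compact_sphere closed_subspace)
  moreover obtain u where "u \<in> S" "u \<noteq> 0" using S subspace_0 by blast
  then have "(1 / norm u) *\<^sub>R u \<in> ?K" using S by (simp add: subspace_scale)
  then have "?K \<noteq> {}" by blast
  moreover have "continuous_on ?K (\<lambda>x. x \<bullet> (A *v x))"
    by (intro continuous_intros linear_continuous_on_compose[where g = "(*v) A"] matrix_vector_mul_linear continuous_on_id)
  ultimately obtain v where v: "v \<in> ?K" and max: "\<And>x. x \<in> ?K \<Longrightarrow> x \<bullet> (A *v x) \<le> v \<bullet> (A *v v)"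
    using continuous_attains_sup[of ?K] by blast
  define c where "c = v \<bullet> (A *v v)"
  have le: "x \<bullet> (A *v x) \<le> c * (x \<bullet> x)" if "x \<in> S" for x
  proof (cases "x = 0")
    case False
    then have "(1 / norm x) *\<^sub>R x \<in> ?K" using S that by (simp add: subspace_scale)
    from max[OF this] have "x \<bullet> (A *v x) / (norm x * norm x) \<le> c"
      by (simp add: c_def matrix_vector_mult_scaleR)
    then show ?thesis using False by (simp add: field_simps dot_square_norm power2_eq_square)
  qed simp
  define w where "w = A *v v - c *\<^sub>R v"
  have wS: "w \<in> S" using v S inv by (auto simp: w_def intro!: subspace_diff subspace_scale)
  have vv: "v \<bullet> v = 1" using v by (simp add: dot_square_norm)
  have "w \<bullet> w = 0"
  proof (rule ccontr)
    assume "w \<bullet> w \<noteq> 0"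
    then have pos: "w \<bullet> w > 0" by (simp add: inner_gt_zero_iff)
    define b where "b = c * (w \<bullet> w) - w \<bullet> (A *v w)"
    \<comment> \<open>Maximality at \<open>v + t *\<^sub>R w\<close>: a gain linear in
      \<open>t\<close> must be offset by a quadratic term.\<close>
    have ineq: "2 * t * (w \<bullet> w) \<le> t ^ 2 * b" for t
    proof -
      have "v + t *\<^sub>R w \<in> S" using v wS S by (auto intro!: subspace_add subspace_scale)
      from le[OF this] have "c + 2 * t * (w \<bullet> (A *v v)) + t ^ 2 * (w \<bullet> (A *v w)) \<le>
          c * (1 + 2 * t * (w \<bullet> v) + t ^ 2 * (w \<bullet> w))"
        using symmetric_inner[OF A, of v w] vv
        by (simp add: matrix_vector_right_distrib matrix_vector_mult_scaleR inner_add_left inner_add_right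
            inner_commute c_def power2_eq_square algebra_simps)
      moreover have "w \<bullet> (A *v v) = w \<bullet> w + c * (w \<bullet> v)"
        by (simp add: w_def inner_diff_left inner_diff_right algebra_simps)
      ultimately show ?thesis by (simp add: b_def algebra_simps)
    qed
    have "2 * (w \<bullet> w) \<le> b" using ineq[of 1] by simp
    with pos have "b > 0" by linarith
    \<comment> \<open>The value of \<open>t\<close> minimising
      \<open>t ^ 2 * b - 2 * t * (w \<bullet> w)\<close>.\<close>
    have "2 * (w \<bullet> w / b) * (w \<bullet> w) \<le> (w \<bullet> w / b) ^ 2 * b" by (rule ineq)
    then have "2 * ((w \<bullet> w) * (w \<bullet> w)) \<le> (w \<bullet> w) * (w \<bullet> w)"
      using \<open>b > 0\<close> by (simp add: power2_eq_square field_simps)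
    moreover have "(w \<bullet> w) * (w \<bullet> w) > 0" using pos by simp
    ultimately show False by linarith
  qed
  then have "A *v v = c *\<^sub>R v" by (simp add: w_def)
  then show ?thesis using that v le by auto
qed

text \<open>Induction on the dimension of an invariant subspace: by symmetry the part of
  \<open>S\<close> orthogonal to an eigenvector is again invariant. Working with subspaces keeps the
  matrix and the type fixed.\<close>

lemma symmetric_eigenbasis:
  fixes A :: "real ^ 'n ^ 'n"
  assumes A: "transpose A = A" and S: "subspace S" and inv: "\<And>x. x \<in> S \<Longrightarrow> A *v x \<in> S"
  shows "\<exists>B c. finite B \<and> B \<subseteq> S \<and> pairwise orthogonal B \<and> (\<forall>b\<in>B. norm b = 1 \<and> A *v b = c b *\<^sub>R b) \<and> S \<subseteq> span B"
  using S inv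
proof (induction "dim S" arbitrary: S rule: less_induct)
  case less
  show ?case
  proof (cases "S = {0}")
    case True
    then show ?thesis by (intro exI[of _ "{}"]) auto
  next
    case False
    obtain v l where v: "v \<in> S" "norm v = 1" "A *v v = l *\<^sub>R v"
      using symmetric_eigenvector_in_subspace[OF A less.prems(1) False less.prems(2)] by metis
    define S' where "S' = {x \<in> S. v \<bullet> x = 0}"
    have S': "subspace S'" "S' \<subseteq> S"
      using less.prems(1) by (auto simp: S'_def subspace_def inner_add_right)
    have vv: "v \<bullet> v = 1" using v by (simp add: dot_square_norm)
    have "A *v x \<in> S'" if "x \<in> S'" for x
      using that less.prems(2) symmetric_inner[OF A, of v x] v(3) by (simp add: S'_def)
    moreover have "dim S' < dim S"
    proof (rule dim_psubset)
      have "v \<notin> S'" using vv by (simp add: S'_def)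
      then show "span S' \<subset> span S"
        using S' less.prems(1) v(1) span_eq_iff by blast
    qed
    ultimately obtain B c where B: "finite B" "B \<subseteq> S'" "pairwise orthogonal B"
      "\<forall>b\<in>B. norm b = 1 \<and> A *v b = c b *\<^sub>R b" "S' \<subseteq> span B"
      using less.hyps[of S'] S'(1) by metis
    have "v \<notin> B" using B(2) vv by (auto simp: S'_def)
    have "S \<subseteq> span (insert v B)"
    proof
      fix x assume x: "x \<in> S"
      have "x - (v \<bullet> x) *\<^sub>R v \<in> S'"
        using x v less.prems(1) vv by (simp add: S'_def subspace_diff subspace_scale inner_diff_right)
      then have "x - (v \<bullet> x) *\<^sub>R v \<in> span B" using B(5) by blast
      then show "x \<in> span (insert v B)" by (rule span_breakdown_eq[THEN iffD2, OF exI])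
    qed
    moreover have "pairwise orthogonal (insert v B)"
      using B(2,3) by (auto simp: pairwise_insert orthogonal_def S'_def inner_commute)
    moreover have "\<forall>b\<in>insert v B. norm b = 1 \<and> A *v b = (c(v := l)) b *\<^sub>R b"
      using B(4) v \<open>v \<notin> B\<close> by auto
    moreover have "insert v B \<subseteq> S" using v B(2) S'(2) by auto
    ultimately show ?thesis
      using B(1) by (intro exI[of _ "insert v B"] exI[of _ "c(v := l)"]) auto
  qed
qed

text \<open>Scales each vector of an orthonormal eigenbasis by the square root of its
  eigenvalue.\<close>

lemma sqrt_matrix_exists:
  fixes A :: "real ^ 'n ^ 'n"
  assumes "sym_nonneg_definite A"
  shows "\<exists>R. sym_nonneg_definite R \<and> R ** R = A"
proof -
  have A: "transpose A = A" and pos: "\<And>x. 0 \<le> x \<bullet> (A *v x)"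
    using assms by (auto simp: sym_nonneg_definite_def)
  obtain B c where B: "finite B" "pairwise orthogonal B"
    "\<And>b. b \<in> B \<Longrightarrow> norm b = 1 \<and> A *v b = c b *\<^sub>R b" "UNIV \<subseteq> span B"
    using symmetric_eigenbasis[OF A subspace_UNIV] by auto
  have bb: "b \<bullet> b' = (if b = b' then 1 else 0)" if "b \<in> B" "b' \<in> B" for b b'
    using that B(2,3) by (auto simp: pairwise_def orthogonal_def dot_square_norm)
  have c: "c b \<ge> 0" if "b \<in> B" for b
    using pos[of b] B(3)[OF that] bb[OF that that] by simp
  define f where "f x = (\<Sum>b\<in>B. (sqrt (c b) * (b \<bullet> x)) *\<^sub>R b)" for x
  have "linear f"
    by (rule linearI)
      (simp_all add: f_def inner_add_right algebra_simps sum.distrib scaleR_sum_right)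
  define R where "R = matrix f"
  have R: "R *v x = f x" for x
    unfolding R_def by (rule matrix_works) (use \<open>linear f\<close> in \<open>simp add: linear_matrix_vector_mul_eq\<close>)
  have fb: "f b = sqrt (c b) *\<^sub>R b" if "b \<in> B" for b
  proof -
    have "f b = (\<Sum>b'\<in>B. if b' = b then sqrt (c b) *\<^sub>R b else 0)"
      unfolding f_def using that by (intro sum.cong) (auto simp: bb)
    then show ?thesis using that B(1) by simp
  qed
  have f_inner: "f x \<bullet> y = (\<Sum>b\<in>B. sqrt (c b) * (b \<bullet> x) * (b \<bullet> y))" for x y
    by (simp add: f_def inner_sum_left)
  have "transpose R = R"
  proof -
    have "(R *v x) \<bullet> y = x \<bullet> (R *v y)" for x y
      unfolding R f_inner inner_commute[of x] by (simp add: mult_ac)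
    then have "(transpose R *v y) \<bullet> x = (R *v y) \<bullet> x" for x y
      by (metis dot_lmul_matrix transpose_matrix_vector inner_commute)
    then have "transpose R *v y = R *v y" for y
      by (metis vector_eq_ldot inner_commute)
    then show ?thesis by (simp add: matrix_eq)
  qed
  moreover have "0 \<le> x \<bullet> (R *v x)" for x
    unfolding R inner_commute[of x] f_inner
    by (intro sum_nonneg) (simp add: c mult.assoc)
  moreover have "R ** R = A"
  proof -
    have "(R ** R) *v x = A *v x" for x
    proof (rule linear_eq_on[of "(*v) (R ** R)" "(*v) A" x B])
      show "x \<in> span B" using B(4) by auto
      fix b assume "b \<in> B"
      then show "(R ** R) *v b = A *v b"
        using B(3) c fb by (simp add: matrix_vector_mul_assoc[symmetric] R linear_cmul[OF \<open>linear f\<close>])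
    qed auto
    then show ?thesis by (simp add: matrix_eq)
  qed
  ultimately show ?thesis by (auto simp: sym_nonneg_definite_def)
qed

text \<open>Argues on an eigenvector \<open>b\<close> of \<open>R - Q\<close> with nonzero
  eigenvalue. Since \<open>R *v b\<close> and \<open>Q *v b\<close> have equal length, their
  difference is orthogonal to their sum, so
  \<open>b \<bullet> (R *v b) + b \<bullet> (Q *v b) = 0\<close>; both terms are nonnegative, hence
  zero, and so is the eigenvalue.\<close>

lemma sqrt_matrix_unique:
  fixes R Q :: "real ^ 'n ^ 'n"
  assumes R: "sym_nonneg_definite R" and Q: "sym_nonneg_definite Q" and eq: "R ** R = Q ** Q"
  shows "R = Q"
proof -
  have tr: "transpose R = R" "transpose Q = Q" and pos: "\<And>x. 0 \<le> x \<bullet> (R *v x)" "\<And>x. 0 \<le> x \<bullet> (Q *v x)"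
    using R Q by (auto simp: sym_nonneg_definite_def)
  have sym: "transpose (R - Q) = R - Q"
    using tr by (simp add: transpose_def vec_eq_iff)
  obtain B c where B: "finite B" "\<And>b. b \<in> B \<Longrightarrow> norm b = 1 \<and> (R - Q) *v b = c b *\<^sub>R b" "UNIV \<subseteq> span B"
    using symmetric_eigenbasis[OF sym subspace_UNIV] by auto
  have "(R - Q) *v b = 0" if b: "b \<in> B" for b
  proof (rule ccontr)
    assume "(R - Q) *v b \<noteq> 0"
    then have c: "c b \<noteq> 0" using B(2)[OF b] by auto
    have bb: "b \<bullet> b = 1" using B(2)[OF b] by (simp add: dot_square_norm)
    have d: "R *v b - Q *v b = c b *\<^sub>R b" using B(2)[OF b] by (simp add: matrix_vector_mult_diff_rdistrib)
    have "(R *v b) \<bullet> (R *v b) = (Q *v b) \<bullet> (Q *v b)"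
      using eq symmetric_inner[OF tr(1), of b "R *v b"] symmetric_inner[OF tr(2), of b "Q *v b"]
      by (simp add: matrix_vector_mul_assoc)
    then have "(R *v b - Q *v b) \<bullet> (R *v b + Q *v b) = 0"
      by (simp add: inner_diff_left inner_diff_right inner_add_right inner_commute)
    then have "c b * (b \<bullet> (R *v b) + b \<bullet> (Q *v b)) = 0"
      unfolding d by (simp add: inner_add_right distrib_left)
    then have "b \<bullet> (R *v b) + b \<bullet> (Q *v b) = 0" using c by simp
    then have "b \<bullet> (R *v b) = 0" "b \<bullet> (Q *v b) = 0"
      using pos[of b] by linarith+
    then have "b \<bullet> (c b *\<^sub>R b) = 0" unfolding d[symmetric] by (simp add: inner_diff_right)
    then show False using c bb by simp
  qed
  then have "(R - Q) *v x = 0 *v x" for x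
    using B(3) by (intro linear_eq_on[of "(*v) (R - Q)" "(*v) 0" x B]) auto
  then have "R - Q = 0" by (simp add: matrix_eq)
  then show ?thesis by simp
qed

text \<open>Unfolds the definite description, for which both existence and uniqueness are
  required.\<close>

lemma sqrt_matrix_works:
  assumes "sym_nonneg_definite A"
  shows "transpose (sqrt_matrix A) = sqrt_matrix A" "sqrt_matrix A ** sqrt_matrix A = A"
proof -
  have "\<exists>!R. sym_nonneg_definite R \<and> R ** R = A"
    using sqrt_matrix_exists[OF assms] sqrt_matrix_unique by blast
  from theI'[OF this] show "transpose (sqrt_matrix A) = sqrt_matrix A" "sqrt_matrix A ** sqrt_matrix A = A"
    unfolding sqrt_matrix_def[symmetric] by (auto simp: sym_nonneg_definite_def)
qed

section \<open>Gaussian integration by parts\<close>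

text \<open>Dominated convergence along sequences: the mean value theorem bounds every difference
  quotient by the same integrable \<open>K\<close>.\<close>

lemma has_real_derivative_integral:
  fixes f :: "real \<Rightarrow> 'a \<Rightarrow> real"
  assumes int: "\<And>t. integrable M (f t)" and meas: "f' \<in> borel_measurable M"
    and der: "\<And>s \<omega>. ((\<lambda>t. f t \<omega>) has_real_derivative g s \<omega>) (at s)" and f': "\<And>\<omega>. f' \<omega> = g t \<omega>"
    and bound: "\<And>s \<omega>. \<bar>g s \<omega>\<bar> \<le> K \<omega>" and K: "integrable M K"
  shows "((\<lambda>t. \<integral>\<omega>. f t \<omega> \<partial>M) has_real_derivative (\<integral>\<omega>. f' \<omega> \<partial>M)) (at t)"
  unfolding DERIV_def tendsto_at_iff_sequentially
proof (intro allI impI)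
  fix X :: "nat \<Rightarrow> real" assume X: "\<forall>i. X i \<in> UNIV - {0}" "X \<longlonglongrightarrow> 0"
  have lim: "(\<lambda>i. \<integral>\<omega>. (f (t + X i) \<omega> - f t \<omega>) / X i \<partial>M) \<longlonglongrightarrow> (\<integral>\<omega>. f' \<omega> \<partial>M)"
  proof (rule integral_dominated_convergence[where w = K])
    show "AE \<omega> in M. (\<lambda>i. (f (t + X i) \<omega> - f t \<omega>) / X i) \<longlonglongrightarrow> f' \<omega>"
    proof (rule AE_I2)
      fix \<omega>
      have "((\<lambda>h. (f (t + h) \<omega> - f t \<omega>) / h) \<longlongrightarrow> f' \<omega>) (at 0)"
        using der[where s = t and \<omega> = \<omega>] by (simp add: DERIV_def f')
      then show "(\<lambda>i. (f (t + X i) \<omega> - f t \<omega>) / X i) \<longlonglongrightarrow> f' \<omega>"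
        unfolding tendsto_at_iff_sequentially using X by (auto simp: o_def)
    qed
    show "AE \<omega> in M. norm ((f (t + X i) \<omega> - f t \<omega>) / X i) \<le> K \<omega>" for i
    proof (rule AE_I2)
      fix \<omega>
      have "\<bar>f (t + X i) \<omega> - f t \<omega>\<bar> \<le> K \<omega> * \<bar>t + X i - t\<bar>"
        using field_differentiable_bound[of UNIV "\<lambda>t. f t \<omega>" "\<lambda>s. g s \<omega>" "K \<omega>" t "t + X i"] der bound
        by simp
      then show "norm ((f (t + X i) \<omega> - f t \<omega>) / X i) \<le> K \<omega>"
        using X by (simp add: field_simps)
    qed
  qed (use int meas K in auto)
  have eq: "(\<integral>\<omega>. (f (t + X i) \<omega> - f t \<omega>) / X i \<partial>M) = ((\<integral>\<omega>. f (t + X i) \<omega> \<partial>M) - (\<integral>\<omega>. f t \<omega> \<partial>M)) / X i" for i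
    using int[of "t + X i"] int[of t] by (simp add: Bochner_Integration.integral_diff)
  show "((\<lambda>h. ((\<integral>\<omega>. f (t + h) \<omega> \<partial>M) - (\<integral>\<omega>. f t \<omega> \<partial>M)) / h) \<circ> X) \<longlonglongrightarrow> (\<integral>\<omega>. f' \<omega> \<partial>M)"
    using lim unfolding eq o_def .
qed

text \<open>The derivative of \<open>std_normal_density t * g t\<close> is the difference of the two
  integrands. A bounded \<open>g'\<close> makes \<open>g\<close> grow at most linearly, so the
  boundary terms vanish and both integrals exist.\<close>

lemma std_normal_integration_by_parts:
  fixes g g' :: "real \<Rightarrow> real"
  assumes der: "\<And>t. (g has_real_derivative g' t) (at t)" and cont: "continuous_on UNIV g'"
    and bound: "\<And>t. \<bar>g' t\<bar> \<le> C"
  shows "(\<integral>t. std_normal_density t * (t * g t) \<partial>lborel) = (\<integral>t. std_normal_density t * g' t \<partial>lborel)"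
proof -
  let ?d = "std_normal_density"
  have contg: "continuous_on UNIV g"
    using der by (intro continuous_at_imp_continuous_on) (auto intro: DERIV_isCont)
  have [measurable]: "g \<in> borel_measurable borel" "g' \<in> borel_measurable borel"
    using cont contg by (auto intro: borel_measurable_continuous_onI)
  have lin: "\<bar>g t\<bar> \<le> \<bar>g 0\<bar> + C * \<bar>t\<bar>" for t
    using field_differentiable_bound[of UNIV g g' C 0 t] der bound by (simp add: abs_le_iff; linarith)
  have C: "0 \<le> C" using bound[of 0] by linarith
  have int0: "integrable lborel ?d" and int1: "integrable lborel (\<lambda>t. ?d t * \<bar>t\<bar>)"
    and int2: "integrable lborel (\<lambda>t. ?d t * t ^ 2)"
    using integrable_std_normal_moment_abs[of 0] integrable_std_normal_moment_abs[of 1] integrable_std_normal_moment[of 2] by simp_all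
  have i1: "integrable lborel (\<lambda>t. ?d t * g' t)"
  proof (rule Bochner_Integration.integrable_bound)
    show "integrable lborel (\<lambda>t. C * ?d t)" using int0 by simp
    show "AE t in lborel. norm (?d t * g' t) \<le> norm (C * ?d t)"
      using bound C by (auto simp: abs_mult mult.commute intro!: mult_right_mono)
  qed simp
  have i2: "integrable lborel (\<lambda>t. ?d t * (t * g t))"
  proof (rule Bochner_Integration.integrable_bound)
    show "integrable lborel (\<lambda>t. \<bar>g 0\<bar> * (?d t * \<bar>t\<bar>) + C * (?d t * t ^ 2))"
      using int1 int2 by simp
    show "AE t in lborel. norm (?d t * (t * g t)) \<le> norm (\<bar>g 0\<bar> * (?d t * \<bar>t\<bar>) + C * (?d t * t ^ 2))"
    proof (rule AE_I2)
      fix t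
      have "?d t * (\<bar>t\<bar> * \<bar>g t\<bar>) \<le> ?d t * (\<bar>t\<bar> * (\<bar>g 0\<bar> + C * \<bar>t\<bar>))"
        using lin by (intro mult_left_mono) auto
      then show "norm (?d t * (t * g t)) \<le> norm (\<bar>g 0\<bar> * (?d t * \<bar>t\<bar>) + C * (?d t * t ^ 2))"
        using C by (simp add: abs_mult algebra_simps power2_eq_square)
    qed
  qed simp
  have lim0: "(?d \<longlongrightarrow> 0) at_top" "(?d \<longlongrightarrow> 0) at_bot"
    unfolding std_normal_density_def by real_asymp+
  have lim1: "((\<lambda>t. ?d t * \<bar>t\<bar>) \<longlongrightarrow> 0) at_top" "((\<lambda>t. ?d t * \<bar>t\<bar>) \<longlongrightarrow> 0) at_bot"
    unfolding std_normal_density_def by real_asymp+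
  have lim: "((\<lambda>t. ?d t * g t) \<longlongrightarrow> 0) F" if "(?d \<longlongrightarrow> 0) F" "((\<lambda>t. ?d t * \<bar>t\<bar>) \<longlongrightarrow> 0) F" for F
  proof (rule tendsto_rabs_zero_cancel, rule tendsto_sandwich[OF _ _ tendsto_const])
    show "((\<lambda>t. \<bar>g 0\<bar> * ?d t + C * (?d t * \<bar>t\<bar>)) \<longlongrightarrow> 0) F"
      using tendsto_add[OF tendsto_mult_left[OF that(1), of "\<bar>g 0\<bar>"] tendsto_mult_left[OF that(2), of C]] by simp
    show "\<forall>\<^sub>F t in F. \<bar>?d t * g t\<bar> \<le> \<bar>g 0\<bar> * ?d t + C * (?d t * \<bar>t\<bar>)"
    proof (rule always_eventually, rule allI)
      fix t
      have "?d t * \<bar>g t\<bar> \<le> ?d t * (\<bar>g 0\<bar> + C * \<bar>t\<bar>)"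
        using lin by (intro mult_left_mono) auto
      then show "\<bar>?d t * g t\<bar> \<le> \<bar>g 0\<bar> * ?d t + C * (?d t * \<bar>t\<bar>)"
        by (simp add: abs_mult algebra_simps)
    qed
  qed auto
  have "(LBINT t=-\<infinity>..\<infinity>. ?d t * g' t - ?d t * (t * g t)) = 0 - 0"
  proof (rule interval_integral_FTC_integrable)
    fix t
    have "((\<lambda>t. ?d t * g t) has_real_derivative ?d t * g' t - ?d t * (t * g t)) (at t)"
      unfolding std_normal_density_def
      by (rule derivative_eq_intros der refl | simp)+ (simp add: algebra_simps)
    then show "((\<lambda>t. ?d t * g t) has_vector_derivative ?d t * g' t - ?d t * (t * g t)) (at t)"
      by (simp add: has_real_derivative_iff_has_vector_derivative)
    have "continuous_on UNIV (\<lambda>t. ?d t * g' t - ?d t * (t * g t))"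
      unfolding std_normal_density_def using cont contg by (intro continuous_intros) auto
    then show "isCont (\<lambda>t. ?d t * g' t - ?d t * (t * g t)) t"
      by (simp add: continuous_on_eq_continuous_at)
  next
    show "set_integrable lborel (einterval (-\<infinity>) \<infinity>) (\<lambda>t. ?d t * g' t - ?d t * (t * g t))"
      using i1 i2 by (simp add: set_integrable_def)
    show "(((\<lambda>t. ?d t * g t) \<circ> real_of_ereal) \<longlongrightarrow> 0) (at_right (-\<infinity>))"
      "(((\<lambda>t. ?d t * g t) \<circ> real_of_ereal) \<longlongrightarrow> 0) (at_left \<infinity>)"
      using lim lim0 lim1 by (simp_all add: ereal_tendsto_simps)
  qed simp
  then have "(\<integral>t. ?d t * g' t - ?d t * (t * g t) \<partial>lborel) = 0"
    by (simp add: interval_lebesgue_integral_def set_lebesgue_integral_def)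
  then show ?thesis using i1 i2 by simp
qed

context
  fixes N :: "'b measure" and Z :: "'b \<Rightarrow> real ^ 'n"
  assumes normal: "std_normal_vector N Z"
begin

interpretation prob_space N
  using normal by (simp add: std_normal_vector_def)

lemma normal_component_measurable: "(\<lambda>\<omega>. Z \<omega> $ i) \<in> borel_measurable N"
  using normal by (auto simp: std_normal_vector_def indep_vars_def)

lemma normal_measurable: "Z \<in> borel_measurable N"
  by (rule borel_measurable_vec) (rule normal_component_measurable)

lemma integrable_normal_component_squared: "integrable N (\<lambda>\<omega>. (Z \<omega> $ i) ^ 2)"
proof -
  have "distributed N lborel (\<lambda>\<omega>. Z \<omega> $ i) std_normal_density"
    using normal by (simp add: std_normal_vector_def)
  from distributed_integrable[OF this, of "\<lambda>x. x ^ 2"] show ?thesis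
    using integrable_std_normal_moment[of 2] by simp
qed

text \<open>Splits \<open>Z\<close> into its \<open>k\<close>-th coordinate and the independent
  rest, and applies the scalar formula along each line parallel to the axis by Fubini.\<close>

lemma normal_vector_integration_by_parts:
  fixes G G' :: "real ^ 'n \<Rightarrow> real"
  assumes der: "\<And>z. ((\<lambda>t. G (z + t *\<^sub>R axis k 1)) has_real_derivative G' z) (at 0)"
    and cont: "continuous_on UNIV G" "continuous_on UNIV G'" and bound: "\<And>z. \<bar>G' z\<bar> \<le> C"
    and int: "integrable N (\<lambda>\<omega>. Z \<omega> $ k * G (Z \<omega>))"
  shows "(\<integral>\<omega>. Z \<omega> $ k * G (Z \<omega>) \<partial>N) = (\<integral>\<omega>. G' (Z \<omega>) \<partial>N)"
proof -
  have [measurable]: "G \<in> borel_measurable borel" "G' \<in> borel_measurable borel"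
    using cont by (auto intro: borel_measurable_continuous_onI)
  note [measurable] = normal_component_measurable normal_measurable
  define rest where "rest z = z - (z $ k) *\<^sub>R axis k 1" for z :: "real ^ 'n"
  define P Q where "P = distr N borel (\<lambda>\<omega>. rest (Z \<omega>))" and "Q = distr N borel (\<lambda>\<omega>. Z \<omega> $ k)"
  have rest_meas [measurable]: "(\<lambda>\<omega>. rest (Z \<omega>)) \<in> borel_measurable N"
    unfolding rest_def by (intro borel_measurable_diff borel_measurable_scaleR) simp_all
  interpret P: prob_space P unfolding P_def by (rule prob_space_distr) simp
  interpret Q: prob_space Q unfolding Q_def by (rule prob_space_distr) simp
  \<comment> \<open>The coordinate is kept as a vector on the axis, so that both variables of
    \<open>indep_var\<close> have the same type and add up to \<open>Z\<close>.\<close>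
  define along where "along z = (z $ k) *\<^sub>R axis k (1 :: real)" for z :: "real ^ 'n"
  have along_meas [measurable]: "(\<lambda>\<omega>. along (Z \<omega>)) \<in> borel_measurable N"
    unfolding along_def by (intro borel_measurable_scaleR) simp_all
  define Q' where "Q' = distr N borel (\<lambda>\<omega>. along (Z \<omega>))"
  interpret Q': prob_space Q' unfolding Q'_def by (rule prob_space_distr) simp
  interpret PQ': pair_sigma_finite P Q' ..
  have "indep_var borel (\<lambda>\<omega>. rest (Z \<omega>)) borel (\<lambda>\<omega>. along (Z \<omega>))"
  proof -
    let ?r = "\<lambda>f. \<chi> j. if j = k then (0 :: real) else f j"
    have "indep_vars (\<lambda>_. borel) (\<lambda>i \<omega>. Z \<omega> $ i) UNIV"
      using normal by (simp add: std_normal_vector_def)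
    then have "indep_var (PiM (UNIV - {k}) (\<lambda>_. borel)) (\<lambda>\<omega>. restrict (\<lambda>i. Z \<omega> $ i) (UNIV - {k}))
        (PiM {k} (\<lambda>_. borel)) (\<lambda>\<omega>. restrict (\<lambda>i. Z \<omega> $ i) {k})"
      by (rule indep_var_restrict) auto
    moreover have "?r \<in> measurable (PiM (UNIV - {k}) (\<lambda>_. borel)) borel"
    proof (rule borel_measurable_vec)
      fix i show "(\<lambda>f. ?r f $ i) \<in> borel_measurable (PiM (UNIV - {k}) (\<lambda>_. borel))"
        by (cases "i = k") (auto intro: measurable_component_singleton)
    qed
    moreover have "(\<lambda>f. f k *\<^sub>R axis k (1 :: real)) \<in> measurable (PiM {k} (\<lambda>_. borel)) borel"
      by (intro borel_measurable_scaleR measurable_component_singleton) simp_all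
    ultimately have "indep_var borel (?r \<circ> (\<lambda>\<omega>. restrict (\<lambda>i. Z \<omega> $ i) (UNIV - {k})))
        borel ((\<lambda>f. f k *\<^sub>R axis k (1 :: real)) \<circ> (\<lambda>\<omega>. restrict (\<lambda>i. Z \<omega> $ i) {k}))"
      by (rule indep_var_compose)
    moreover have "?r \<circ> (\<lambda>\<omega>. restrict (\<lambda>i. Z \<omega> $ i) (UNIV - {k})) = (\<lambda>\<omega>. rest (Z \<omega>))"
      by (auto simp: fun_eq_iff vec_eq_iff rest_def axis_def)
    moreover have "(\<lambda>f. f k *\<^sub>R axis k (1 :: real)) \<circ> (\<lambda>\<omega>. restrict (\<lambda>i. Z \<omega> $ i) {k}) = (\<lambda>\<omega>. along (Z \<omega>))"
      by (auto simp: fun_eq_iff along_def)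
    ultimately show ?thesis by simp
  qed
  then have joint: "distr N (borel \<Otimes>\<^sub>M borel) (\<lambda>\<omega>. (rest (Z \<omega>), along (Z \<omega>))) = P \<Otimes>\<^sub>M Q'"
    by (simp add: indep_var_distribution_eq P_def Q'_def)
  have Q: "Q = density lborel (\<lambda>x. ennreal (std_normal_density x))"
  proof -
    have "distr N lborel (\<lambda>\<omega>. Z \<omega> $ k) = density lborel (\<lambda>x. ennreal (std_normal_density x))"
      using normal by (auto simp: std_normal_vector_def distributed_def)
    moreover have "distr N lborel (\<lambda>\<omega>. Z \<omega> $ k) = Q"
      unfolding Q_def by (rule distr_cong) auto
    ultimately show ?thesis by simp
  qed
  have fubini: "(\<integral>\<omega>. F (Z \<omega>) \<partial>N) = (\<integral>r. (\<integral>t. F (r + t *\<^sub>R axis k 1) \<partial>Q) \<partial>P)"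
    if F: "F \<in> borel_measurable borel" "integrable N (\<lambda>\<omega>. F (Z \<omega>))" for F :: "real ^ 'n \<Rightarrow> real"
  proof -
    have [measurable]: "F \<in> borel_measurable borel" by (rule F(1))
    have sum_meas: "(\<lambda>(r, u). F (r + u)) \<in> borel_measurable (borel \<Otimes>\<^sub>M borel)"
      by measurable
    have pair: "(\<lambda>\<omega>. (rest (Z \<omega>), along (Z \<omega>))) \<in> measurable N (borel \<Otimes>\<^sub>M borel)"
      by measurable
    have sum: "rest z + along z = z" for z
      by (simp add: rest_def along_def)
    have "integrable (P \<Otimes>\<^sub>M Q') (\<lambda>(r, u). F (r + u))"
      unfolding joint[symmetric] using F(2)
      by (subst integrable_distr_eq[OF pair sum_meas]) (simp add: sum)
    from PQ'.integral_fst[OF this] have "(\<integral>r. (\<integral>u. F (r + u) \<partial>Q') \<partial>P) =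
        integral\<^sup>L (P \<Otimes>\<^sub>M Q') (\<lambda>(r, u). F (r + u))"
      by simp
    also have "\<dots> = (\<integral>\<omega>. F (Z \<omega>) \<partial>N)"
      unfolding joint[symmetric] by (subst integral_distr[OF pair sum_meas]) (simp add: sum)
    finally have total: "(\<integral>r. (\<integral>u. F (r + u) \<partial>Q') \<partial>P) = (\<integral>\<omega>. F (Z \<omega>) \<partial>N)" .
    have "(\<integral>u. F (r + u) \<partial>Q') = (\<integral>t. F (r + t *\<^sub>R axis k 1) \<partial>Q)" for r
      unfolding Q'_def Q_def
      by (subst (1 2) integral_distr) (simp_all add: along_def)
    then show ?thesis using total by simp
  qed
  \<comment> \<open>On the hyperplane \<open>r $ k = 0\<close>, which carries \<open>P\<close>, the
    \<open>k\<close>-th coordinate of the shifted point is \<open>t\<close> itself and the scalar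
    formula applies.\<close>
  have inner: "(\<integral>t. (r + t *\<^sub>R axis k 1) $ k * G (r + t *\<^sub>R axis k 1) \<partial>Q) = (\<integral>t. G' (r + t *\<^sub>R axis k 1) \<partial>Q)"
    if r: "r $ k = 0" for r
  proof -
    have "(\<integral>t. std_normal_density t * (t * G (r + t *\<^sub>R axis k 1)) \<partial>lborel) =
        (\<integral>t. std_normal_density t * G' (r + t *\<^sub>R axis k 1) \<partial>lborel)"
    proof (rule std_normal_integration_by_parts)
      fix t
      have "((\<lambda>h. G ((r + t *\<^sub>R axis k 1) + h *\<^sub>R axis k 1)) has_real_derivative G' (r + t *\<^sub>R axis k 1)) (at 0)"
        by (rule der)
      then show "((\<lambda>t. G (r + t *\<^sub>R axis k 1)) has_real_derivative G' (r + t *\<^sub>R axis k 1)) (at t)"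
        using DERIV_shift[of "\<lambda>t. G (r + t *\<^sub>R axis k 1)" "G' (r + t *\<^sub>R axis k 1)" 0 t]
        by (simp add: algebra_simps)
      show "\<bar>G' (r + t *\<^sub>R axis k 1)\<bar> \<le> C" by (rule bound)
    next
      show "continuous_on UNIV (\<lambda>t. G' (r + t *\<^sub>R axis k 1))"
        by (rule continuous_on_compose2[OF cont(2)]) (auto intro!: continuous_intros)
    qed
    then show ?thesis unfolding Q using r by (simp add: integral_real_density)
  qed
  have ae: "AE r in P. r $ k = 0"
  proof -
    have "{r :: real ^ 'n. r $ k = 0} \<in> sets borel" by measurable
    then show ?thesis unfolding P_def by (subst AE_distr_iff) (auto simp: rest_def)
  qed
  have "(\<integral>r. (\<integral>t. (r + t *\<^sub>R axis k 1) $ k * G (r + t *\<^sub>R axis k 1) \<partial>Q) \<partial>P) =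
      (\<integral>r. (\<integral>t. G' (r + t *\<^sub>R axis k 1) \<partial>Q) \<partial>P)"
  proof (rule integral_cong_AE)
    have shift: "(\<lambda>x. fst x + snd x *\<^sub>R axis k 1) \<in> borel_measurable (P \<Otimes>\<^sub>M Q)"
    proof -
      have "fst \<in> borel_measurable (P \<Otimes>\<^sub>M Q)" "snd \<in> borel_measurable (P \<Otimes>\<^sub>M Q)"
        using measurable_fst[of P Q] measurable_snd[of P Q] by (simp_all add: P_def Q_def)
      then show ?thesis by (intro borel_measurable_add borel_measurable_scaleR) simp_all
    qed
    have inner_meas: "(\<lambda>r. \<integral>t. F (r + t *\<^sub>R axis k 1) \<partial>Q) \<in> borel_measurable P"
      if "F \<in> borel_measurable borel" for F :: "real ^ 'n \<Rightarrow> real"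
      using measurable_compose[OF shift that]
      by (intro Q.borel_measurable_lebesgue_integral) (simp add: case_prod_beta')
    have "(\<lambda>z. z $ k * G z) \<in> borel_measurable borel"
      by (intro borel_measurable_times borel_measurable_continuous_onI continuous_intros cont)
    from inner_meas[OF this] inner_meas[of G']
    show "(\<lambda>r. \<integral>t. (r + t *\<^sub>R axis k 1) $ k * G (r + t *\<^sub>R axis k 1) \<partial>Q) \<in> borel_measurable P"
      "(\<lambda>r. \<integral>t. G' (r + t *\<^sub>R axis k 1) \<partial>Q) \<in> borel_measurable P"
      by simp_all
    show "AE r in P. (\<integral>t. (r + t *\<^sub>R axis k 1) $ k * G (r + t *\<^sub>R axis k 1) \<partial>Q) =
        (\<integral>t. G' (r + t *\<^sub>R axis k 1) \<partial>Q)"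
      using ae by eventually_elim (rule inner)
  qed
  moreover have "integrable N (\<lambda>\<omega>. G' (Z \<omega>))"
    using bound by (intro integrable_const_bound[where B = C]) auto
  ultimately show ?thesis
    using fubini[of "\<lambda>z. z $ k * G z"] fubini[of G'] int by simp
qed

end

section \<open>Interpolation\<close>

lemma l1_matrix_le: "l1 (R *v z) \<le> (\<Sum>i\<in>UNIV. \<Sum>k\<in>UNIV. \<bar>R $ i $ k\<bar>) * l1 (z :: real ^ 'n)"
proof -
  have "l1 (R *v z) \<le> (\<Sum>i\<in>UNIV. \<Sum>k\<in>UNIV. \<bar>R $ i $ k\<bar> * l1 z)"
    unfolding l1_def[of "R *v z"]
  proof (rule sum_mono)
    fix i
    have "\<bar>\<Sum>k\<in>UNIV. R $ i $ k * z $ k\<bar> \<le> (\<Sum>k\<in>UNIV. \<bar>R $ i $ k\<bar> * l1 z)"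
      by (intro order_trans[OF sum_abs] sum_mono) (simp add: abs_mult mult_left_mono component_le_l1)
    then show "\<bar>(R *v z) $ i\<bar> \<le> (\<Sum>k\<in>UNIV. \<bar>R $ i $ k\<bar> * l1 z)"
      by (simp add: matrix_vector_mult_def)
  qed
  then show ?thesis by (simp add: sum_distrib_right)
qed

lemma borel_measurable_l1 [measurable]: "l1 \<in> borel_measurable (borel :: (real ^ 'n) measure)"
  unfolding l1_def by measurable

lemma integrable_normal_l1:
  fixes Z :: "'b \<Rightarrow> real ^ 'n"
  assumes "std_normal_vector N Z"
  shows "integrable N (\<lambda>\<omega>. l1 (R *v Z \<omega> :: real ^ 'm))" "integrable N (\<lambda>\<omega>. (l1 (R *v Z \<omega> :: real ^ 'm)) ^ 2)"
proof -
  interpret prob_space N using assms by (simp add: std_normal_vector_def)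
  note [measurable] = normal_measurable[OF assms]
  have meas: "(\<lambda>\<omega>. R *v Z \<omega>) \<in> borel_measurable N"
    by (rule measurable_compose[OF normal_measurable[OF assms]])
      (intro borel_measurable_continuous_onI linear_continuous_on matrix_vector_mul_bounded_linear)
  then have [measurable]: "(\<lambda>\<omega>. l1 (R *v Z \<omega>)) \<in> borel_measurable N" by measurable
  define r where "r = (\<Sum>i\<in>UNIV. \<Sum>k\<in>UNIV. \<bar>R $ i $ k\<bar>)"
  have r: "r \<ge> 0" by (simp add: r_def sum_nonneg)
  have sq: "(l1 (R *v z)) ^ 2 \<le> r ^ 2 * (real CARD('n) * (\<Sum>k\<in>UNIV. (z $ k) ^ 2))" for z
  proof -
    have "l1 (R *v z) \<le> r * l1 z" using l1_matrix_le[of R z] by (simp add: r_def)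
    then have "(l1 (R *v z)) ^ 2 \<le> (r * l1 z) ^ 2" by (rule power_mono) simp
    also have "\<dots> = r ^ 2 * (\<Sum>k\<in>UNIV. \<bar>z $ k\<bar> * 1) ^ 2" by (simp add: l1_def power_mult_distrib)
    also have "\<dots> \<le> r ^ 2 * ((\<Sum>k\<in>UNIV. \<bar>z $ k\<bar> ^ 2) * (\<Sum>k\<in>(UNIV :: 'n set). 1 ^ 2))"
      by (intro mult_left_mono Cauchy_Schwarz_ineq_sum) simp
    finally show ?thesis by (simp add: mult.commute)
  qed
  show 2: "integrable N (\<lambda>\<omega>. (l1 (R *v Z \<omega>)) ^ 2)"
  proof (rule Bochner_Integration.integrable_bound)
    show "integrable N (\<lambda>\<omega>. r ^ 2 * (real CARD('n) * (\<Sum>k\<in>UNIV. (Z \<omega> $ k) ^ 2)))"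
      using integrable_normal_component_squared[OF assms] by simp
    show "AE \<omega> in N. norm ((l1 (R *v Z \<omega>)) ^ 2) \<le> norm (r ^ 2 * (real CARD('n) * (\<Sum>k\<in>UNIV. (Z \<omega> $ k) ^ 2)))"
      by (intro AE_I2) (simp only: real_norm_def abs_of_nonneg sq zero_le_power2 order_trans[OF _ abs_ge_self])
  qed simp
  show "integrable N (\<lambda>\<omega>. l1 (R *v Z \<omega>))"
    by (rule square_integrable_imp_integrable[OF _ 2]) simp
qed

text \<open>Provides the dominating functions for the Gaussian expectations; this is where a bound
  on second derivatives is used.\<close>

lemma quadratic_growth:
  fixes h :: "real ^ 'n \<Rightarrow> real"
  assumes "\<And>x. h differentiable (at x)" "\<And>i x. partial i h differentiable (at x)" "\<And>i j x. \<bar>partial j (partial i h) x\<bar> \<le> K"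
  obtains C where "\<And>i x. \<bar>partial i h x\<bar> \<le> C + K * l1 x" "\<And>x. \<bar>h x\<bar> \<le> \<bar>h 0\<bar> + C * l1 x + K * (l1 x) ^ 2" "0 \<le> C" "0 \<le> K"
proof -
  define C where "C = (\<Sum>i\<in>UNIV. \<bar>partial i h 0\<bar>)"
  have C: "\<bar>partial i h 0\<bar> \<le> C" for i
    unfolding C_def by (rule member_le_sum) auto
  have K: "0 \<le> K" using assms(3)[of undefined undefined undefined] by (meson abs_ge_zero order_trans)
  have lip: "\<bar>partial i h (x + v) - partial i h x\<bar> \<le> K * l1 v" for i x v
    by (rule lipschitz_of_partial_bound[OF assms(2,3)])
  have "\<bar>partial i h x\<bar> \<le> C + K * l1 x" for i x
    using lip[of i 0 x] C[of i] by simp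
  moreover have "\<bar>h x\<bar> \<le> \<bar>h 0\<bar> + C * l1 x + K * (l1 x) ^ 2" for x
  proof -
    have "\<bar>h (0 + x) - h 0 - (\<Sum>j\<in>UNIV. x $ j * partial j h 0)\<bar> \<le> K / 2 * (l1 x) ^ 2"
      using lip by (intro taylor_of_partial_lipschitz[OF assms(1)])
    moreover have "\<bar>\<Sum>j\<in>UNIV. x $ j * partial j h 0\<bar> \<le> l1 x * C"
      by (rule abs_sum_mult_le_l1) (rule C)
    moreover have "0 \<le> K * (l1 x) ^ 2" using K by simp
    moreover have "\<bar>u\<bar> \<le> \<bar>v\<bar> + c + k" if "\<bar>u - v - w\<bar> \<le> k / 2" "\<bar>w\<bar> \<le> c" "0 \<le> k" for u v w c k :: real
      using that by linarith
    ultimately show ?thesis by (simp add: mult.commute)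
  qed
  moreover have "0 \<le> C" by (simp add: C_def sum_nonneg)
  ultimately show ?thesis using that K by blast
qed

text \<open>The graph statistic is frozen at the value \<open>a\<close>. The velocity of the
  rotation is \<open>cos \<theta> *\<^sub>R a - sin \<theta> *\<^sub>R Y\<close>; integration by
  parts in \<open>Y\<close> yields another factor \<open>cos \<theta>\<close> and the matrix
  \<open>R ** R\<close>, so \<open>cos \<theta>\<close> factors out of the whole derivative.\<close>

lemma gaussian_interpolation_derivative:
  fixes h :: "real ^ 'n \<Rightarrow> real" and Z :: "'b \<Rightarrow> real ^ 'n" and a :: "real ^ 'n"
  assumes normal: "std_normal_vector N Z"
    and h: "\<And>x. h differentiable (at x)" "\<And>i x. partial i h differentiable (at x)"
      "\<And>i j. continuous_on UNIV (partial j (partial i h))" "\<And>i j x. \<bar>partial j (partial i h) x\<bar> \<le> K"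
    and R: "transpose R = R" "R ** R = S"
  defines "x \<equiv> \<lambda>\<theta> \<omega>. sin \<theta> *\<^sub>R a + cos \<theta> *\<^sub>R (R *v Z \<omega>)"
  shows "((\<lambda>\<theta>. \<integral>\<omega>. h (x \<theta> \<omega>) \<partial>N) has_real_derivative
     (\<integral>\<omega>. cos \<theta> * ((\<Sum>i\<in>UNIV. a $ i * partial i h (x \<theta> \<omega>)) -
        sin \<theta> * (\<Sum>i\<in>UNIV. \<Sum>j\<in>UNIV. S $ i $ j * partial j (partial i h) (x \<theta> \<omega>))) \<partial>N)) (at \<theta>)"
    and "integrable N (\<lambda>\<omega>. h (x \<theta> \<omega>))"
    and "integrable N (\<lambda>\<omega>. (\<Sum>i\<in>UNIV. a $ i * partial i h (x \<theta> \<omega>)) -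
        sin \<theta> * (\<Sum>i\<in>UNIV. \<Sum>j\<in>UNIV. S $ i $ j * partial j (partial i h) (x \<theta> \<omega>)))"
proof -
  interpret prob_space N using normal by (simp add: std_normal_vector_def)
  note [measurable] = normal_measurable[OF normal] normal_component_measurable[OF normal]
  define Y where "Y \<omega> = R *v Z \<omega>" for \<omega>
  have Y [measurable]: "Y \<in> borel_measurable N"
    unfolding Y_def by (rule measurable_compose[OF normal_measurable[OF normal]])
      (intro borel_measurable_continuous_onI linear_continuous_on matrix_vector_mul_bounded_linear)
  have [measurable]: "(\<lambda>\<omega>. Y \<omega> $ i) \<in> borel_measurable N" for i
    by (rule measurable_compose[OF Y borel_measurable_continuous_onI]) (intro continuous_intros)
  have x: "x \<theta> \<omega> = sin \<theta> *\<^sub>R a + cos \<theta> *\<^sub>R Y \<omega>" for \<theta> \<omega>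
    by (simp add: x_def Y_def)
  have x_meas [measurable]: "x \<theta> \<in> borel_measurable N" for \<theta>
    unfolding x by measurable
  have [measurable]: "h \<in> borel_measurable borel" "partial i h \<in> borel_measurable borel"
    "partial j (partial i h) \<in> borel_measurable borel" for i j
    by (rule borel_measurable_continuous_onI continuous_on_differentiable h)+
  obtain C where C: "\<And>i x. \<bar>partial i h x\<bar> \<le> C + K * l1 x" "\<And>x. \<bar>h x\<bar> \<le> \<bar>h 0\<bar> + C * l1 x + K * (l1 x) ^ 2"
    "0 \<le> C" "0 \<le> K"
    using quadratic_growth[OF h(1,2,4)] by blast
  \<comment> \<open>Dominates both the interpolating point and its velocity uniformly in the
    angle.\<close>
  define L where "L \<omega> = l1 a + l1 (Y \<omega>)" for \<omega>
  have L0: "0 \<le> L \<omega>" for \<omega> by (simp add: L_def)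
  have aL: "\<bar>a $ i\<bar> \<le> L \<omega>" and YL: "\<bar>Y \<omega> $ i\<bar> \<le> L \<omega>" for i \<omega>
    using component_le_l1[of a i] component_le_l1[of "Y \<omega>" i] l1_nonneg[of a] l1_nonneg[of "Y \<omega>"]
    unfolding L_def by linarith+
  have [measurable]: "L \<in> borel_measurable N" unfolding L_def by measurable
  have intL: "integrable N L" "integrable N (\<lambda>\<omega>. L \<omega> ^ 2)"
    unfolding L_def Y_def power2_sum using integrable_normal_l1[OF normal, of R] by simp_all
  have combL: "l1 (s *\<^sub>R a + t *\<^sub>R Y \<omega>) \<le> L \<omega>" if "\<bar>s\<bar> \<le> 1" "\<bar>t\<bar> \<le> 1" for s t \<omega>
  proof -
    have "l1 (s *\<^sub>R a + t *\<^sub>R Y \<omega>) \<le> \<bar>s\<bar> * l1 a + \<bar>t\<bar> * l1 (Y \<omega>)"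
      using l1_add[of "s *\<^sub>R a" "t *\<^sub>R Y \<omega>"] by simp
    also have "\<dots> \<le> 1 * l1 a + 1 * l1 (Y \<omega>)"
      using that by (intro add_mono mult_right_mono) auto
    finally show ?thesis by (simp add: L_def)
  qed
  have xL: "l1 (x \<theta> \<omega>) \<le> L \<omega>" for \<theta> \<omega>
    unfolding x by (rule combL) simp_all
  have hL: "\<bar>partial i h (x \<theta> \<omega>)\<bar> \<le> C + K * L \<omega>" for i \<theta> \<omega>
    using C(1)[of i "x \<theta> \<omega>"] mult_left_mono[OF xL C(4), of \<theta> \<omega>] by linarith
  show int_h: "integrable N (\<lambda>\<omega>. h (x \<theta> \<omega>))" for \<theta>
  proof (rule Bochner_Integration.integrable_bound)
    show "integrable N (\<lambda>\<omega>. \<bar>h 0\<bar> + C * L \<omega> + K * (L \<omega>) ^ 2)" using intL by simp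
    show "AE \<omega> in N. norm (h (x \<theta> \<omega>)) \<le> norm (\<bar>h 0\<bar> + C * L \<omega> + K * (L \<omega>) ^ 2)"
    proof (rule AE_I2)
      fix \<omega>
      have "\<bar>h (x \<theta> \<omega>)\<bar> \<le> \<bar>h 0\<bar> + C * l1 (x \<theta> \<omega>) + K * (l1 (x \<theta> \<omega>)) ^ 2" by (rule C(2))
      also have "\<dots> \<le> \<bar>h 0\<bar> + C * L \<omega> + K * (L \<omega>) ^ 2"
        using C(3,4) xL by (intro add_mono mult_left_mono power_mono) auto
      finally show "norm (h (x \<theta> \<omega>)) \<le> norm (\<bar>h 0\<bar> + C * L \<omega> + K * (L \<omega>) ^ 2)" by simp
    qed
  qed simp
  have bound_integrable: "integrable N F"
    if [measurable]: "F \<in> borel_measurable N" and F: "\<And>\<omega>. \<bar>F \<omega>\<bar> \<le> L \<omega> * (C + K * L \<omega>)" for F :: "'b \<Rightarrow> real"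
  proof (rule Bochner_Integration.integrable_bound)
    show "integrable N (\<lambda>\<omega>. C * L \<omega> + K * (L \<omega>) ^ 2)" using intL by simp
    show "AE \<omega> in N. norm (F \<omega>) \<le> norm (C * L \<omega> + K * (L \<omega>) ^ 2)"
    proof (rule AE_I2)
      fix \<omega>
      have "\<bar>F \<omega>\<bar> \<le> C * L \<omega> + K * (L \<omega>) ^ 2"
        using F[of \<omega>] by (simp add: algebra_simps power2_eq_square)
      then show "norm (F \<omega>) \<le> norm (C * L \<omega> + K * (L \<omega>) ^ 2)" by simp
    qed
  qed simp
  define D where "D \<theta> \<omega> = (\<Sum>i\<in>UNIV. (cos \<theta> *\<^sub>R a + (- sin \<theta>) *\<^sub>R Y \<omega>) $ i * partial i h (x \<theta> \<omega>))" for \<theta> \<omega>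
  have D_meas [measurable]: "D \<theta> \<in> borel_measurable N" for \<theta>
    unfolding D_def by (intro borel_measurable_sum borel_measurable_times) (auto intro: measurable_compose[OF x_meas])
  have DL: "\<bar>D \<theta> \<omega>\<bar> \<le> L \<omega> * (C + K * L \<omega>)" for \<theta> \<omega>
  proof -
    have "\<bar>D \<theta> \<omega>\<bar> \<le> l1 (cos \<theta> *\<^sub>R a + (- sin \<theta>) *\<^sub>R Y \<omega>) * (C + K * L \<omega>)"
      unfolding D_def by (rule abs_sum_mult_le_l1) (rule hL)
    also have "\<dots> \<le> L \<omega> * (C + K * L \<omega>)"
      using C L0 by (intro mult_right_mono combL) auto
    finally show ?thesis .
  qed
  have deriv: "((\<lambda>\<theta>. \<integral>\<omega>. h (x \<theta> \<omega>) \<partial>N) has_real_derivative (\<integral>\<omega>. D \<theta> \<omega> \<partial>N)) (at \<theta>)"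
  proof (rule has_real_derivative_integral[where g = D, OF int_h D_meas _ refl DL])
    fix \<theta> \<omega>
    show "((\<lambda>\<theta>. h (x \<theta> \<omega>)) has_real_derivative D \<theta> \<omega>) (at \<theta>)"
      unfolding D_def
    proof (rule has_real_derivative_along_curve[OF h(1)])
      show "((\<lambda>\<theta>. x \<theta> \<omega>) has_vector_derivative cos \<theta> *\<^sub>R a + (- sin \<theta>) *\<^sub>R Y \<omega>) (at \<theta>)"
        unfolding x by (auto intro!: derivative_eq_intros)
    qed
  next
    show "integrable N (\<lambda>\<omega>. L \<omega> * (C + K * L \<omega>))"
      by (rule bound_integrable) (use C L0 in auto)
  qed
  define c s where "c = cos \<theta>" and "s = sin \<theta>"
  have int1: "integrable N (\<lambda>\<omega>. a $ i * partial i h (x \<theta> \<omega>))" for i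
  proof (rule bound_integrable)
    show "\<bar>a $ i * partial i h (x \<theta> \<omega>)\<bar> \<le> L \<omega> * (C + K * L \<omega>)" for \<omega>
      unfolding abs_mult using aL hL L0 by (intro mult_mono) auto
  qed simp
  have int2: "integrable N (\<lambda>\<omega>. Y \<omega> $ i * partial i h (x \<theta> \<omega>))" for i
  proof (rule bound_integrable)
    show "\<bar>Y \<omega> $ i * partial i h (x \<theta> \<omega>)\<bar> \<le> L \<omega> * (C + K * L \<omega>)" for \<omega>
      unfolding abs_mult using YL hL L0 by (intro mult_mono) auto
  qed simp
  have int3: "integrable N (\<lambda>\<omega>. partial j (partial i h) (x \<theta> \<omega>))" for i j
    using h(4) by (intro integrable_const_bound[where B = K]) auto
  have int4: "integrable N (\<lambda>\<omega>. Z \<omega> $ k * partial i h (x \<theta> \<omega>))" for i k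
  proof (rule Bochner_Integration.integrable_bound)
    have lZ: "integrable N (\<lambda>\<omega>. (l1 (Z \<omega>)) ^ 2)" "integrable N (\<lambda>\<omega>. l1 (Z \<omega>))"
      using integrable_normal_l1[OF normal, of "mat 1"] by simp_all
    show "integrable N (\<lambda>\<omega>. C * l1 (Z \<omega>) + K * (((l1 (Z \<omega>)) ^ 2 + (L \<omega>) ^ 2)))"
      using lZ intL by simp
    show "AE \<omega> in N. norm (Z \<omega> $ k * partial i h (x \<theta> \<omega>)) \<le> norm (C * l1 (Z \<omega>) + K * (((l1 (Z \<omega>)) ^ 2 + (L \<omega>) ^ 2)))"
    proof (rule AE_I2)
      fix \<omega>
      have "\<bar>Z \<omega> $ k * partial i h (x \<theta> \<omega>)\<bar> \<le> l1 (Z \<omega>) * (C + K * L \<omega>)"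
        unfolding abs_mult using component_le_l1[of "Z \<omega>" k] hL[of i \<theta> \<omega>] by (intro mult_mono) auto
      also have "\<dots> = C * l1 (Z \<omega>) + K * (l1 (Z \<omega>) * L \<omega>)" by (simp add: algebra_simps)
      also have "\<dots> \<le> C * l1 (Z \<omega>) + K * ((l1 (Z \<omega>)) ^ 2 + (L \<omega>) ^ 2)"
      proof (intro add_left_mono mult_left_mono)
        have "0 \<le> (l1 (Z \<omega>) - L \<omega>) ^ 2" "0 \<le> (l1 (Z \<omega>)) ^ 2" "0 \<le> (L \<omega>) ^ 2" by simp_all
        then show "l1 (Z \<omega>) * L \<omega> \<le> (l1 (Z \<omega>)) ^ 2 + (L \<omega>) ^ 2"
          unfolding power2_diff by linarith
      qed (rule C(4))
      finally show "norm (Z \<omega> $ k * partial i h (x \<theta> \<omega>)) \<le> norm (C * l1 (Z \<omega>) + K * (((l1 (Z \<omega>)) ^ 2 + (L \<omega>) ^ 2)))"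
        by simp
    qed
  qed simp
  have ibp: "(\<integral>\<omega>. Z \<omega> $ k * partial i h (x \<theta> \<omega>) \<partial>N) = (\<Sum>j\<in>UNIV. c * R $ j $ k * (\<integral>\<omega>. partial j (partial i h) (x \<theta> \<omega>) \<partial>N))" for i k
  proof -
    let ?y = "\<lambda>z. s *\<^sub>R a + c *\<^sub>R (R *v z)"
    have y: "x \<theta> \<omega> = ?y (Z \<omega>)" for \<omega> by (simp add: x_def c_def s_def)
    have cont_y: "continuous_on UNIV ?y"
      by (intro continuous_intros linear_continuous_on matrix_vector_mul_bounded_linear)
    \<comment> \<open>The chain rule for \<open>?y\<close> along the \<open>k\<close>-th axis brings
      in \<open>c\<close> times the \<open>k\<close>-th column of \<open>R\<close>.\<close>
    have col: "(R *v axis k 1) $ j = R $ j $ k" for j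
      by (simp add: matrix_vector_mult_basis column_def)
    have "(\<integral>\<omega>. Z \<omega> $ k * partial i h (?y (Z \<omega>)) \<partial>N) =
        (\<integral>\<omega>. (\<Sum>j\<in>UNIV. c * R $ j $ k * partial j (partial i h) (?y (Z \<omega>))) \<partial>N)"
    proof (rule normal_vector_integration_by_parts[OF normal])
      fix z
      have "((\<lambda>t. ?y (z + t *\<^sub>R axis k 1)) has_vector_derivative c *\<^sub>R (R *v axis k 1)) (at 0)"
        by (auto intro!: derivative_eq_intros simp: matrix_vector_right_distrib matrix_vector_mult_scaleR scaleR_right_distrib mult.commute)
      from has_real_derivative_along_curve[OF h(2)[of i] this]
      show "((\<lambda>t. partial i h (?y (z + t *\<^sub>R axis k 1))) has_real_derivative
          (\<Sum>j\<in>UNIV. c * R $ j $ k * partial j (partial i h) (?y z))) (at 0)"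
        by (simp add: col)
      have "\<bar>\<Sum>j\<in>UNIV. c * R $ j $ k * partial j (partial i h) (?y z)\<bar> \<le> l1 (c *\<^sub>R (R *v axis k 1)) * K"
        using abs_sum_mult_le_l1[of "\<lambda>j. partial j (partial i h) (?y z)" K "c *\<^sub>R (R *v axis k 1)"] h(4) by (simp add: col)
      then show "\<bar>\<Sum>j\<in>UNIV. c * R $ j $ k * partial j (partial i h) (?y z)\<bar> \<le> l1 (c *\<^sub>R (R *v axis k 1)) * K" .
    next
      show "continuous_on UNIV (\<lambda>z. partial i h (?y z))"
        by (rule continuous_on_compose2[OF continuous_on_differentiable[OF h(2)] cont_y]) auto
      show "continuous_on UNIV (\<lambda>z. \<Sum>j\<in>UNIV. c * R $ j $ k * partial j (partial i h) (?y z))"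
        by (intro continuous_intros continuous_on_compose2[OF h(3) cont_y]) auto
      show "integrable N (\<lambda>\<omega>. Z \<omega> $ k * partial i h (?y (Z \<omega>)))"
        using int4 unfolding y .
    qed
    then show ?thesis
      unfolding y[symmetric] using int3 by simp
  qed
  have Sij: "S $ i $ j = (\<Sum>k\<in>UNIV. R $ i $ k * R $ j $ k)" for i j
  proof -
    have "R $ k $ j = R $ j $ k" for k
      using R(1) by (metis transpose_def vec_lambda_beta)
    then show ?thesis
      unfolding R(2)[symmetric] matrix_matrix_mult_def by simp
  qed
  have Yint: "(\<integral>\<omega>. Y \<omega> $ i * partial i h (x \<theta> \<omega>) \<partial>N) = c * (\<Sum>j\<in>UNIV. S $ i $ j * (\<integral>\<omega>. partial j (partial i h) (x \<theta> \<omega>) \<partial>N))" for i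
  proof -
    have "(\<integral>\<omega>. Y \<omega> $ i * partial i h (x \<theta> \<omega>) \<partial>N) = (\<integral>\<omega>. (\<Sum>k\<in>UNIV. R $ i $ k * (Z \<omega> $ k * partial i h (x \<theta> \<omega>))) \<partial>N)"
      by (simp add: Y_def matrix_vector_mult_def sum_distrib_right mult.assoc)
    also have "\<dots> = (\<Sum>k\<in>UNIV. R $ i $ k * (\<Sum>j\<in>UNIV. c * R $ j $ k * (\<integral>\<omega>. partial j (partial i h) (x \<theta> \<omega>) \<partial>N)))"
      using int4 by (simp add: ibp)
    also have "\<dots> = c * (\<Sum>j\<in>UNIV. S $ i $ j * (\<integral>\<omega>. partial j (partial i h) (x \<theta> \<omega>) \<partial>N))"
      unfolding Sij sum_distrib_left sum_distrib_right
      by (subst sum.swap) (simp add: mult_ac)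
    finally show ?thesis .
  qed
  show "integrable N (\<lambda>\<omega>. (\<Sum>i\<in>UNIV. a $ i * partial i h (x \<theta> \<omega>)) -
        sin \<theta> * (\<Sum>i\<in>UNIV. \<Sum>j\<in>UNIV. S $ i $ j * partial j (partial i h) (x \<theta> \<omega>)))"
    using int1 int3 by simp
  have "(\<integral>\<omega>. D \<theta> \<omega> \<partial>N) = (\<integral>\<omega>. c * (\<Sum>i\<in>UNIV. a $ i * partial i h (x \<theta> \<omega>)) - s * (\<Sum>i\<in>UNIV. Y \<omega> $ i * partial i h (x \<theta> \<omega>)) \<partial>N)"
    unfolding D_def by (simp add: c_def s_def algebra_simps sum_distrib_left sum_subtractf)
  also have "\<dots> = c * (\<Sum>i\<in>UNIV. \<integral>\<omega>. a $ i * partial i h (x \<theta> \<omega>) \<partial>N) - s * (\<Sum>i\<in>UNIV. \<integral>\<omega>. Y \<omega> $ i * partial i h (x \<theta> \<omega>) \<partial>N)"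
    using int1 int2 by simp
  also have "\<dots> = c * ((\<Sum>i\<in>UNIV. \<integral>\<omega>. a $ i * partial i h (x \<theta> \<omega>) \<partial>N) -
      s * (\<Sum>i\<in>UNIV. \<Sum>j\<in>UNIV. S $ i $ j * (\<integral>\<omega>. partial j (partial i h) (x \<theta> \<omega>) \<partial>N)))"
    unfolding Yint sum_distrib_left[symmetric] by (simp add: algebra_simps)
  also have "\<dots> = (\<integral>\<omega>. c * ((\<Sum>i\<in>UNIV. a $ i * partial i h (x \<theta> \<omega>)) -
      s * (\<Sum>i\<in>UNIV. \<Sum>j\<in>UNIV. S $ i $ j * partial j (partial i h) (x \<theta> \<omega>))) \<partial>N)"
    using int1 int3 by simp
  finally show "((\<lambda>\<theta>. \<integral>\<omega>. h (x \<theta> \<omega>) \<partial>N) has_real_derivative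
     (\<integral>\<omega>. cos \<theta> * ((\<Sum>i\<in>UNIV. a $ i * partial i h (x \<theta> \<omega>)) -
        sin \<theta> * (\<Sum>i\<in>UNIV. \<Sum>j\<in>UNIV. S $ i $ j * partial j (partial i h) (x \<theta> \<omega>))) \<partial>N)) (at \<theta>)"
    using deriv by (simp add: c_def s_def)
qed

text \<open>The quadratic form at \<open>x\<close> is the second moment of the inner product of
  \<open>x\<close> with the centred statistics.\<close>

lemma sym_nonneg_definite_Sigma1:
  assumes "n \<ge> 3" "0 \<le> p" "p \<le> 1"
  shows "sym_nonneg_definite (Sigma1 n p)"
proof -
  let ?E = "bern_ex p (pairs n)" and ?W = "centred_stats n p"
  have S: "Sigma1 n p $ i $ j = ?E (\<lambda>A. ?W A $ i * ?W A $ j)" for i j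
    using assms(1) by (simp add: bern_ex_stein_matrix_Sigma1[symmetric] bern_ex_stein_matrix)
  have "transpose (Sigma1 n p) = Sigma1 n p"
    by (simp add: vec_eq_iff transpose_def S mult.commute)
  moreover have "0 \<le> x \<bullet> (Sigma1 n p *v x)" for x
  proof -
    have "x \<bullet> (Sigma1 n p *v x) = (\<Sum>i\<in>UNIV. \<Sum>j\<in>UNIV. ?E (\<lambda>A. x $ i * x $ j * (?W A $ i * ?W A $ j)))"
      by (simp add: inner_vec_def matrix_vector_mult_def S sum_distrib_left bern_ex_cmult mult_ac)
    also have "\<dots> = ?E (\<lambda>A. (\<Sum>i\<in>UNIV. x $ i * ?W A $ i) * (\<Sum>j\<in>UNIV. x $ j * ?W A $ j))"
      unfolding sum_product bern_ex_sum by (simp add: mult_ac)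
    also have "\<dots> \<ge> ?E (\<lambda>A. 0)"
      by (rule bern_ex_mono[OF assms(2,3)]) simp
    finally show ?thesis by (simp add: bern_ex_const)
  qed
  ultimately show ?thesis by (simp add: sym_nonneg_definite_def)
qed

text \<open>With the Gaussian point frozen, the graph expectation of the derivative is what
  \<open>graph_stein_bound\<close> controls, with \<open>s = sin \<theta>\<close> and with the
  partial derivatives of \<open>h\<close> as \<open>G\<close> and \<open>H\<close>. The Gaussian
  integral is taken only afterwards.\<close>

lemma graph_gaussian_comparison:
  fixes h :: "real ^ 3 \<Rightarrow> real" and Z :: "'b \<Rightarrow> real ^ 3"
  assumes n: "n \<ge> 3" and p: "0 \<le> p" "p \<le> 1" and normal: "std_normal_vector N Z"
    and h: "times_differentiable 3 h" and K2: "\<And>i j x. \<bar>partial j (partial i h) x\<bar> \<le> K'"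
    and K: "\<And>i j k x. \<bar>partial k (partial j (partial i h)) x\<bar> \<le> K"
  shows "\<bar>bern_ex p (pairs n) (\<lambda>A. h (centred_stats n p A)) -
      (\<integral>\<omega>. h (sqrt_matrix (Sigma1 n p) *v Z \<omega>) \<partial>N)\<bar> \<le> 7 * K / (3 * n)"
proof -
  interpret prob_space N using normal by (simp add: std_normal_vector_def)
  let ?E = "bern_ex p (pairs n)" and ?W = "centred_stats n p" and ?S = "Sigma1 n p"
  define R where "R = sqrt_matrix ?S"
  have R: "transpose R = R" "R ** R = ?S"
    using sqrt_matrix_works[OF sym_nonneg_definite_Sigma1[OF n p]] by (simp_all add: R_def)
  have n2: "n \<ge> 2" using n by simp
  have K0: "0 \<le> K" using K[of undefined undefined undefined undefined] by (meson abs_ge_zero order_trans)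
  have d: "\<And>x. h differentiable (at x)" "\<And>i x. partial i h differentiable (at x)"
    "\<And>i j x. partial j (partial i h) differentiable (at x)"
    using h by (simp_all add: numeral_3_eq_3)
  have cont: "continuous_on UNIV (partial j (partial i h))" for i j
    by (rule continuous_on_differentiable) (rule d)
  have lip: "\<bar>partial j (partial i h) (x + v) - partial j (partial i h) x\<bar> \<le> K * l1 v" for i j x v
    by (rule lipschitz_of_partial_bound[OF d(3) K])
  have taylor: "\<bar>partial i h (x + v) - partial i h x - (\<Sum>j\<in>UNIV. v $ j * partial j (partial i h) x)\<bar> \<le> K / 2 * (l1 v) ^ 2" for i x v
    by (rule taylor_of_partial_lipschitz[OF d(2) lip])
  define x where "x A \<theta> \<omega> = sin \<theta> *\<^sub>R ?W A + cos \<theta> *\<^sub>R (R *v Z \<omega>)" for A \<theta> \<omega>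
  define T where "T A \<theta> \<omega> = (\<Sum>i\<in>UNIV. ?W A $ i * partial i h (x A \<theta> \<omega>)) -
        sin \<theta> * (\<Sum>i\<in>UNIV. \<Sum>j\<in>UNIV. ?S $ i $ j * partial j (partial i h) (x A \<theta> \<omega>))" for A \<theta> \<omega>
  define \<phi> where "\<phi> \<theta> = ?E (\<lambda>A. \<integral>\<omega>. h (x A \<theta> \<omega>) \<partial>N)" for \<theta>
  note interp = gaussian_interpolation_derivative[OF normal d(1,2) cont K2 R, folded x_def T_def]
  have int_T: "integrable N (T A \<theta>)" for A \<theta>
    using interp(3)[of "?W A" \<theta>] unfolding x_def T_def .
  have T_bound: "\<bar>?E (\<lambda>A. T A \<theta> \<omega>)\<bar> \<le> 7 * K * (sin \<theta>) ^ 2 / n" if \<theta>: "0 \<le> sin \<theta>" for \<theta> \<omega>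
  proof -
    let ?s = "sin \<theta>"
    have step: "x (insert e A) \<theta> \<omega> = x (A - {e}) \<theta> \<omega> + ?s *\<^sub>R flip_diff n e A" if "e \<in> pairs n" for e A
      using centred_stats_flip[OF n2 that, of p A] by (simp add: x_def algebra_simps)
    have "\<bar>?E (\<lambda>A. \<Sum>i\<in>UNIV. ?W A $ i * partial i h (x A \<theta> \<omega>)) -
       ?s * (\<Sum>i\<in>UNIV. \<Sum>j\<in>UNIV. ?E (\<lambda>A. stein_matrix n p A i j) * ?E (\<lambda>A. partial j (partial i h) (x A \<theta> \<omega>)))\<bar>
       \<le> 7 * K * ?s ^ 2 / n"
    proof (rule graph_stein_bound[OF n2 p K0 \<theta>])
      fix i e A assume e: "e \<in> pairs n" and A: "A \<subseteq> pairs n"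
      let ?v = "?s *\<^sub>R flip_diff n e A"
      let ?x1 = "x (insert e A) \<theta> \<omega>" and ?x0 = "x (A - {e}) \<theta> \<omega>"
      have l1: "l1 ?v = ?s * l1 (flip_diff n e A)" using \<theta> by simp
      have sum: "(\<Sum>j\<in>UNIV. ?v $ j * y j) = ?s * (\<Sum>j\<in>UNIV. flip_diff n e A $ j * y j)" for y
        by (simp add: sum_distrib_left mult.assoc)
      show "\<bar>partial i h ?x1 - partial i h ?x0 -
          ?s * (\<Sum>j\<in>UNIV. flip_diff n e A $ j * partial j (partial i h) (x A \<theta> \<omega>))\<bar>
          \<le> K / 2 * (?s * l1 (flip_diff n e A)) ^ 2"
      \<comment> \<open>The expansion must start at \<open>A\<close>, which is the upper or the
        lower endpoint of the flip; in the first case it runs backwards along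
        \<open>- ?v\<close>.\<close>
      proof (cases "e \<in> A")
        case True
        then have x1: "x A \<theta> \<omega> = ?x1" by (simp add: insert_absorb)
        have x0: "?x0 = ?x1 + (- ?v)" using step[OF e] by simp
        have l1': "l1 (- ?v) = ?s * l1 (flip_diff n e A)"
          using l1_scaleR[of "-1" ?v] l1 by simp
        have sum': "(\<Sum>j\<in>UNIV. (- ?v) $ j * y j) = - (?s * (\<Sum>j\<in>UNIV. flip_diff n e A $ j * y j))" for y
          by (simp add: sum_distrib_left sum_negf mult.assoc)
        have "\<bar>partial i h ?x0 - partial i h ?x1 + ?s * (\<Sum>j\<in>UNIV. flip_diff n e A $ j * partial j (partial i h) ?x1)\<bar>
          \<le> K / 2 * (?s * l1 (flip_diff n e A)) ^ 2"
          using taylor[of i ?x1 "- ?v"] unfolding x0[symmetric] l1' sum' by simp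
        then show ?thesis unfolding x1 by linarith
      next
        case False
        then have "x A \<theta> \<omega> = ?x0" by simp
        then show ?thesis
          using taylor[of i ?x0 ?v] unfolding step[OF e, symmetric] l1 sum by simp
      qed
      fix j
      show "\<bar>partial j (partial i h) ?x1 - partial j (partial i h) ?x0\<bar> \<le> K * (?s * l1 (flip_diff n e A))"
        using lip[of j i ?x0 ?v] unfolding step[OF e, symmetric] l1 .
    qed
    moreover have "?E (\<lambda>A. T A \<theta> \<omega>) = ?E (\<lambda>A. \<Sum>i\<in>UNIV. ?W A $ i * partial i h (x A \<theta> \<omega>)) -
       ?s * (\<Sum>i\<in>UNIV. \<Sum>j\<in>UNIV. ?E (\<lambda>A. stein_matrix n p A i j) * ?E (\<lambda>A. partial j (partial i h) (x A \<theta> \<omega>)))"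
      unfolding T_def bern_ex_diff bern_ex_cmult bern_ex_stein_matrix_Sigma1[OF n]
      by (simp add: bern_ex_sum bern_ex_cmult)
    ultimately show ?thesis by simp
  qed
  have deriv: "(\<phi> has_real_derivative cos \<theta> * (\<integral>\<omega>. ?E (\<lambda>A. T A \<theta> \<omega>) \<partial>N)) (at \<theta>)" for \<theta>
  proof -
    have "((\<lambda>\<theta>. \<integral>\<omega>. h (x A \<theta> \<omega>) \<partial>N) has_real_derivative cos \<theta> * (\<integral>\<omega>. T A \<theta> \<omega> \<partial>N)) (at \<theta>)" for A
      using interp(1)[of "?W A" \<theta>] unfolding x_def T_def by simp
    then have "(\<phi> has_real_derivative ?E (\<lambda>A. cos \<theta> * (\<integral>\<omega>. T A \<theta> \<omega> \<partial>N))) (at \<theta>)"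
      unfolding \<phi>_def bern_ex_def by (intro DERIV_sum DERIV_cmult)
    also have "?E (\<lambda>A. cos \<theta> * (\<integral>\<omega>. T A \<theta> \<omega> \<partial>N)) = cos \<theta> * (\<integral>\<omega>. ?E (\<lambda>A. T A \<theta> \<omega>) \<partial>N)"
      unfolding bern_ex_cmult using int_T by (simp add: bern_ex_def)
    finally show ?thesis .
  qed
  have int_bound: "\<bar>\<integral>\<omega>. ?E (\<lambda>A. T A \<theta> \<omega>) \<partial>N\<bar> \<le> 7 * K * (sin \<theta>) ^ 2 / n" if \<theta>: "0 \<le> sin \<theta>" for \<theta>
  proof -
    have int: "integrable N (\<lambda>\<omega>. ?E (\<lambda>A. T A \<theta> \<omega>))"
      unfolding bern_ex_def using int_T by simp
    have "- (7 * K * (sin \<theta>) ^ 2 / n) \<le> ?E (\<lambda>A. T A \<theta> \<omega>)" "?E (\<lambda>A. T A \<theta> \<omega>) \<le> 7 * K * (sin \<theta>) ^ 2 / n" for \<omega>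
      using T_bound[OF \<theta>, of \<omega>] by (simp_all add: abs_le_iff)
    then show ?thesis
      using integral_le_const[OF int, of "7 * K * (sin \<theta>) ^ 2 / n"] integral_ge_const[OF int, of "- (7 * K * (sin \<theta>) ^ 2 / n)"]
      by (simp add: abs_le_iff)
  qed
  define B where "B = 7 * K / n"
  \<comment> \<open>The derivative of \<open>B / 3 * (sin \<theta>) ^ 3\<close> is
    \<open>B * (sin \<theta>) ^ 2 * cos \<theta>\<close>, the bound on the derivative of
    \<open>\<phi>\<close>. Comparing monotone functions, once per sign, replaces integrating that
    derivative.\<close>
  have mono: "\<sigma> * \<phi> (pi / 2) - B / 3 * (sin (pi / 2)) ^ 3 \<le> \<sigma> * \<phi> 0 - B / 3 * (sin 0) ^ 3" if \<sigma>: "\<bar>\<sigma>\<bar> = 1" for \<sigma>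
  proof (rule DERIV_nonpos_imp_nonincreasing[of 0 "pi / 2"])
    fix \<theta> :: real assume \<theta>: "0 \<le> \<theta>" "\<theta> \<le> pi / 2"
    have s: "0 \<le> sin \<theta>" and c: "0 \<le> cos \<theta>"
      using \<theta> by (auto intro: sin_ge_zero cos_ge_zero)
    let ?J = "\<integral>\<omega>. ?E (\<lambda>A. T A \<theta> \<omega>) \<partial>N"
    have "((\<lambda>\<theta>. \<sigma> * \<phi> \<theta> - B / 3 * (sin \<theta>) ^ 3) has_real_derivative cos \<theta> * (\<sigma> * ?J - B * (sin \<theta>) ^ 2)) (at \<theta>)"
      by (rule derivative_eq_intros deriv refl | simp)+ (simp add: algebra_simps power2_eq_square)
    moreover have "\<sigma> * ?J \<le> B * (sin \<theta>) ^ 2"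
    proof -
      have "\<sigma> * ?J \<le> \<bar>\<sigma> * ?J\<bar>" by simp
      also have "\<dots> = \<bar>?J\<bar>" using \<sigma> by (simp only: abs_mult)
      finally show ?thesis using int_bound[OF s] by (simp add: B_def)
    qed
    ultimately show "\<exists>y. ((\<lambda>\<theta>. \<sigma> * \<phi> \<theta> - B / 3 * (sin \<theta>) ^ 3) has_real_derivative y) (at \<theta>) \<and> y \<le> 0"
      using c by (intro exI[of _ "cos \<theta> * (\<sigma> * ?J - B * (sin \<theta>) ^ 2)"]) (simp add: mult_nonneg_nonpos)
  qed simp
  have "\<phi> (pi / 2) - B / 3 \<le> \<phi> 0" "- \<phi> (pi / 2) - B / 3 \<le> - \<phi> 0"
    using mono[of 1] mono[of "-1"] by simp_all
  then have "\<bar>\<phi> (pi / 2) - \<phi> 0\<bar> \<le> B / 3"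
    by (intro abs_leI) linarith+
  \<comment> \<open>At \<open>pi / 2\<close> the Gaussian part has vanished; at 0 the graph part
    has.\<close>
  moreover have "\<phi> (pi / 2) = ?E (\<lambda>A. h (?W A))"
    by (simp add: \<phi>_def x_def prob_space)
  moreover have "\<phi> 0 = (\<integral>\<omega>. h (R *v Z \<omega>) \<partial>N)"
    by (simp add: \<phi>_def x_def bern_ex_const)
  ultimately show ?thesis by (simp add: B_def R_def)
qed

lemma ennreal_times_top_divide:
  "n > 0 \<Longrightarrow> x > 0 \<Longrightarrow> \<top> / of_nat n * ennreal x = \<top>"
  by (simp add: ennreal_of_nat_eq_real_of_nat divide_ennreal_def inverse_ennreal ennreal_mult_eq_top_iff)

theorem proposition5p2:
  fixes n :: nat and p :: real
    and M :: "'a measure" and I :: "nat set \<Rightarrow> 'a \<Rightarrow> real"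
    and N :: "'b measure" and Z :: "'b \<Rightarrow> real ^ 3"
  assumes "n \<ge> 4" and "0 < p" and "p < 1"
    and "bernoulli_random_graph M n p I"
    and "std_normal_vector N Z"
  shows "covariance_matrix M (W1 M n I) = Sigma1 n p \<and>
    (\<forall>h :: real ^ 3 \<Rightarrow> real. times_differentiable 3 h \<longrightarrow>
       ennreal \<bar>(\<integral>\<omega>. h (W1 M n I \<omega>) \<partial>M) - (\<integral>\<omega>. h (sqrt_matrix (Sigma1 n p) *v Z \<omega>) \<partial>N)\<bar>
       \<le> deriv_norm2 h / of_nat n * ennreal (35 / 4 + 9 / real n)
         + 8 * deriv_norm3 h / (3 * of_nat n) * ennreal (1 + 1 / real n + 1 / real n ^ 2))"
proof (intro conjI allI impI)
  have n: "n \<ge> 3" "n \<ge> 2" "real n > 0" and p: "0 \<le> p" "p \<le> 1"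
    using assms by auto
  show "covariance_matrix M (W1 M n I) = Sigma1 n p"
    by (rule covariance_matrix_W1[OF assms(4) n(1) p])
  fix h :: "real ^ 3 \<Rightarrow> real" assume h: "times_differentiable 3 h"
  let ?d = "\<bar>(\<integral>\<omega>. h (W1 M n I \<omega>) \<partial>M) - (\<integral>\<omega>. h (sqrt_matrix (Sigma1 n p) *v Z \<omega>) \<partial>N)\<bar>"
  let ?c2 = "35 / 4 + 9 / real n" and ?c3 = "1 + 1 / real n + 1 / real n ^ 2"
  have c: "?c2 > 0" "?c3 \<ge> 1" using n by (auto intro!: add_pos_nonneg)
  have three_n: "3 * of_nat n = (of_nat (3 * n) :: ennreal)" by simp
  \<comment> \<open>An infinite seminorm has a positive coefficient and makes the right-hand side
    infinite; otherwise both provide real bounds.\<close>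
  consider "deriv_norm2 h = \<top>" | "deriv_norm3 h = \<top>" | "deriv_norm2 h < \<top>" "deriv_norm3 h < \<top>"
    by (metis top.not_eq_extremum)
  then show "ennreal ?d \<le> deriv_norm2 h / of_nat n * ennreal ?c2 + 8 * deriv_norm3 h / (3 * of_nat n) * ennreal ?c3"
  proof cases
    case 1
    then show ?thesis using ennreal_times_top_divide[of n ?c2] n c by simp
  next
    case 2
    have "8 * \<top> / (3 * of_nat n) * ennreal ?c3 = \<top>"
      unfolding three_n using ennreal_times_top_divide[of "3 * n" ?c3] n c by (simp add: ennreal_mult_top)
    then show ?thesis using 2 by simp
  next
    case 3
    define K where "K = enn2real (deriv_norm3 h)"
    have K: "deriv_norm3 h = ennreal K" "0 \<le> K" using 3 by (simp_all add: K_def)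
    have "h \<in> borel_measurable borel"
      using h by (intro borel_measurable_continuous_onI continuous_on_differentiable) (simp add: numeral_3_eq_3)
    then have "(\<integral>\<omega>. h (W1 M n I \<omega>) \<partial>M) = bern_ex p (pairs n) (\<lambda>A. h (centred_stats n p A))"
      by (rule integral_W1[OF assms(4) n(2) p])
    then have "?d \<le> 7 * K / (3 * n)"
      using graph_gaussian_comparison[OF n(1) p assms(5) h partial_bound2[OF 3(1)] partial_bound3[OF 3(2)]]
      by (simp add: K_def)
    \<comment> \<open>Uses 7 \<le> 8 and \<open>?c3 \<ge> 1\<close>; the nonnegative
      \<open>deriv_norm2\<close> summand is added at the end.\<close>
    also have "\<dots> \<le> 8 * K / (3 * n) * ?c3"
    proof -
      have "7 * K / (3 * n) \<le> 8 * K / (3 * n) * 1"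
        using K n by (simp add: divide_right_mono)
      also have "\<dots> \<le> 8 * K / (3 * n) * ?c3"
        using K n c by (intro mult_left_mono) auto
      finally show ?thesis .
    qed
    finally have "ennreal ?d \<le> ennreal (8 * K / (3 * n) * ?c3)"
      by (rule ennreal_leI)
    also have "\<dots> = 8 * deriv_norm3 h / (3 * of_nat n) * ennreal ?c3"
    proof -
      have "8 * deriv_norm3 h = ennreal (8 * K)"
        by (simp add: K(1) ennreal_mult')
      moreover have "(3 * of_nat n :: ennreal) = ennreal (3 * real n)"
        by (simp add: ennreal_mult' ennreal_of_nat_eq_real_of_nat)
      moreover have "ennreal (8 * K) / ennreal (3 * real n) = ennreal (8 * K / (3 * n))"
        using K(2) n(3) by (subst divide_ennreal) auto
      moreover have "ennreal (8 * K / (3 * n) * ?c3) = ennreal (8 * K / (3 * n)) * ennreal ?c3"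
        using K(2) c by (intro ennreal_mult) auto
      ultimately show ?thesis by (simp only:)
    qed
    finally show ?thesis by (rule order_trans) simp
  qed
qed

end
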